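(* Let $\mathbf{a}^{(0)}=(1,1)$ and $\mathbf{a}^{(1)}=(1)$. Let $M^{(0)}=M$ and let $M^{(1)}$ be the set of elements of $M$ which end with a letter in $S$. Then for any $\varepsilon\in\{0,1\}$, the map $$M^{(\varepsilon)}\longrightarrow\mathcal{F}^{(\varepsilon)},\qquad w\mapsto w(\mathbf{a}^{(\varepsilon)}),$$ is bijective.
   Context: $\Bbbk$ is an algebraically closed field of characteristic zero; $\mathbb{N}=\{0,1,2,\dots\}$, $\mathbb{N}^*=\mathbb{N}\setminus\{0\}$. For $n\in\mathbb{N}^*$, $\mathcal{C}_n$ is the set of compositions of $n$ (finite sequences $(a_1,\dots,a_r)$, $r\ge1$, of positive integers with sum $n$), and $\mathcal{C}=\bigcup_{n\in\mathbb{N}^*}\mathcal{C}_n$. For $\mathbf{a}\in\mathcal{C}_n$, $\mathfrak{p}_{\mathbf{a}}$ is the standard parabolic subalgebra of $\mathrm{sl}_n(\Bbbk)$ consisting of trace-zero block upper triangular matrices with diagonal block sizes $a_1,\dots,a_r$. The index of a Lie algebra $\mathfrak{g}$ is $\mathrm{ind}(\mathfrak{g})=\min_{f\in\mathfrak{g}^*}\dim\{x\in\mathfrak{g}: f([x,y])=0\ \forall y\in\mathfrak{g}\}$. Let $\mathcal{F}_n=\{\mathbf{a}\in\mathcal{C}_n : \mathrm{ind}(\mathfrak{p}_{\mathbf{a}})=0\}$ and, for $\varepsilon\in\{0,1\}$, $\mathcal{F}^{(\varepsilon)}=\bigcup_{n\in\mathbb{N}^*}\mathcal{F}_{2n+\varepsilon}$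 (so $\mathcal{F}_1$ is left out). Operators on $\mathcal{C}$: for $m\in\mathbb{N}$ and $\mathbf{a}=(a_1,\dots,a_r)\in\mathcal{C}$, - $\theta(\mathbf{a})=(a_r,\dots,a_1)$; - $\sigma_m(\mathbf{a})=((m+2)a_1,a_2,\dots,a_r,(m+1)a_1)$; - $\tau_m(\mathbf{a})=((m+1)a_1+(m+2)a_2,a_3,\dots,a_r,ma_1+(m+1)a_2)$ if $r>1$, and $\tau_m(\mathbf{a})=\mathbf{a}$ if $r=1$; - $\widetilde{\sigma}_m=\theta\sigma_m$, $\widetilde{\tau}_m=\theta\tau_m$. Let $S=\{\sigma_m,\widetilde{\sigma}_m : m\in\mathbb{N}\}$, $T=\{\tau_m,\widetilde{\tau}_m : m\in\mathbb{N}\}$, $A=S\cup T$, and let $M$ be the submonoid generated by $A$ in the monoid (under composition) of maps $\mathcal{C}\to\mathcal{C}$. The monoid $M$ is free on the alphabet $A$, so each element is a unique word $\eta_1\cdots\eta_k$ with $\eta_i\in A$ (acting by composition, $\eta_k$ applied first); such a word with $k\ge1$ ends with the letter $\eta_k$ (the empty word has no last letter). *)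

theory Defs
  imports "HOL-Computational_Algebra.Computational_Algebra" "Jordan_Normal_Form.VS_Connect"
begin

section \<open>Compositions\<close>

typedef composition = "{a :: nat list. a \<noteq> [] \<and> (\<forall>x\<in>set a. 0 < x)}"
  morphisms parts Composition
  by (rule exI[of _ "[1]"]) simp

setup_lifting type_definition_composition

definition csize :: "composition \<Rightarrow> nat" where
  "csize a = sum_list (parts a)"

section \<open>Index of a Lie algebra of matrices\<close>

definition lie_bracket :: "'k::field mat \<Rightarrow> 'k mat \<Rightarrow> 'k mat" where
  "lie_bracket X Y = X * Y - Y * X"

text \<open>An element of the dual of \<open>\<g>\<close> is represented by any function that is linear on \<open>\<g>\<close>;
  its values outside \<open>\<g>\<close> play no role below.\<close>

definition linear_form_on :: "'k::field mat set \<Rightarrow> ('k mat \<Rightarrow> 'k) \<Rightarrow> bool" where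
  "linear_form_on \<g> f \<longleftrightarrow>
     (\<forall>X\<in>\<g>. \<forall>Y\<in>\<g>. f (X + Y) = f X + f Y) \<and> (\<forall>c. \<forall>X\<in>\<g>. f (c \<cdot>\<^sub>m X) = c * f X)"

definition form_kernel :: "'k::field mat set \<Rightarrow> ('k mat \<Rightarrow> 'k) \<Rightarrow> 'k mat set" where
  "form_kernel \<g> f = {X \<in> \<g>. \<forall>Y\<in>\<g>. f (lie_bracket X Y) = 0}"

definition mat_subspace_dim :: "nat \<Rightarrow> 'k::field mat set \<Rightarrow> nat" where
  "mat_subspace_dim n W =
     vectorspace.dim class_ring (module_mat TYPE('k) n n \<lparr>carrier := W\<rparr>)"

text \<open>Here \<open>\<g>\<close> is meant to be a Lie subalgebra of the \<open>n \<times> n\<close> matrices.\<close>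

definition lie_index :: "nat \<Rightarrow> 'k::field mat set \<Rightarrow> nat" where
  "lie_index n \<g> = (LEAST d. \<exists>f. linear_form_on \<g> f \<and> d = mat_subspace_dim n (form_kernel \<g> f))"

section \<open>Standard parabolic subalgebras of the special linear Lie algebra\<close>

text \<open>Indices are 0-based: \<open>block_of a i\<close> is the \<open>k\<close> with
  \<open>a\<^sub>1 + \<dots> + a\<^sub>k \<le> i < a\<^sub>1 + \<dots> + a\<^sub>k + a\<^sub>k\<^sub>+\<^sub>1\<close>, for \<open>i < csize a\<close>.\<close>

definition block_of :: "composition \<Rightarrow> nat \<Rightarrow> nat" where
  "block_of a i = (LEAST k. i < sum_list (take (Suc k) (parts a)))"

definition parabolic :: "composition \<Rightarrow> 'k::field mat set" where
  "parabolic a = {X \<in> carrier_mat (csize a) (csize a).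
     (\<Sum>i<csize a. X $$ (i, i)) = 0 \<and>
     (\<forall>i<csize a. \<forall>j<csize a. block_of a j < block_of a i \<longrightarrow> X $$ (i, j) = 0)}"

definition frobenius :: "'k::field itself \<Rightarrow> nat \<Rightarrow> composition set" where
  "frobenius _ n = {a. csize a = n \<and> lie_index n (parabolic a :: 'k mat set) = 0}"

definition frobenius_parity :: "'k::field itself \<Rightarrow> nat \<Rightarrow> composition set" where
  "frobenius_parity K \<epsilon> = (\<Union>n\<in>{1..}. frobenius K (2 * n + \<epsilon>))"

section \<open>The operators and the monoid they generate\<close>

lift_definition \<theta> :: "composition \<Rightarrow> composition" is rev
  by simp

lift_definition \<sigma> :: "nat \<Rightarrow> composition \<Rightarrow> composition" is
  "\<lambda>m a. (m + 2) * hd a # tl a @ [(m + 1) * hd a]"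
  by (auto simp: neq_Nil_conv)

lift_definition \<tau> :: "nat \<Rightarrow> composition \<Rightarrow> composition" is
  "\<lambda>m a. case a of
     a1 # a2 # as \<Rightarrow> ((m + 1) * a1 + (m + 2) * a2) # as @ [m * a1 + (m + 1) * a2]
   | _ \<Rightarrow> a"
  by (auto split: list.splits)

definition S_ops :: "(composition \<Rightarrow> composition) set" where
  "S_ops = range \<sigma> \<union> range (\<lambda>m. \<theta> \<circ> \<sigma> m)"

definition T_ops :: "(composition \<Rightarrow> composition) set" where
  "T_ops = range \<tau> \<union> range (\<lambda>m. \<theta> \<circ> \<tau> m)"

definition A_ops :: "(composition \<Rightarrow> composition) set" where
  "A_ops = S_ops \<union> T_ops"

inductive_set op_monoid :: "(composition \<Rightarrow> composition) set" where
  one: "id \<in> op_monoid"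
| gen: "\<eta> \<in> A_ops \<Longrightarrow> \<eta> \<in> op_monoid"
| mult: "v \<in> op_monoid \<Longrightarrow> w \<in> op_monoid \<Longrightarrow> v \<circ> w \<in> op_monoid"

text \<open>\<open>w = \<eta>\<^sub>1 \<circ> \<dots> \<circ> \<eta>\<^sub>k\<close> with \<open>k \<ge> 1\<close>, all \<open>\<eta>\<^sub>i\<close> in \<open>A_ops\<close> and \<open>\<eta>\<^sub>k\<close> (which is applied first)
  in \<open>L\<close>. The monoid is free on \<open>A_ops\<close>, so there is only one such word for a given \<open>w\<close>.\<close>

definition ends_with_letter_in ::
    "(composition \<Rightarrow> composition) set \<Rightarrow> (composition \<Rightarrow> composition) \<Rightarrow> bool" where
  "ends_with_letter_in L w \<longleftrightarrow>
     (\<exists>\<eta>s. \<eta>s \<noteq> [] \<and> set \<eta>s \<subseteq> A_ops \<and> last \<eta>s \<in> L \<and> w = foldr (\<circ>) \<eta>s id)"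

definition op_monoid_parity :: "nat \<Rightarrow> (composition \<Rightarrow> composition) set" where
  "op_monoid_parity \<epsilon> =
     (if \<epsilon> = 0 then op_monoid else {w \<in> op_monoid. ends_with_letter_in S_ops w})"

lift_definition comp_1_1 :: composition is "[1, 1]"
  by simp

lift_definition comp_1 :: composition is "[1]"
  by simp

definition base_comp :: "nat \<Rightarrow> composition" where
  "base_comp \<epsilon> = (if \<epsilon> = 0 then comp_1_1 else comp_1)"

end

theory Submission
  imports Defs
begin

text \<open>The statement splits into linear algebra, which decides when a parabolic subalgebra has index \<open>0\<close>,
and a combinatorial descent.

\<^bold>\<open>From the index to rigid matrices.\<close> Every linear form on \<open>\<p>\<^sub>a\<close> is \<open>Y \<mapsto> tr (F Y)\<close> for a matrix \<open>F\<close>, and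
\<open>tr (F [X, Y]) = tr ([F, X] Y)\<close>. So \<open>X\<close> lies in the kernel of the form iff \<open>[F, X]\<close> is orthogonal to
\<open>\<p>\<^sub>a\<close>. After adding the scalars (characteristic \<open>0\<close>) this says: \<open>X\<close> is block upper triangular and
\<open>[F, X]\<close> vanishes at every position \<open>(i, j)\<close> whose transpose \<open>(j, i)\<close> is allowed. The index is \<open>0\<close> iff
some \<open>F\<close> is \<^emph>\<open>rigid\<close>, that is, only the scalars \<open>X\<close> have this property
(\<open>lie_index_0_iff_levels_rigid\<close>). Rigidity makes sense for any preorder \<open>R\<close> of allowed positions on
a finite index set, and the proof moves through such preorders.

\<^bold>\<open>Two reductions.\<close> Let \<open>K\<close> be a class of \<open>R\<close> with nothing below it, \<open>D\<close> a class with nothing above it,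
and \<open>K\<close> below \<open>D\<close>. If the corner \<open>F\<^sub>D\<^sub>K\<close> had both a nonzero kernel vector \<open>u\<close> and a nonzero cokernel vector \<open>v\<close>, the
matrix \<open>u v\<^sup>T\<close> placed at \<open>K \<times> D\<close> would be a nilpotent stabilizer, so the corner of a rigid \<open>F\<close> has full
rank (\<open>rigid_full_rank\<close>). A change of basis in \<open>K\<close> or \<open>D\<close> turns it into a partial identity matrix, and
the equations \<open>[F, X] = 0\<close> near that identity solve for the blocks of \<open>X\<close> which touch part of \<open>D\<close>.
Eliminating them leaves the same problem on a smaller preorder: \<open>surjective_reduction\<close> if
\<open>|K| \<ge> |D|\<close>, \<open>injective_reduction\<close> if \<open>|K| \<le> |D|\<close>.

\<^bold>\<open>Euclid's algorithm.\<close> For a composition \<open>(c\<^sub>1, \<dots>, c\<^sub>r)\<close> with \<open>c\<^sub>1 > c\<^sub>r\<close> put \<open>k = c\<^sub>1 - c\<^sub>r\<close>. The surjective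
reduction removes the last block; the injective one then replaces \<open>c\<^sub>r\<close> by \<open>\<rho> = c\<^sub>r mod k\<close>; one more
surjective reduction gives the composition \<open>(k - \<rho>, \<rho>, c\<^sub>2, \<dots>)\<close>, or \<open>(k, c\<^sub>2, \<dots>)\<close> if \<open>\<rho> = 0\<close>. These are
the inverses of \<open>\<tau>\<^sub>m\<close> and \<open>\<sigma>\<^sub>m\<close> (\<open>levels_rigid_tau\<close>, \<open>levels_rigid_sigma\<close>), and transposition gives
\<open>\<theta>\<close>. If \<open>c\<^sub>1 = c\<^sub>r\<close> and \<open>r \<ge> 2\<close>, the problem left by the first step is a direct sum, so only \<open>(1, 1)\<close> is
Frobenius (\<open>levels_rigid_equal_ends\<close>); for \<open>r = 1\<close> only \<open>(1)\<close> is.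

\<^bold>\<open>Words.\<close> A ratio \<open>c\<^sub>1 / c\<^sub>r > 1\<close> either equals \<open>(m + 2) / (m + 1)\<close> or lies strictly between
\<open>(m + 2) / (m + 1)\<close> and \<open>(m + 1) / m\<close> for exactly one \<open>m\<close>. Hence a composition with different ends is
\<open>\<eta> a\<close> for exactly one letter \<open>\<eta>\<close> and one composition \<open>a\<close> (\<open>exists_preimage\<close>, \<open>unique_parsing\<close>), and
\<open>a\<close> is smaller by an even number. Descending from a Frobenius composition therefore ends in \<open>(1, 1)\<close> or
\<open>(1)\<close>, as the parity of the size tells, and spells exactly one word. A letter of \<open>T\<close> fixes \<open>(1)\<close>, so
words applied to \<open>(1)\<close> are determined by their value only if they end in \<open>S\<close>.\<close>

section \<open>Rigid matrices of a preorder\<close>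

text \<open>Matrices are functions of two indices and only their values on \<open>J \<times> J\<close> matter. This lets index sets
shrink and be relabelled freely, which a matrix type with built-in dimensions would not.\<close>

definition mcomm :: "'i set \<Rightarrow> ('i \<Rightarrow> 'i \<Rightarrow> 'k::field) \<Rightarrow> ('i \<Rightarrow> 'i \<Rightarrow> 'k) \<Rightarrow> 'i \<Rightarrow> 'i \<Rightarrow> 'k" where
  "mcomm J F X i j = (\<Sum>l\<in>J. F i l * X l j) - (\<Sum>l\<in>J. X i l * F l j)"

definition supported :: "'i set \<Rightarrow> ('i \<Rightarrow> 'i \<Rightarrow> bool) \<Rightarrow> ('i \<Rightarrow> 'i \<Rightarrow> 'k::field) \<Rightarrow> bool" where
  "supported J R X \<longleftrightarrow> (\<forall>i\<in>J. \<forall>j\<in>J. \<not> R i j \<longrightarrow> X i j = 0)"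

text \<open>With \<open>\<g>\<close> the matrices supported on \<open>R\<close>, this says that \<open>X \<in> \<g>\<close> annihilates the linear form
\<open>Y \<mapsto> tr (F Y)\<close> on \<open>\<g>\<close>: the condition \<open>R j i\<close> selects the entries of \<open>[F, X]\<close> that pair with \<open>\<g>\<close>.\<close>
definition stabilizes ::
    "'i set \<Rightarrow> ('i \<Rightarrow> 'i \<Rightarrow> bool) \<Rightarrow> ('i \<Rightarrow> 'i \<Rightarrow> 'k::field) \<Rightarrow> ('i \<Rightarrow> 'i \<Rightarrow> 'k) \<Rightarrow> bool" where
  "stabilizes J R F X \<longleftrightarrow> supported J R X \<and> (\<forall>i\<in>J. \<forall>j\<in>J. R j i \<longrightarrow> mcomm J F X i j = 0)"

definition scalar_on :: "'i set \<Rightarrow> ('i \<Rightarrow> 'i \<Rightarrow> 'k::field) \<Rightarrow> bool" where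
  "scalar_on J X \<longleftrightarrow> (\<exists>c. \<forall>i\<in>J. \<forall>j\<in>J. X i j = (if i = j then c else 0))"

definition rigid :: "'i set \<Rightarrow> ('i \<Rightarrow> 'i \<Rightarrow> bool) \<Rightarrow> ('i \<Rightarrow> 'i \<Rightarrow> 'k::field) \<Rightarrow> bool" where
  "rigid J R F \<longleftrightarrow> (\<forall>X. stabilizes J R F X \<longrightarrow> scalar_on J X)"

definition has_rigid :: "'k::field itself \<Rightarrow> 'i set \<Rightarrow> ('i \<Rightarrow> 'i \<Rightarrow> bool) \<Rightarrow> bool" where
  "has_rigid _ J R \<longleftrightarrow> (\<exists>F :: 'i \<Rightarrow> 'i \<Rightarrow> 'k. rigid J R F)"

lemma supportedD: "supported J R X \<Longrightarrow> i \<in> J \<Longrightarrow> j \<in> J \<Longrightarrow> \<not> R i j \<Longrightarrow> X i j = 0"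
  by (simp add: supported_def)

lemma mcomm_cong:
  assumes "\<And>i j. i \<in> J \<Longrightarrow> j \<in> J \<Longrightarrow> F i j = F' i j"
    and "\<And>i j. i \<in> J \<Longrightarrow> j \<in> J \<Longrightarrow> X i j = X' i j" and "i \<in> J" "j \<in> J"
  shows "mcomm J F X i j = mcomm J F' X' i j"
  unfolding mcomm_def using assms by (intro arg_cong2[of _ _ _ _ minus] sum.cong) auto

lemma mcomm_reindex:
  assumes "bij_betw h J J'"
  shows "mcomm J (\<lambda>i j. F (h i) (h j)) (\<lambda>i j. X (h i) (h j)) i j = mcomm J' F X (h i) (h j)"
  unfolding mcomm_def by (simp add: sum.reindex_bij_betw[OF assms, symmetric])

lemma mcomm_scalar:
  assumes fin: "finite J" and ij: "i \<in> J" "j \<in> J"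
    and c: "\<And>i j. i \<in> J \<Longrightarrow> j \<in> J \<Longrightarrow> X i j = (if i = j then c else 0)"
  shows "mcomm J F X i j = 0"
proof -
  have "(\<Sum>l\<in>J. F i l * X l j) = (\<Sum>l\<in>J. if l = j then F i l * c else 0)"
    using ij c by (intro sum.cong) auto
  moreover have "(\<Sum>l\<in>J. X i l * F l j) = (\<Sum>l\<in>J. if i = l then c * F l j else 0)"
    using ij c by (intro sum.cong) auto
  ultimately show ?thesis using fin ij by (simp add: mcomm_def sum.delta sum.delta' mult.commute)
qed

lemma has_rigid_relabel_imp:
  fixes h :: "'i \<Rightarrow> 'j"
  assumes h: "bij_betw h J J'" and R: "\<And>i j. i \<in> J \<Longrightarrow> j \<in> J \<Longrightarrow> R i j \<longleftrightarrow> R' (h i) (h j)"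
    and F: "has_rigid TYPE('k::field) J R"
  shows "has_rigid TYPE('k) J' R'"
proof -
  obtain F :: "'i \<Rightarrow> 'i \<Rightarrow> 'k" where F: "rigid J R F" using F unfolding has_rigid_def by blast
  define g where "g = inv_into J h"
  have g: "bij_betw g J' J" unfolding g_def using h by (rule bij_betw_inv_into)
  have gh: "g (h i) = i" if "i \<in> J" for i
    unfolding g_def using h that by (simp add: bij_betw_inv_into_left)
  have hg: "h (g i) = i" if "i \<in> J'" for i
    unfolding g_def using h that by (simp add: bij_betw_inv_into_right)
  have hJ: "h i \<in> J'" if "i \<in> J" for i using h that bij_betwE by blast
  have gJ: "g i \<in> J" if "i \<in> J'" for i using g that bij_betwE by blast
  have "rigid J' R' (\<lambda>i j. F (g i) (g j))"
    unfolding rigid_def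
  proof (intro allI impI)
    fix X assume X: "stabilizes J' R' (\<lambda>i j. F (g i) (g j)) X"
    have eq: "mcomm J F (\<lambda>i j. X (h i) (h j)) i j = mcomm J' (\<lambda>i j. F (g i) (g j)) X (h i) (h j)"
      if "i \<in> J" "j \<in> J" for i j
      using that by (subst mcomm_reindex[OF h, symmetric]) (auto intro!: mcomm_cong simp: gh)
    have "stabilizes J R F (\<lambda>i j. X (h i) (h j))"
      using X R hJ eq unfolding stabilizes_def supported_def by auto
    then obtain c where c: "\<And>i j. i \<in> J \<Longrightarrow> j \<in> J \<Longrightarrow> X (h i) (h j) = (if i = j then c else 0)"
      using F unfolding rigid_def scalar_on_def by metis
    show "scalar_on J' X" unfolding scalar_on_def
    proof (intro exI[of _ c] ballI)
      fix i j assume ij: "i \<in> J'" "j \<in> J'"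
      show "X i j = (if i = j then c else 0)"
        using c[of "g i" "g j"] gJ hg ij by metis
    qed
  qed
  then show ?thesis unfolding has_rigid_def by blast
qed

lemma has_rigid_relabel:
  assumes h: "bij_betw h J J'" and R: "\<And>i j. i \<in> J \<Longrightarrow> j \<in> J \<Longrightarrow> R i j \<longleftrightarrow> R' (h i) (h j)"
  shows "has_rigid TYPE('k::field) J R \<longleftrightarrow> has_rigid TYPE('k) J' R'"
proof
  show "has_rigid TYPE('k) J R \<Longrightarrow> has_rigid TYPE('k) J' R'"
    using has_rigid_relabel_imp[where h = h and R = R and R' = R'] h R by blast
next
  have "R' i j \<longleftrightarrow> R (inv_into J h i) (inv_into J h j)" if "i \<in> J'" "j \<in> J'" for i j
  proof -
    have "inv_into J h l \<in> J \<and> h (inv_into J h l) = l" if "l \<in> J'" for l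
      using that bij_betwE[OF bij_betw_inv_into[OF h]] bij_betw_inv_into_right[OF h] by blast
    then show ?thesis using R[of "inv_into J h i" "inv_into J h j"] that by simp
  qed
  then show "has_rigid TYPE('k) J' R' \<Longrightarrow> has_rigid TYPE('k) J R"
    using has_rigid_relabel_imp[where h = "inv_into J h" and R = R' and R' = R] bij_betw_inv_into[OF h] by blast
qed

text \<open>Transposition is an anti-automorphism: it sends a stabilizer of \<open>F\<close> to one of \<open>F\<^sup>T\<close> up to a sign of the
commutator.\<close>
lemma has_rigid_reverse_imp:
  assumes "has_rigid TYPE('k::field) J R"
  shows "has_rigid TYPE('k) J (\<lambda>i j. R j i)"
proof -
  obtain F :: "'a \<Rightarrow> 'a \<Rightarrow> 'k" where F: "rigid J R F" using assms unfolding has_rigid_def by blast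
  have eq: "mcomm J F (\<lambda>i j. X j i) i j = - mcomm J (\<lambda>i j. F j i) X j i" for X i j
    unfolding mcomm_def by (simp add: mult.commute)
  have "rigid J (\<lambda>i j. R j i) (\<lambda>i j. F j i)"
    unfolding rigid_def
  proof (intro allI impI)
    fix X assume "stabilizes J (\<lambda>i j. R j i) (\<lambda>i j. F j i) X"
    then have "stabilizes J R F (\<lambda>i j. X j i)"
      unfolding stabilizes_def supported_def eq by auto
    then have "scalar_on J (\<lambda>i j. X j i)" using F unfolding rigid_def by blast
    then show "scalar_on J X" unfolding scalar_on_def by metis
  qed
  then show ?thesis unfolding has_rigid_def by blast
qed

text \<open>An entry \<open>F i j\<close> with \<open>\<not> R j i\<close> is multiplied in the relevant entries of \<open>[F, X]\<close> only by entries of \<open>X\<close>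
outside \<open>R\<close>, by transitivity. Such entries of \<open>F\<close> may thus be chosen at will.\<close>
lemma rigid_cong:
  assumes tr: "\<And>i j k. i \<in> J \<Longrightarrow> j \<in> J \<Longrightarrow> k \<in> J \<Longrightarrow> R i j \<Longrightarrow> R j k \<Longrightarrow> R i k"
    and FF: "\<And>i j. i \<in> J \<Longrightarrow> j \<in> J \<Longrightarrow> R j i \<Longrightarrow> F i j = F' i j"
    and F: "rigid J R F"
  shows "rigid J R F'"
proof -
  have eq: "mcomm J F X i j = mcomm J F' X i j"
    if X: "supported J R X" and ij: "i \<in> J" "j \<in> J" "R j i" for X i j
  proof -
    have "F i l * X l j = F' i l * X l j" if "l \<in> J" for l
    proof (cases "R l j")
      case True then show ?thesis using FF[of i l] tr[of l j i] ij that by simp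
    qed (use supportedD[OF X] ij that in auto)
    moreover have "X i l * F l j = X i l * F' l j" if "l \<in> J" for l
    proof (cases "R i l")
      case True then show ?thesis using FF[of l j] tr[of j i l] ij that by simp
    qed (use supportedD[OF X] ij that in auto)
    ultimately show ?thesis unfolding mcomm_def
      by (intro arg_cong2[of _ _ _ _ minus] sum.cong refl)
  qed
  show ?thesis using F unfolding rigid_def stabilizes_def by (metis eq)
qed

section \<open>Change of basis\<close>

definition mmul :: "'i set \<Rightarrow> ('i \<Rightarrow> 'i \<Rightarrow> 'k::field) \<Rightarrow> ('i \<Rightarrow> 'i \<Rightarrow> 'k) \<Rightarrow> 'i \<Rightarrow> 'i \<Rightarrow> 'k" where
  "mmul J A B i j = (\<Sum>l\<in>J. A i l * B l j)"

definition inverse_on :: "'i set \<Rightarrow> ('i \<Rightarrow> 'i \<Rightarrow> 'k::field) \<Rightarrow> ('i \<Rightarrow> 'i \<Rightarrow> 'k) \<Rightarrow> bool" where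
  "inverse_on J g h \<longleftrightarrow> (\<forall>i\<in>J. \<forall>j\<in>J. mmul J g h i j = (if i = j then 1 else 0)
      \<and> mmul J h g i j = (if i = j then 1 else 0))"

lemma mmul_assoc: "mmul J (mmul J A B) C = mmul J A (mmul J B C)"
proof (intro ext)
  fix i j
  have "mmul J (mmul J A B) C i j = (\<Sum>l\<in>J. \<Sum>m\<in>J. A i m * B m l * C l j)"
    unfolding mmul_def by (simp add: sum_distrib_right)
  also have "\<dots> = (\<Sum>m\<in>J. \<Sum>l\<in>J. A i m * B m l * C l j)" by (rule sum.swap)
  also have "\<dots> = mmul J A (mmul J B C) i j"
    unfolding mmul_def by (simp add: sum_distrib_left mult.assoc)
  finally show "mmul J (mmul J A B) C i j = mmul J A (mmul J B C) i j" .
qed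

lemma mmul_cong:
  assumes "\<And>l. l \<in> J \<Longrightarrow> A i l = A' i l" "\<And>l. l \<in> J \<Longrightarrow> B l j = B' l j"
  shows "mmul J A B i j = mmul J A' B' i j"
  unfolding mmul_def using assms by (intro sum.cong) auto

lemma mmul_id_left:
  assumes "finite J" "i \<in> J" "\<And>l. l \<in> J \<Longrightarrow> E i l = (if i = l then 1 else 0)"
  shows "mmul J E A i j = A i j"
proof -
  have "mmul J E A i j = (\<Sum>l\<in>J. if i = l then A l j else 0)"
    unfolding mmul_def using assms by (intro sum.cong) auto
  then show ?thesis using assms by (simp add: sum.delta')
qed

lemma mmul_id_right:
  assumes "finite J" "j \<in> J" "\<And>l. l \<in> J \<Longrightarrow> E l j = (if l = j then 1 else 0)"
  shows "mmul J A E i j = A i j"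
proof -
  have "mmul J A E i j = (\<Sum>l\<in>J. if l = j then A i l else 0)"
    unfolding mmul_def using assms by (intro sum.cong) auto
  then show ?thesis using assms by (simp add: sum.delta)
qed

lemma mmul_supported:
  assumes tr: "\<And>i j k. i \<in> J \<Longrightarrow> j \<in> J \<Longrightarrow> k \<in> J \<Longrightarrow> R i j \<Longrightarrow> R j k \<Longrightarrow> R i k"
    and "supported J R A" "supported J R B"
  shows "supported J R (mmul J A B)"
  unfolding supported_def mmul_def
proof (intro ballI impI sum.neutral)
  fix i j l assume "i \<in> J" "j \<in> J" "\<not> R i j" "l \<in> J"
  then have "\<not> R i l \<or> \<not> R l j" using tr by blast
  then show "A i l * B l j = 0" using assms(2,3) \<open>i \<in> J\<close> \<open>j \<in> J\<close> \<open>l \<in> J\<close>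
    by (auto dest: supportedD)
qed

text \<open>If \<open>X\<close> stabilizes \<open>g F h\<close>, then \<open>h X g\<close> stabilizes \<open>F\<close>, since \<open>[F, h X g] = h [g F h, X] g\<close> and
multiplication by matrices supported on \<open>R\<close> respects the positions where the commutator has to vanish.
This is the coadjoint action of the group of invertible matrices supported on \<open>R\<close>.\<close>
lemma rigid_conj:
  assumes fin: "finite J"
    and tr: "\<And>i j k. i \<in> J \<Longrightarrow> j \<in> J \<Longrightarrow> k \<in> J \<Longrightarrow> R i j \<Longrightarrow> R j k \<Longrightarrow> R i k"
    and g: "supported J R g" and h: "supported J R h" and gh: "inverse_on J g h"
    and F: "rigid J R F"
  shows "rigid J R (mmul J g (mmul J F h))"
  unfolding rigid_def
proof (intro allI impI)
  let ?F = "mmul J g (mmul J F h)"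
  fix X assume X: "stabilizes J R ?F X"
  define Y where "Y = mmul J h (mmul J X g)"
  have Xs: "supported J R X" using X by (simp add: stabilizes_def)
  have Ys: "supported J R Y" unfolding Y_def by (intro mmul_supported[OF tr] h g Xs)
  have idl: "mmul J (mmul J h g) A i j = A i j" if "i \<in> J" for A i j
    using that gh fin by (intro mmul_id_left) (auto simp: inverse_on_def)
  have idr: "mmul J A (mmul J h g) i j = A i j" if "j \<in> J" for A i j
    using that gh fin by (intro mmul_id_right) (auto simp: inverse_on_def)
  have idl': "mmul J (mmul J g h) A i j = A i j" if "i \<in> J" for A i j
    using that gh fin by (intro mmul_id_left) (auto simp: inverse_on_def)
  have idr': "mmul J A (mmul J g h) i j = A i j" if "j \<in> J" for A i j
    using that gh fin by (intro mmul_id_right) (auto simp: inverse_on_def)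
  have FY: "mmul J F Y i j = mmul J h (mmul J (mmul J ?F X) g) i j" if "i \<in> J" "j \<in> J" for i j
  proof -
    have "mmul J h (mmul J (mmul J ?F X) g) i j = mmul J (mmul J h g) (mmul J F Y) i j"
      unfolding Y_def by (simp add: mmul_assoc)
    then show ?thesis using idl that by simp
  qed
  have YF: "mmul J Y F i j = mmul J h (mmul J (mmul J X ?F) g) i j" if "i \<in> J" "j \<in> J" for i j
  proof -
    have "mmul J h (mmul J (mmul J X ?F) g) i j = mmul J (mmul J Y F) (mmul J h g) i j"
      unfolding Y_def by (simp add: mmul_assoc)
    then show ?thesis using idr that by simp
  qed
  have comm: "mcomm J F Y i j = (\<Sum>a\<in>J. \<Sum>b\<in>J. h i a * mcomm J ?F X a b * g b j)"
    if "i \<in> J" "j \<in> J" for i j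
  proof -
    have "mcomm J F Y i j = mmul J F Y i j - mmul J Y F i j" by (simp add: mcomm_def mmul_def)
    also have "\<dots> = mmul J h (mmul J (mmul J ?F X) g) i j - mmul J h (mmul J (mmul J X ?F) g) i j"
      using that FY YF by simp
    also have "\<dots> = (\<Sum>a\<in>J. \<Sum>b\<in>J. h i a * (mmul J ?F X a b - mmul J X ?F a b) * g b j)"
      unfolding mmul_def[of J h] mmul_def[of J _ g]
      by (simp add: sum_subtractf[symmetric] sum_distrib_left algebra_simps)
    finally show ?thesis by (simp add: mcomm_def mmul_def)
  qed
  have "mcomm J F Y i j = 0" if ij: "i \<in> J" "j \<in> J" "R j i" for i j
    unfolding comm[OF ij(1,2)]
  proof (intro sum.neutral ballI)
    fix a b assume ab: "a \<in> J" "b \<in> J"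
    show "h i a * mcomm J ?F X a b * g b j = 0"
    proof (cases "R i a \<and> R b j")
      case True
      then have "R b a" using tr[of b j i] tr[of b i a] ij ab by blast
      then show ?thesis using X ab by (simp add: stabilizes_def)
    qed (use supportedD[OF h] supportedD[OF g] ij ab in auto)
  qed
  then have "stabilizes J R F Y" using Ys unfolding stabilizes_def by blast
  then obtain c where c: "\<And>i j. i \<in> J \<Longrightarrow> j \<in> J \<Longrightarrow> Y i j = (if i = j then c else 0)"
    using F unfolding rigid_def scalar_on_def by metis
  show "scalar_on J X" unfolding scalar_on_def
  proof (intro exI[of _ c] ballI)
    fix i j assume ij: "i \<in> J" "j \<in> J"
    have "X i j = mmul J (mmul J g h) (mmul J X (mmul J g h)) i j"
      using idl' idr' ij by simp
    also have "\<dots> = mmul J g (mmul J Y h) i j" unfolding Y_def by (simp add: mmul_assoc)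
    also have "\<dots> = (\<Sum>a\<in>J. g i a * (\<Sum>b\<in>J. Y a b * h b j))" by (simp add: mmul_def)
    also have "\<dots> = (\<Sum>a\<in>J. g i a * (\<Sum>b\<in>J. if a = b then c * h b j else 0))"
      using c by (intro sum.cong arg_cong2[of _ _ _ _ times] refl) auto
    also have "\<dots> = (\<Sum>a\<in>J. g i a * (c * h a j))" using fin by (simp add: sum.delta')
    also have "\<dots> = c * mmul J g h i j"
      unfolding mmul_def by (simp add: sum_distrib_left algebra_simps)
    also have "\<dots> = (if i = j then c else 0)" using gh ij by (simp add: inverse_on_def)
    finally show "X i j = (if i = j then c else 0)" .
  qed
qed

lemma inverse_on_mmul:
  assumes fin: "finite J" and 1: "inverse_on J g h" and 2: "inverse_on J g' h'"
  shows "inverse_on J (mmul J g g') (mmul J h' h)"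
proof -
  have *: "mmul J (mmul J a b) (mmul J b' a') i j = (if i = j then 1 else 0)"
    if "inverse_on J a a'" "inverse_on J b b'" "i \<in> J" "j \<in> J" for a b a' b' :: "'a \<Rightarrow> 'a \<Rightarrow> 'b" and i j
  proof -
    have "mmul J (mmul J a b) (mmul J b' a') i j = mmul J a (mmul J (mmul J b b') a') i j"
      by (simp add: mmul_assoc)
    also have "\<dots> = mmul J a a' i j"
      using that fin by (intro mmul_cong refl mmul_id_left) (auto simp: inverse_on_def)
    finally show ?thesis using that by (simp add: inverse_on_def)
  qed
  have sym: "inverse_on J h g" "inverse_on J h' g'" using 1 2 by (auto simp: inverse_on_def)
  show ?thesis unfolding inverse_on_def using *[OF 1 2] *[OF sym(2,1)] by blast
qed

text \<open>\<open>(1 + Z) (1 - Z) = 1\<close> when \<open>Z\<^sup>2 = 0\<close>. The products vanish entry by entry in all uses, because row and column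
indices of \<open>Z\<close> come from disjoint sets.\<close>
lemma inverse_on_unipotent:
  fixes Z :: "'i \<Rightarrow> 'i \<Rightarrow> 'k::field"
  assumes fin: "finite J" and Z: "\<And>i l j. i \<in> J \<Longrightarrow> l \<in> J \<Longrightarrow> j \<in> J \<Longrightarrow> Z i l * Z l j = 0"
  shows "inverse_on J (\<lambda>i j. (if i = j then 1 else 0) + Z i j) (\<lambda>i j. (if i = j then 1 else 0) - Z i j)"
proof -
  have "(\<Sum>l\<in>J. ((if i = l then 1 else 0) + s * Z i l) * ((if l = j then 1 else 0) - s * Z l j))
      = (if i = j then 1 else 0)" if "i \<in> J" "j \<in> J" for i j s
  proof -
    have "((if i = l then 1 else 0) + s * Z i l) * ((if l = j then 1 else 0) - s * Z l j)
       = (if i = l then (if l = j then 1 else 0) - s * Z l j else 0) + (if l = j then s * Z i l else 0)"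
      if "l \<in> J" for l using Z[OF \<open>i \<in> J\<close> that \<open>j \<in> J\<close>] by (auto simp: algebra_simps)
    then have "(\<Sum>l\<in>J. ((if i = l then 1 else 0) + s * Z i l) * ((if l = j then 1 else 0) - s * Z l j))
      = (\<Sum>l\<in>J. (if i = l then (if l = j then 1 else 0) - s * Z l j else 0) + (if l = j then s * Z i l else 0))"
      by (intro sum.cong) auto
    also have "\<dots> = (if i = j then 1 else 0)"
      using fin that by (simp add: sum.distrib sum.delta sum.delta')
    finally show ?thesis .
  qed
  from this[of _ _ 1] this[of _ _ "-1"] show ?thesis unfolding inverse_on_def mmul_def by simp
qed

section \<open>Row reduction\<close>

text \<open>One step of Gaussian elimination: the unit vectors \<open>e\<^sub>s\<close> with \<open>s \<in> S\<close> are the pivot columns found so far,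
and \<open>w\<close> becomes \<open>e\<^sub>p\<close>. If \<open>w p = 0\<close>, row \<open>q\<close> is first added to row \<open>p\<close>, which does not touch the \<open>e\<^sub>s\<close>.\<close>
lemma pivot_column:
  fixes w :: "'i \<Rightarrow> 'k::field"
  assumes fin: "finite D" and S: "S \<subseteq> D" and p: "p \<in> D" "p \<notin> S" and q: "q \<in> D" "q \<notin> S" "w q \<noteq> 0"
  shows "\<exists>g h. inverse_on D g h \<and> (\<forall>i\<in>D. \<forall>s\<in>S. g i s = (if i = s then 1 else 0))
     \<and> (\<forall>i\<in>D. (\<Sum>l\<in>D. g i l * w l) = (if i = p then 1 else 0))"
proof -
  have piv: "\<exists>g h. inverse_on D g h \<and> (\<forall>i\<in>D. \<forall>s\<in>S. g i s = (if i = s then 1 else 0))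
     \<and> (\<forall>i\<in>D. (\<Sum>l\<in>D. g i l * w l) = (if i = p then 1 else 0))" if wp: "w p \<noteq> 0" for w :: "'i \<Rightarrow> 'k"
  proof -
    define g where "g i j = (if j = p then (if i = p then 1 / w p else - w i / w p) else if i = j then 1 else 0)" for i j
    define h where "h i j = (if j = p then w i else if i = j then 1 else (0::'k))" for i j
    have gE: "(\<Sum>l\<in>D. g i l * v l) = (if i = p then v p / w p else v i - w i * v p / w p)" if "i \<in> D" for i v
    proof -
      have "(\<Sum>l\<in>D. g i l * v l) = g i p * v p + (\<Sum>l\<in>D - {p}. g i l * v l)"
        using fin p by (simp add: sum.remove)
      also have "(\<Sum>l\<in>D - {p}. g i l * v l) = (\<Sum>l\<in>D - {p}. if i = l then v l else 0)"
        by (intro sum.cong) (auto simp: g_def)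
      also have "\<dots> = (if i = p then 0 else v i)" using fin that by (simp add: sum.delta')
      finally show ?thesis by (auto simp: g_def)
    qed
    have hE: "(\<Sum>l\<in>D. h i l * v l) = (if i = p then w p * v p else w i * v p + v i)" if "i \<in> D" for i v
    proof -
      have "(\<Sum>l\<in>D. h i l * v l) = h i p * v p + (\<Sum>l\<in>D - {p}. h i l * v l)"
        using fin p by (simp add: sum.remove)
      also have "(\<Sum>l\<in>D - {p}. h i l * v l) = (\<Sum>l\<in>D - {p}. if i = l then v l else 0)"
        by (intro sum.cong) (auto simp: h_def)
      also have "\<dots> = (if i = p then 0 else v i)" using fin that by (simp add: sum.delta')
      finally show ?thesis by (auto simp: h_def)
    qed
    have "inverse_on D g h"
      unfolding inverse_on_def mmul_def using wp p(1)
      by (auto simp: gE hE) (auto simp: g_def h_def)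
    moreover have "\<forall>i\<in>D. \<forall>s\<in>S. g i s = (if i = s then 1 else 0)" using p by (auto simp: g_def)
    moreover have "\<forall>i\<in>D. (\<Sum>l\<in>D. g i l * w l) = (if i = p then 1 else 0)" using wp by (auto simp: gE)
    ultimately show ?thesis by blast
  qed
  show ?thesis
  proof (cases "w p = 0")
    case True
    define Z where "Z i j = (if i = p \<and> j = q then 1 else (0::'k))" for i j
    have pq: "p \<noteq> q" using True q by auto
    let ?g1 = "\<lambda>i j. (if i = j then 1 else 0) + Z i j" and ?h1 = "\<lambda>i j. (if i = j then 1 else 0) - Z i j"
    have inv1: "inverse_on D ?g1 ?h1"
      by (rule inverse_on_unipotent[OF fin]) (use pq in \<open>auto simp: Z_def\<close>)
    define w' where "w' i = (\<Sum>l\<in>D. ?g1 i l * w l)" for i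
    have w'p: "w' p = w q"
    proof -
      have "w' p = (\<Sum>l\<in>D. (if p = l then w l else 0) + (if l = q then w l else 0))"
        unfolding w'_def by (intro sum.cong) (auto simp: Z_def algebra_simps)
      then show ?thesis using fin p(1) q(1) True by (simp add: sum.distrib sum.delta sum.delta')
    qed
    obtain g h where gh: "inverse_on D g h" "\<forall>i\<in>D. \<forall>s\<in>S. g i s = (if i = s then 1 else 0)"
       "\<forall>i\<in>D. (\<Sum>l\<in>D. g i l * w' l) = (if i = p then 1 else 0)"
      using piv[of w'] w'p q by auto
    show ?thesis
    proof (intro exI conjI ballI)
      show "inverse_on D (mmul D g ?g1) (mmul D ?h1 h)" by (rule inverse_on_mmul[OF fin gh(1) inv1])
    next
      fix i s assume "i \<in> D" "s \<in> S"
      then have "mmul D g ?g1 i s = g i s"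
        using S q by (intro mmul_id_right[OF fin]) (auto simp: Z_def)
      then show "mmul D g ?g1 i s = (if i = s then 1 else 0)" using gh(2) \<open>i \<in> D\<close> \<open>s \<in> S\<close> by auto
    next
      fix i assume "i \<in> D"
      have "(\<Sum>l\<in>D. mmul D g ?g1 i l * w l) = mmul D (mmul D g ?g1) (\<lambda>l _. w l) i undefined"
        by (simp add: mmul_def)
      also have "\<dots> = mmul D g (\<lambda>l _. w' l) i undefined"
        unfolding mmul_assoc by (simp add: mmul_def w'_def)
      also have "\<dots> = (if i = p then 1 else 0)" using gh(3) \<open>i \<in> D\<close> by (simp add: mmul_def)
      finally show "(\<Sum>l\<in>D. mmul D g ?g1 i l * w l) = (if i = p then 1 else 0)" .
    qed
  qed (use piv in blast)
qed

text \<open>The positions \<open>b\<close> of the pivots are prescribed, so that the reductions below can decide beforehand which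
indices are eliminated. If the next column had no nonzero entry outside the rows already used, it would be a
combination of the previous columns, against injectivity.\<close>
lemma row_reduce:
  fixes A :: "'i \<Rightarrow> 'j \<Rightarrow> 'k::field"
  assumes fin: "finite D" and finK: "finite K"
    and inj: "\<And>u. (\<And>d. d \<in> D \<Longrightarrow> (\<Sum>k\<in>K. A d k * u k) = 0) \<Longrightarrow> \<forall>k\<in>K. u k = 0"
    and b: "inj_on b K" "b ` K \<subseteq> D"
  shows "\<exists>g h. inverse_on D g h \<and>
    (\<forall>d\<in>D. \<forall>k\<in>K. (\<Sum>l\<in>D. g d l * A l k) = (if d = b k then 1 else 0))"
  using finK inj b
proof (induction K)
  case empty
  have "inverse_on D (\<lambda>i j. if i = j then 1 else 0) (\<lambda>i j. if i = j then 1 else (0::'k))"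
    using inverse_on_unipotent[OF fin, of "\<lambda>_ _. 0 :: 'k"] by simp
  then show ?case by auto
next
  case (insert k0 K)
  have "\<forall>k\<in>K. u k = 0" if u: "\<And>d. d \<in> D \<Longrightarrow> (\<Sum>k\<in>K. A d k * u k) = 0" for u
  proof -
    have "\<forall>k\<in>insert k0 K. (u(k0 := 0)) k = 0"
    proof (rule insert.prems(1))
      fix d assume "d \<in> D"
      have "(\<Sum>k\<in>K. A d k * (u(k0 := 0)) k) = (\<Sum>k\<in>K. A d k * u k)"
        using insert.hyps by (intro sum.cong) auto
      then show "(\<Sum>k\<in>insert k0 K. A d k * (u(k0 := 0)) k) = 0"
        using insert.hyps u[OF \<open>d \<in> D\<close>] by simp
    qed
    then have "(u(k0 := 0)) k = 0" if "k \<in> K" for k using that by blast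
    moreover have "(u(k0 := 0)) k = u k" if "k \<in> K" for k using that insert.hyps by auto
    ultimately show ?thesis by metis
  qed
  note inj_K = this
  have "inj_on b K" "b ` K \<subseteq> D" using insert.prems(2,3) by (auto simp: inj_on_insert)
  from insert.IH[OF inj_K this]
  obtain g h where gh: "inverse_on D g h"
    "\<And>d k. d \<in> D \<Longrightarrow> k \<in> K \<Longrightarrow> (\<Sum>l\<in>D. g d l * A l k) = (if d = b k then 1 else 0)"
    by blast
  define w where "w i = (\<Sum>l\<in>D. g i l * A l k0)" for i
  have "\<exists>q\<in>D - b ` K. w q \<noteq> 0"
  proof (rule ccontr)
    assume "\<not> ?thesis"
    then have w0: "w q = 0" if "q \<in> D" "q \<notin> b ` K" for q using that by blast
    \<comment> \<open>then column \<open>k0\<close> is the combination of the others with coefficients \<open>w (b k)\<close>\<close>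
    define u where "u k = (if k = k0 then - 1 else w (b k))" for k
    have z: "(\<Sum>l\<in>D. g d l * (\<Sum>k\<in>insert k0 K. A l k * u k)) = 0" if d: "d \<in> D" for d
    proof -
      have "(\<Sum>l\<in>D. g d l * (\<Sum>k\<in>insert k0 K. A l k * u k))
        = (\<Sum>k\<in>insert k0 K. (\<Sum>l\<in>D. g d l * A l k) * u k)"
        unfolding sum_distrib_left sum_distrib_right by (subst sum.swap) (simp add: mult.assoc)
      also have "\<dots> = - w d + (\<Sum>k\<in>K. (if d = b k then 1 else 0) * w (b k))"
      proof -
        have "(\<Sum>k\<in>K. (\<Sum>l\<in>D. g d l * A l k) * u k) = (\<Sum>k\<in>K. (if d = b k then 1 else 0) * w (b k))"
          using insert.hyps(2) gh(2)[OF d] by (intro sum.cong) (auto simp: u_def)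
        then show ?thesis using insert.hyps by (simp add: w_def u_def)
      qed
      also have "(\<Sum>k\<in>K. (if d = b k then 1 else 0) * w (b k)) = w d"
      proof (cases "d \<in> b ` K")
        case True
        then obtain k where k: "k \<in> K" "d = b k" by blast
        have "(\<Sum>k'\<in>K. (if d = b k' then 1 else 0) * w (b k')) = (\<Sum>k'\<in>K. if k' = k then w d else 0)"
          using k insert.prems(2) by (intro sum.cong) (auto simp: inj_on_def)
        then show ?thesis using k insert.hyps by simp
      next
        case False
        then show ?thesis using w0[OF d] by (auto intro!: sum.neutral)
      qed
      finally show ?thesis by simp
    qed
    have "(\<Sum>k\<in>insert k0 K. A d k * u k) = 0" if d: "d \<in> D" for d
    proof -
      let ?v = "\<lambda>l _. \<Sum>k\<in>insert k0 K. A l k * u k"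
      have "?v d d = mmul D (mmul D h g) ?v d d"
        by (rule mmul_id_left[symmetric]) (use fin d gh(1) in \<open>auto simp: inverse_on_def\<close>)
      also have "\<dots> = mmul D h (\<lambda>_ _. 0) d d"
        unfolding mmul_assoc using z by (intro mmul_cong refl) (simp add: mmul_def)
      finally show ?thesis by (simp add: mmul_def)
    qed
    then have "u k0 = 0" using insert.prems(1)[of u] by blast
    then show False by (simp add: u_def)
  qed
  then obtain q where q: "q \<in> D" "q \<notin> b ` K" "w q \<noteq> 0" by blast
  have p: "b k0 \<in> D" "b k0 \<notin> b ` K" "b ` K \<subseteq> D" using insert.prems insert.hyps by (auto simp: inj_on_insert)
  from pivot_column[where w = w, OF fin p(3,1,2) q]
  obtain g' h' where gh': "inverse_on D g' h'"
    "\<And>i s. i \<in> D \<Longrightarrow> s \<in> b ` K \<Longrightarrow> g' i s = (if i = s then 1 else 0)"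
    "\<And>i. i \<in> D \<Longrightarrow> (\<Sum>l\<in>D. g' i l * w l) = (if i = b k0 then 1 else 0)" by blast
  show ?case
  proof (intro exI conjI ballI)
    show "inverse_on D (mmul D g' g) (mmul D h h')" by (rule inverse_on_mmul[OF fin gh'(1) gh(1)])
  next
    fix d k assume dk: "d \<in> D" "k \<in> insert k0 K"
    have "(\<Sum>l\<in>D. mmul D g' g d l * A l k) = mmul D (mmul D g' g) (\<lambda>l _. A l k) d d"
      by (simp add: mmul_def)
    also have "\<dots> = (\<Sum>l\<in>D. g' d l * (\<Sum>m\<in>D. g l m * A m k))"
      unfolding mmul_assoc by (simp add: mmul_def)
    also have "\<dots> = (if d = b k then 1 else 0)"
    proof (cases "k = k0")
      case True then show ?thesis using gh'(3) dk by (simp add: w_def)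
    next
      case False
      then have k: "k \<in> K" using dk by blast
      have "(\<Sum>l\<in>D. g' d l * (\<Sum>m\<in>D. g l m * A m k)) = (\<Sum>l\<in>D. if l = b k then g' d l else 0)"
        using gh(2) k by (intro sum.cong) auto
      also have "\<dots> = g' d (b k)" using fin p(3) k by (auto simp: sum.delta)
      finally show ?thesis using gh'(2) k dk by auto
    qed
    finally show "(\<Sum>l\<in>D. mmul D g' g d l * A l k) = (if d = b k then 1 else 0)" .
  qed
qed

lemma column_reduce:
  fixes A :: "'i \<Rightarrow> 'j \<Rightarrow> 'k::field"
  assumes fin: "finite D" and finK: "finite K"
    and surj: "\<And>v. (\<And>k. k \<in> K \<Longrightarrow> (\<Sum>d\<in>D. v d * A d k) = 0) \<Longrightarrow> \<forall>d\<in>D. v d = 0"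
    and b: "inj_on b D" "b ` D \<subseteq> K"
  shows "\<exists>g h. inverse_on K g h \<and>
    (\<forall>d\<in>D. \<forall>k\<in>K. (\<Sum>l\<in>K. A d l * g l k) = (if k = b d then 1 else 0))"
proof -
  obtain g h where gh: "inverse_on K g h"
    "\<forall>k\<in>K. \<forall>d\<in>D. (\<Sum>l\<in>K. g k l * A d l) = (if k = b d then 1 else 0)"
    using row_reduce[OF finK fin, of "\<lambda>k d. A d k" b] surj b by (auto simp: mult.commute)
  have "inverse_on K (\<lambda>i j. g j i) (\<lambda>i j. h j i)"
    using gh(1) by (auto simp: inverse_on_def mmul_def mult.commute)
  then show ?thesis using gh(2)
    by (intro exI[of _ "\<lambda>i j. g j i"] exI[of _ "\<lambda>i j. h j i"]) (auto simp: mult.commute)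
qed

text \<open>As \<open>A\<close> has at least as many columns as rows, row reduction turns some \<open>|D|\<close> of its columns into a
permutation matrix, and that has no cokernel.\<close>
lemma injective_imp_surjective:
  fixes A :: "'i \<Rightarrow> 'j \<Rightarrow> 'k::field"
  assumes fin: "finite D" and finK: "finite K" and card: "card D \<le> card K"
    and inj: "\<And>u. (\<And>d. d \<in> D \<Longrightarrow> (\<Sum>k\<in>K. A d k * u k) = 0) \<Longrightarrow> \<forall>k\<in>K. u k = 0"
    and v: "\<And>k. k \<in> K \<Longrightarrow> (\<Sum>d\<in>D. v d * A d k) = 0"
  shows "\<forall>d\<in>D. v d = 0"
proof -
  obtain c where c: "inj_on c D" "c ` D \<subseteq> K" using card_le_inj[OF fin finK card] by blast
  define b where "b = inv_into D c"
  define K0 where "K0 = c ` D"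
  have b: "inj_on b K0" "b ` K0 = D" using c unfolding b_def K0_def
    by (auto simp: inj_on_inv_into inv_into_image_cancel)
  have inj0: "\<forall>k\<in>K0. u k = 0" if u: "\<And>d. d \<in> D \<Longrightarrow> (\<Sum>k\<in>K0. A d k * u k) = 0" for u
  proof -
    have "\<forall>k\<in>K. (if k \<in> K0 then u k else 0) = 0"
    proof (rule inj)
      fix d assume "d \<in> D"
      have "(\<Sum>k\<in>K. A d k * (if k \<in> K0 then u k else 0)) = (\<Sum>k\<in>K0. A d k * u k)"
        using c(2) finK by (intro sum.mono_neutral_cong_right) (auto simp: K0_def)
      then show "(\<Sum>k\<in>K. A d k * (if k \<in> K0 then u k else 0)) = 0" using u[OF \<open>d \<in> D\<close>] by simp
    qed
    then show ?thesis using c(2) unfolding K0_def by (metis subsetD)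
  qed
  have "finite K0" using fin by (simp add: K0_def)
  from row_reduce[OF fin this inj0 b(1)] b(2)
  obtain g h where gh: "inverse_on D g h"
    "\<And>d k. d \<in> D \<Longrightarrow> k \<in> K0 \<Longrightarrow> (\<Sum>l\<in>D. g d l * A l k) = (if d = b k then 1 else 0)"
    by blast
  define y where "y d = (\<Sum>l\<in>D. v l * h l d)" for d
  have "y d = 0" if d: "d \<in> D" for d
  proof -
    obtain k where k: "k \<in> K0" "d = b k" using b d by blast
    let ?v = "\<lambda>_ l. v l" and ?A = "\<lambda>l _. A l k"
    have "y d = (\<Sum>l\<in>D. if l = d then y l else 0)" using fin d by simp
    also have "\<dots> = (\<Sum>l\<in>D. y l * (\<Sum>m\<in>D. g l m * A m k))"
      using gh(2)[OF _ k(1)] k(2) by (intro sum.cong) auto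
    also have "\<dots> = mmul D (mmul D ?v h) (mmul D g ?A) d d" by (simp add: mmul_def y_def)
    also have "\<dots> = mmul D ?v (mmul D (mmul D h g) ?A) d d" by (simp add: mmul_assoc)
    also have "\<dots> = mmul D ?v ?A d d"
      using fin gh(1) by (intro mmul_cong refl mmul_id_left) (auto simp: inverse_on_def)
    also have "\<dots> = 0" using v[of k] k c(2) by (auto simp: mmul_def K0_def)
    finally show ?thesis .
  qed
  then have y: "mmul D (\<lambda>_ l. v l) h d e = 0" if "e \<in> D" for d e using that by (simp add: mmul_def y_def)
  show ?thesis
  proof
    fix d assume d: "d \<in> D"
    have "v d = mmul D (\<lambda>_ l. v l) (mmul D h g) d d"
      by (rule mmul_id_right[symmetric]) (use fin d gh(1) in \<open>auto simp: inverse_on_def\<close>)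
    also have "\<dots> = mmul D (mmul D (\<lambda>_ l. v l) h) g d d" by (simp add: mmul_assoc)
    also have "\<dots> = 0" using y by (simp add: mmul_def[of D _ g])
    finally show "v d = 0" .
  qed
qed

section \<open>A minimal and a maximal class\<close>

text \<open>\<open>R i j\<close> allows the entry \<open>X i j\<close>, a map from the \<open>j\<close>-th to the \<open>i\<close>-th coordinate. The hypotheses say that the
coordinates in \<open>K\<close> span a subspace which every \<open>X\<close> preserves, that those in \<open>D\<close> are the coordinates of a
quotient on which every \<open>X\<close> acts, and that all maps within \<open>K\<close>, within \<open>D\<close>, and from \<open>D\<close> to \<open>K\<close> are
allowed. Consequently the corner \<open>F\<^sub>D\<^sub>K\<close> intertwines the two actions.\<close>
locale extremal_pair =
  fixes J K D :: "'i set" and R :: "'i \<Rightarrow> 'i \<Rightarrow> bool"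
  assumes fin: "finite J"
    and R_refl: "\<And>i. i \<in> J \<Longrightarrow> R i i"
    and tr: "\<And>i j k. i \<in> J \<Longrightarrow> j \<in> J \<Longrightarrow> k \<in> J \<Longrightarrow> R i j \<Longrightarrow> R j k \<Longrightarrow> R i k"
    and KJ: "K \<subseteq> J" and DJ: "D \<subseteq> J" and KD: "K \<inter> D = {}"
    and K_min: "\<And>i j. i \<in> J \<Longrightarrow> j \<in> K \<Longrightarrow> R i j \<Longrightarrow> i \<in> K"
    and K_full: "\<And>i j. i \<in> K \<Longrightarrow> j \<in> K \<Longrightarrow> R i j"
    and D_max: "\<And>i j. i \<in> D \<Longrightarrow> j \<in> J \<Longrightarrow> R i j \<Longrightarrow> j \<in> D"
    and D_full: "\<And>i j. i \<in> D \<Longrightarrow> j \<in> D \<Longrightarrow> R i j"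
    and K_D: "\<And>i j. i \<in> K \<Longrightarrow> j \<in> D \<Longrightarrow> R i j"
begin

lemma finK: "finite K" and finD: "finite D"
  using fin KJ DJ finite_subset by auto

lemma inK: "i \<in> K \<Longrightarrow> i \<in> J" and inD: "i \<in> D \<Longrightarrow> i \<in> J" and inKD: "i \<in> K \<Longrightarrow> i \<notin> D"
  using KJ DJ KD by auto

text \<open>The rank one matrix \<open>u v\<^sup>T\<close> supported on \<open>K \<times> D\<close> stabilizes \<open>F\<close>: \<open>F (u v\<^sup>T)\<close> vanishes on the rows in \<open>D\<close>
and \<open>(u v\<^sup>T) F\<close> on the columns in \<open>K\<close>, and by extremality no other entry is tested. It is not
scalar unless \<open>u\<close> or \<open>v\<close> is zero.\<close>
lemma rigid_full_rank:
  fixes F :: "'i \<Rightarrow> 'i \<Rightarrow> 'k::field"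
  assumes F: "rigid J R F"
    and u: "\<And>d. d \<in> D \<Longrightarrow> (\<Sum>k\<in>K. F d k * u k) = 0"
    and v: "\<And>k. k \<in> K \<Longrightarrow> (\<Sum>d\<in>D. v d * F d k) = 0"
  shows "(\<forall>k\<in>K. u k = 0) \<or> (\<forall>d\<in>D. v d = 0)"
proof (rule ccontr)
  assume "\<not> ?thesis"
  then obtain k0 d0 where kd: "k0 \<in> K" "u k0 \<noteq> 0" "d0 \<in> D" "v d0 \<noteq> 0" by blast
  define X where "X i j = (if i \<in> K \<and> j \<in> D then u i * v j else 0)" for i j
  have FX: "(\<Sum>l\<in>J. F i l * X l j) = (if j \<in> D then (\<Sum>k\<in>K. F i k * u k) * v j else 0)" for i j
  proof -
    have "(\<Sum>l\<in>J. F i l * X l j) = (\<Sum>k\<in>K. F i k * (if j \<in> D then u k * v j else 0))"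
      using fin KJ by (intro sum.mono_neutral_cong_right) (auto simp: X_def)
    then show ?thesis by (simp add: sum_distrib_right sum_distrib_left mult_ac)
  qed
  have XF: "(\<Sum>l\<in>J. X i l * F l j) = (if i \<in> K then u i * (\<Sum>d\<in>D. v d * F d j) else 0)" for i j
  proof -
    have "(\<Sum>l\<in>J. X i l * F l j) = (\<Sum>d\<in>D. (if i \<in> K then u i * v d else 0) * F d j)"
      using fin DJ by (intro sum.mono_neutral_cong_right) (auto simp: X_def)
    then show ?thesis by (simp add: sum_distrib_left mult_ac)
  qed
  have "stabilizes J R F X"
    unfolding stabilizes_def
  proof (intro conjI ballI impI)
    show "supported J R X" using K_D by (auto simp: supported_def X_def)
  next
    fix i j assume ij: "i \<in> J" "j \<in> J" "R j i"
    have "j \<in> D \<Longrightarrow> i \<in> D" "i \<in> K \<Longrightarrow> j \<in> K" using D_max K_min ij by blast+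
    then have "(\<Sum>l\<in>J. F i l * X l j) = 0" "(\<Sum>l\<in>J. X i l * F l j) = 0"
      unfolding FX XF using u[of i] v[of j] by simp_all
    then show "mcomm J F X i j = 0" by (simp add: mcomm_def)
  qed
  then obtain c where "\<forall>i\<in>J. \<forall>j\<in>J. X i j = (if i = j then c else 0)"
    using F unfolding rigid_def scalar_on_def by blast
  then have "X k0 d0 = (if k0 = d0 then c else 0)" using kd(1,3) inK inD by blast
  then have "X k0 d0 = 0" using kd(1,3) inKD by auto
  then show False using kd by (simp add: X_def)
qed

text \<open>With the partial identity \<open>b\<close> in the corner, \<open>F\<close> multiplies by selecting rows or columns. All
contributions of the corner to \<open>[F, X]\<close> become single entries of \<open>X\<close>, so the equations can be
solved for them.\<close>
lemma block_mcomm: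
  fixes F X :: "'i \<Rightarrow> 'i \<Rightarrow> 'k::field"
  assumes S: "S \<subseteq> J - D" and b: "inj_on b S" "b ` S \<subseteq> D"
    and F1: "\<forall>d\<in>D. \<forall>l\<in>J - D. F d l = (if l \<in> S \<and> d = b l then 1 else 0)"
    and F2: "\<forall>i\<in>J - D. \<forall>e\<in>D. F i e = 0"
    and X: "supported J R X"
  shows "\<And>i j. i \<in> J - D \<Longrightarrow> j \<in> J - D \<Longrightarrow>
      mcomm J F X i j = mcomm (J - D) F X i j - (if j \<in> S then X i (b j) else 0)"
    and "\<And>d j. d \<in> D \<Longrightarrow> j \<in> J - D \<Longrightarrow>
      mcomm J F X d j = (if d \<in> b ` S then X (inv_into S b d) j else 0) - (if j \<in> S then X d (b j) else 0)"
    and "\<And>d e. d \<in> D \<Longrightarrow> e \<in> D \<Longrightarrow>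
      mcomm J F X d e = (if d \<in> b ` S then X (inv_into S b d) e else 0) + mcomm D F X d e"
proof -
  have X0: "X d j = 0" if "d \<in> D" "j \<in> J - D" for d j
    using supportedD[OF X, of d j] that D_max inD by blast
  have split: "(\<Sum>l\<in>J. f l) = (\<Sum>l\<in>J - D. f l) + (\<Sum>l\<in>D. f l)" for f :: "'i \<Rightarrow> 'k"
    using fin DJ by (simp add: sum.subset_diff)
  have S': "finite S" using S fin finite_subset by blast
  have row: "(\<Sum>l\<in>J - D. F d l * x l) = (if d \<in> b ` S then x (inv_into S b d) else 0)"
    if d: "d \<in> D" for d x
  proof -
    have "(\<Sum>l\<in>J - D. F d l * x l) = (\<Sum>l\<in>S. if d = b l then x l else 0)"
      using S fin F1 d by (intro sum.mono_neutral_cong_right) auto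
    also have "\<dots> = (if d \<in> b ` S then x (inv_into S b d) else 0)"
    proof (cases "d \<in> b ` S")
      case True
      then obtain s where s: "s \<in> S" "d = b s" by blast
      have "(\<Sum>l\<in>S. if d = b l then x l else 0) = (\<Sum>l\<in>S. if l = s then x l else 0)"
        using s b by (intro sum.cong) (auto simp: inj_on_def)
      then show ?thesis using s b S' by (simp add: inv_into_f_f)
    qed (auto intro!: sum.neutral)
    finally show ?thesis .
  qed
  have col: "(\<Sum>l\<in>D. x l * F l j) = (if j \<in> S then x (b j) else 0)" if j: "j \<in> J - D" for j x
  proof -
    have "(\<Sum>l\<in>D. x l * F l j) = (\<Sum>l\<in>D. if l = b j then (if j \<in> S then x l else 0) else 0)"
      using F1 j by (intro sum.cong) auto
    then show ?thesis using finD b by (auto simp: sum.delta)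
  qed
  show "mcomm J F X i j = mcomm (J - D) F X i j - (if j \<in> S then X i (b j) else 0)"
    if "i \<in> J - D" "j \<in> J - D" for i j
    using that F2 X0 col[of j "X i"] unfolding mcomm_def split by simp
  show "mcomm J F X d j = (if d \<in> b ` S then X (inv_into S b d) j else 0) - (if j \<in> S then X d (b j) else 0)"
    if "d \<in> D" "j \<in> J - D" for d j
    using that X0 col[of j "X d"] row[of d "\<lambda>l. X l j"] unfolding mcomm_def split by simp
  show "mcomm J F X d e = (if d \<in> b ` S then X (inv_into S b d) e else 0) + mcomm D F X d e"
    if "d \<in> D" "e \<in> D" for d e
    using that X0 F2 row[of d "\<lambda>l. X l e"] unfolding mcomm_def split by simp
qed

section \<open>Eliminating a class: surjective corner\<close>

text \<open>Write \<open>K = K' \<union> S\<close>, where \<open>K'\<close> is the kernel of the corner and \<open>S \<cong> D\<close> along \<open>b\<close>, and let \<open>P\<close> be the set of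
indices below \<open>D\<close>. The equations in the rows \<open>D\<close> say that \<open>X\<close> acts on \<open>D\<close> as on \<open>S\<close>, that it preserves
the kernel of \<open>F\<close> on the span of \<open>P - D\<close> (hence the positions deleted in \<open>R'\<close>), and that
\<open>X\<^sub>S\<^sub>D = - [Q, X]\<close> with \<open>Q = F\<^sub>D\<^sub>D\<close>. The equations in the columns \<open>S\<close> give \<open>X\<^sub>P\<^sub>D = [F, X]\<^sub>P\<^sub>S\<close>. So \<open>X\<close>
is determined by its restriction to \<open>J - D\<close>, and what remains of the equations is the condition for
\<open>F' = F + Q\<close>, with \<open>Q\<close> moved to \<open>S \<times> S\<close>: comparing the two values of \<open>X\<^sub>S\<^sub>D\<close> gives \<open>[F + Q, X]\<^sub>S\<^sub>S = 0\<close>.\<close>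
lemma surjective_normal_form:
  fixes F :: "'i \<Rightarrow> 'i \<Rightarrow> 'k::field"
  assumes S: "S \<subseteq> K" and b: "bij_betw b S D"
    and P_succ: "\<And>i d k. i \<in> J \<Longrightarrow> d \<in> D \<Longrightarrow> R i d \<Longrightarrow> k \<in> K \<Longrightarrow> R k i"
    and R': "\<And>i j. i \<in> J - D \<Longrightarrow> j \<in> J - D \<Longrightarrow>
      R' i j \<longleftrightarrow> R i j \<and> \<not> (i \<in> S \<and> j \<notin> S \<and> (\<exists>d\<in>D. R j d))"
    and F1: "\<forall>d\<in>D. \<forall>l\<in>J - D. F d l = (if l \<in> S \<and> d = b l then 1 else 0)"
    and F2: "\<forall>i\<in>J - D. \<forall>e\<in>D. F i e = 0"
    and F': "\<And>i j. i \<in> J - D \<Longrightarrow> j \<in> J - D \<Longrightarrow>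
      F' i j = F i j + (if i \<in> S \<and> j \<in> S then F (b i) (b j) else 0)"
  shows "rigid J R F \<longleftrightarrow> rigid (J - D) R' F'"
proof -
  define Q where "Q i j = F (b i) (b j)" for i j
  have S_sub: "S \<subseteq> J - D" using S inK inKD by auto
  have binj: "inj_on b S" and bim: "b ` S = D" using b by (auto simp: bij_betw_def)
  have bD: "b s \<in> D" if "s \<in> S" for s using that bim by blast
  have bI: "inv_into S b (b s) = s" if "s \<in> S" for s using that binj by simp
  have sK: "s \<in> K" "s \<in> J" "s \<in> J - D" if "s \<in> S" for s using that S S_sub inK by auto
  note block = block_mcomm[where S = S and b = b and F = F, OF S_sub binj equalityD1[OF bim] F1 F2]
  have small: "mcomm (J - D) F' X i j = mcomm (J - D) F X i j
      + (if i \<in> S then \<Sum>l\<in>S. Q i l * X l j else 0) - (if j \<in> S then \<Sum>l\<in>S. X i l * Q l j else 0)"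
    if ij: "i \<in> J - D" "j \<in> J - D" for X i j
  proof -
    have sum_S: "(\<Sum>l\<in>J - D. if l \<in> S then f l else 0) = (\<Sum>l\<in>S. f l)" for f :: "'i \<Rightarrow> 'k"
      using S_sub fin by (simp add: sum.If_cases Int_absorb1)
    have 1: "(\<Sum>l\<in>J - D. (if i \<in> S \<and> l \<in> S then F (b i) (b l) else 0) * X l j)
        = (if i \<in> S then \<Sum>l\<in>S. Q i l * X l j else 0)"
      using sum_S[of "\<lambda>l. Q i l * X l j"] by (cases "i \<in> S") (simp_all add: Q_def if_distrib[of "\<lambda>x. x * _"] cong: if_cong)
    have 2: "(\<Sum>l\<in>J - D. X i l * (if l \<in> S \<and> j \<in> S then F (b l) (b j) else 0))
        = (if j \<in> S then \<Sum>l\<in>S. X i l * Q l j else 0)"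
      using sum_S[of "\<lambda>l. X i l * Q l j"] by (cases "j \<in> S") (simp_all add: Q_def if_distrib[of "\<lambda>x. _ * x"] cong: if_cong)
    have 3: "(\<Sum>l\<in>J - D. F' i l * X l j) = (\<Sum>l\<in>J - D. F i l * X l j)
        + (\<Sum>l\<in>J - D. (if i \<in> S \<and> l \<in> S then F (b i) (b l) else 0) * X l j)"
      unfolding sum.distrib[symmetric] using ij by (intro sum.cong refl) (subst F', simp_all add: distrib_right)
    have 4: "(\<Sum>l\<in>J - D. X i l * F' l j) = (\<Sum>l\<in>J - D. X i l * F l j)
        + (\<Sum>l\<in>J - D. X i l * (if l \<in> S \<and> j \<in> S then F (b l) (b j) else 0))"
      unfolding sum.distrib[symmetric] using ij by (intro sum.cong refl) (subst F', simp_all add: distrib_left)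
    show ?thesis unfolding mcomm_def 3 4 1 2 by simp
  qed
  have Dre: "mcomm D F X (b s) (b t) = mcomm S Q (\<lambda>i j. X (b i) (b j)) s t" for X s t
    unfolding Q_def by (rule mcomm_reindex[OF b, symmetric])
  \<comment> \<open>the correction by \<open>Q\<close> is felt only in \<open>S \<times> S\<close>\<close>
  have small0: "mcomm (J - D) F' X i j = mcomm (J - D) F X i j"
    if "i \<in> J - D" "j \<in> J - D" "j \<notin> S" "R j i" and X: "supported (J - D) R' X" for X i j
  proof -
    have "(\<Sum>l\<in>S. Q i l * X l j) = 0" if i: "i \<in> S"
    proof (intro sum.neutral ballI)
      fix l assume l: "l \<in> S"
      have "j \<in> K" using K_min[of j i] i that S \<open>j \<in> J - D\<close> \<open>R j i\<close> by blast
      then obtain "\<exists>d\<in>D. R j d" using K_D bD i by blast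
      then have "\<not> R' l j" using R'[of l j] l sK \<open>j \<in> J - D\<close> \<open>j \<notin> S\<close> by blast
      then show "Q i l * X l j = 0" using supportedD[OF X, of l j] l sK \<open>j \<in> J - D\<close> by simp
    qed
    then show ?thesis using small that by simp
  qed
  have smallP: "mcomm (J - D) F' X i s = mcomm (J - D) F X i s"
    if "i \<in> J - D" "s \<in> S" "i \<notin> S" "i \<notin> K" and X: "supported (J - D) R' X" for X i s
  proof -
    have "X i l = 0" if l: "l \<in> S" for l
      using supportedD[OF X, of i l] R'[of i l] K_min[of i l] \<open>i \<in> J - D\<close> \<open>i \<notin> K\<close> l sK by blast
    then show ?thesis using small[of i s X] sK that by simp
  qed
  have smallS: "mcomm (J - D) F' X s t = mcomm (J - D) F X s t + mcomm S Q X s t"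
    if "s \<in> S" "t \<in> S" for X s t
    using small[of s t X] that sK by (simp add: mcomm_def)
  show ?thesis
  proof
    assume rig: "rigid J R F"
    show "rigid (J - D) R' F'"
      unfolding rigid_def
    proof (intro allI impI)
      fix X assume X: "stabilizes (J - D) R' F' X"
      then have Xs: "supported (J - D) R' X"
        and Xc: "\<And>i j. i \<in> J - D \<Longrightarrow> j \<in> J - D \<Longrightarrow> R' j i \<Longrightarrow> mcomm (J - D) F' X i j = 0"
        by (auto simp: stabilizes_def)
      let ?inv = "inv_into S b"
      \<comment> \<open>the only possible extension of \<open>X\<close> to \<open>J\<close>\<close>
      define Y where "Y i j =
        (if i \<in> J - D then
           if j \<in> D then (if \<exists>d\<in>D. R i d then mcomm (J - D) F X i (?inv j) else 0) else X i j
         else if j \<in> D then X (?inv i) (?inv j) else 0)" for i j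
      have Yin: "Y i j = X i j" if "i \<in> J - D" "j \<in> J - D" for i j using that by (simp add: Y_def)
      have YS: "Y (b s) (b t) = X s t" if "s \<in> S" "t \<in> S" for s t
        using that bD bI by (simp add: Y_def)
      have YP: "Y i (b t) = mcomm (J - D) F X i t" if "i \<in> J - D" "t \<in> S" "\<exists>d\<in>D. R i d" for i t
        using that bD bI by (simp add: Y_def)
      have Ymc: "mcomm (J - D) F Y i j = mcomm (J - D) F X i j" if "i \<in> J - D" "j \<in> J - D" for i j
        using that by (intro mcomm_cong refl Yin) auto
      have Ys: "supported J R Y"
        unfolding supported_def
      proof (intro ballI impI)
        fix i j assume ij: "i \<in> J" "j \<in> J" "\<not> R i j"
        show "Y i j = 0"
        proof (cases "j \<in> D")
          case True
          then show ?thesis using ij D_full tr[of i _ j] inD by (auto simp: Y_def)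
        next
          case False
          then show ?thesis using ij supportedD[OF Xs, of i j] R'[of i j] by (auto simp: Y_def)
        qed
      qed
      have "stabilizes J R F Y"
        unfolding stabilizes_def
      proof (intro conjI Ys ballI impI)
        fix i j assume ij: "i \<in> J" "j \<in> J" "R j i"
        show "mcomm J F Y i j = 0"
        proof (cases "i \<in> D")
          case True
          then obtain s where s: "s \<in> S" "i = b s" using bim by blast
          show ?thesis
          proof (cases "j \<in> D")
            case True
            then obtain t where t: "t \<in> S" "j = b t" using bim by blast
            have "mcomm J F Y i j = Y s (b t) + mcomm D F Y (b s) (b t)"
              using block(3)[OF Ys, of i j] \<open>i \<in> D\<close> \<open>j \<in> D\<close> s t bI by simp
            also have "mcomm D F Y (b s) (b t) = mcomm S Q X s t"
              unfolding Dre using s t YS by (intro mcomm_cong) auto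
            also have "Y s (b t) = mcomm (J - D) F X s t"
              using YP[of s t] s t sK bD K_D by blast
            also have "\<dots> + mcomm S Q X s t = mcomm (J - D) F' X s t"
              using smallS s t by simp
            also have "\<dots> = 0" using Xc[of s t] R'[of t s] s t sK K_full by blast
            finally show ?thesis .
          next
            case False
            then have j: "j \<in> J - D" using ij by blast
            have P: "\<exists>d\<in>D. R j d" using \<open>R j i\<close> \<open>i \<in> D\<close> by blast
            have "mcomm J F Y i j = Y s j - (if j \<in> S then Y i (b j) else 0)"
              using block(2)[OF Ys, of i j] \<open>i \<in> D\<close> j s bI by simp
            also have "\<dots> = 0"
            proof (cases "j \<in> S")
              case True then show ?thesis using YS s Yin[of s j] sK j by simp
            next
              case False
              then show ?thesis using Yin[of s j] supportedD[OF Xs, of s j] R'[of s j] P s sK j by simp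
            qed
            finally show ?thesis .
          qed
        next
          case False
          then have i: "i \<in> J - D" and j: "j \<in> J - D" using ij D_max by auto
          have eq: "mcomm J F Y i j = mcomm (J - D) F X i j - (if j \<in> S then Y i (b j) else 0)"
            using block(1)[OF Ys, of i j] i j Ymc by simp
          show ?thesis
          proof (cases "j \<in> S")
            case False
            then have "R' j i" using R'[of j i] i j ij by blast
            then show ?thesis using eq False Xc[of i j] small0[OF i j False \<open>R j i\<close> Xs] i j by simp
          next
            case True
            show ?thesis
            proof (cases "\<exists>d\<in>D. R i d")
              case True then show ?thesis using eq YP[OF i \<open>j \<in> S\<close>] \<open>j \<in> S\<close> by simp
            next
              case noP: False
              then have "i \<notin> K" using K_D bD \<open>j \<in> S\<close> by blast
              then have "i \<notin> S" using S by blast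
              have "R' j i" using R'[of j i] i j ij noP by blast
              then show ?thesis using eq True Xc[of i j] smallP[OF i \<open>j \<in> S\<close> \<open>i \<notin> S\<close> \<open>i \<notin> K\<close> Xs] i j noP bD
                by (simp add: Y_def)
            qed
          qed
        qed
      qed
      then obtain c where "\<And>i j. i \<in> J \<Longrightarrow> j \<in> J \<Longrightarrow> Y i j = (if i = j then c else 0)"
        using rig unfolding rigid_def scalar_on_def by metis
      then have "\<forall>i\<in>J - D. \<forall>j\<in>J - D. X i j = (if i = j then c else 0)" using Yin by (metis DiffD1)
      then show "scalar_on (J - D) X" unfolding scalar_on_def by blast
    qed
  next
    assume rig: "rigid (J - D) R' F'"
    show "rigid J R F"
      unfolding rigid_def
    proof (intro allI impI)
      fix X assume X: "stabilizes J R F X"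
      then have Xs: "supported J R X"
        and Xc: "\<And>i j. i \<in> J \<Longrightarrow> j \<in> J \<Longrightarrow> R j i \<Longrightarrow> mcomm J F X i j = 0"
        by (auto simp: stabilizes_def)
      \<comment> \<open>the equations of \<open>[F, X]\<close> that meet the corner, solved for single entries of \<open>X\<close>\<close>
      have E1: "X s j = 0" if "s \<in> S" "j \<in> J - D" "j \<notin> S" "d \<in> D" "R j d" for s j d
      proof -
        have "R j (b s)" using tr[of j d "b s"] that D_full bD inD by blast
        then have "mcomm J F X (b s) j = 0" using Xc that bD inD by blast
        then show ?thesis using block(2)[OF Xs, of "b s" j] that bD bI by simp
      qed
      have E2: "X (b s) (b t) = X s t" if "s \<in> S" "t \<in> S" for s t
      proof -
        have "mcomm J F X (b s) t = 0"
          using Xc[OF inD[OF bD[OF that(1)]] sK(2)[OF that(2)] K_D[OF sK(1)[OF that(2)] bD[OF that(1)]]] .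
        then show ?thesis using block(2)[OF Xs, of "b s" t] that bD bI sK by simp
      qed
      have E3: "X s (b t) = - mcomm S Q X s t" if "s \<in> S" "t \<in> S" for s t
      proof -
        have "mcomm J F X (b s) (b t) = 0"
          using Xc[OF inD[OF bD[OF that(1)]] inD[OF bD[OF that(2)]] D_full[OF bD[OF that(2)] bD[OF that(1)]]] .
        then have "X s (b t) = - mcomm D F X (b s) (b t)"
          using block(3)[OF Xs, of "b s" "b t"] that bD bI by (simp add: eq_neg_iff_add_eq_0)
        also have "mcomm D F X (b s) (b t) = mcomm S Q X s t"
          unfolding Dre using that E2 by (intro mcomm_cong) auto
        finally show ?thesis .
      qed
      have E4: "mcomm (J - D) F X i t = X i (b t)" if "i \<in> J - D" "t \<in> S" "R t i" for i t
      proof -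
        have "mcomm J F X i t = 0" using Xc that sK by blast
        then show ?thesis using block(1)[OF Xs, of i t] that sK by simp
      qed
      have Xs': "supported (J - D) R' X"
        unfolding supported_def
      proof (intro ballI impI)
        fix i j assume ij: "i \<in> J - D" "j \<in> J - D" "\<not> R' i j"
        then show "X i j = 0" using R'[of i j] supportedD[OF Xs, of i j] E1[of i j] by blast
      qed
      have "stabilizes (J - D) R' F' X"
        unfolding stabilizes_def
      proof (intro conjI Xs' ballI impI)
        fix i j assume i: "i \<in> J - D" and j: "j \<in> J - D" and "R' j i"
        then have Rji: "R j i" and nP: "j \<in> S \<Longrightarrow> i \<notin> S \<Longrightarrow> d \<in> D \<Longrightarrow> \<not> R i d" for d using R'[of j i] by auto
        show "mcomm (J - D) F' X i j = 0"
        proof (cases "j \<in> S")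
          case False
          have "mcomm J F X i j = 0" using Xc i j Rji by blast
          then show ?thesis using small0[OF i j False Rji Xs'] block(1)[OF Xs, of i j] i j False by simp
        next
          case True
          show ?thesis
          proof (cases "i \<in> S")
            case True
            then show ?thesis using smallS[of i j X] \<open>j \<in> S\<close> E4[of i j] E3[of i j] i Rji by simp
          next
            case False
            have nR: "\<not> R i (b j)" using nP[of "b j"] True False bD by blast
            then have "i \<notin> K" using K_D bD True by blast
            then have "mcomm (J - D) F' X i j = X i (b j)"
              using smallP[OF i True False _ Xs'] E4[OF i True Rji] by simp
            also have "\<dots> = 0" using supportedD[OF Xs, of i "b j"] nR i inD bD True by blast
            finally show ?thesis .
          qed
        qed
      qed
      then obtain c where c: "\<And>i j. i \<in> J - D \<Longrightarrow> j \<in> J - D \<Longrightarrow> X i j = (if i = j then c else 0)"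
        using rig unfolding rigid_def scalar_on_def by metis
      have mc0: "mcomm (J - D) F X i t = 0" if "i \<in> J - D" "t \<in> J - D" for i t
        using fin that c by (intro mcomm_scalar) auto
      show "scalar_on J X" unfolding scalar_on_def
      proof (intro exI[of _ c] ballI)
        fix i j assume ij: "i \<in> J" "j \<in> J"
        show "X i j = (if i = j then c else 0)"
        proof (cases "j \<in> D")
          case True
          then obtain t where t: "t \<in> S" "j = b t" using bim by blast
          show ?thesis
          proof (cases "i \<in> D")
            case True
            then obtain s where s: "s \<in> S" "i = b s" using bim by blast
            have "X i j = (if s = t then c else 0)" using E2 c sK s t by simp
            then show ?thesis using s t binj by (auto simp: inj_on_def)
          next
            case False
            have "X i j = 0"
            proof (cases "R i j")
              case True
              then have "R t i" using P_succ[of i j t] ij \<open>j \<in> D\<close> sK t by blast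
              then show ?thesis using E4[of i t] mc0[of i t] True False ij t sK \<open>j \<in> D\<close> by simp
            qed (use supportedD[OF Xs] ij in blast)
            then show ?thesis using \<open>j \<in> D\<close> False by auto
          qed
        next
          case False
          show ?thesis
          proof (cases "i \<in> D")
            case True
            then have "\<not> R i j" using D_max[of i j] ij False by blast
            then show ?thesis using supportedD[OF Xs ij] True False by auto
          qed (use c[of i j] ij False in simp)
        qed
      qed
    qed
  qed
qed

section \<open>Eliminating a class: injective corner\<close>

text \<open>Only \<open>K\<close> and \<open>D\<close> lie below \<open>D\<close>, so the block \<open>y = X\<^sub>K\<^sub>D\<close> is the only one that leads from \<open>D\<close> out of \<open>D\<close>. The corner embeds
\<open>K\<close> in \<open>D\<close> as an invariant subspace on which \<open>X\<close> acts as on \<open>K\<close>. With \<open>Q = F\<^sub>D\<^sub>D\<close>, the rows \<open>b ` K\<close> of \<open>[F, X]\<^sub>D\<^sub>D\<close>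
give \<open>y = - [Q, X]\<close>, so \<open>y\<close> is eliminated, while the off-diagonal block of \<open>X\<^sub>D\<^sub>D\<close> from \<open>D1 = D - b ` K\<close> to \<open>b ` K \<cong> K\<close>
takes over its role. The map \<open>g\<close> identifies \<open>K \<union> D1\<close> with \<open>D\<close>, and \<open>Q\<close> is transported along it: its block from
\<open>K\<close> to \<open>D1\<close> is the new corner.\<close>
lemma injective_normal_form:
  fixes F :: "'i \<Rightarrow> 'i \<Rightarrow> 'k::field"
  assumes b: "inj_on b K" "b ` K \<subseteq> D"
    and P: "\<And>i d. i \<in> J \<Longrightarrow> d \<in> D \<Longrightarrow> R i d \<Longrightarrow> i \<in> K \<union> D"
    and F1: "\<forall>d\<in>D. \<forall>l\<in>J - D. F d l = (if l \<in> K \<and> d = b l then 1 else 0)"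
    and F2: "\<forall>i\<in>J - D. \<forall>e\<in>D. F i e = 0"
    and g: "\<And>i. g i = (if i \<in> K then b i else i)"
    and F': "\<And>i j. F' i j = (if i \<notin> D \<and> j \<notin> D then F i j else 0)
      + (if i \<in> K \<union> (D - b ` K) \<and> j \<in> K \<union> (D - b ` K) then F (g i) (g j) else 0)"
  shows "rigid J R F \<longleftrightarrow> rigid (J - b ` K) R F'"
proof -
  define D1 where "D1 = D - b ` K"
  define K1 where "K1 = K \<union> D1"
  define J' where "J' = J - b ` K"
  define Q where "Q i j = F (g i) (g j)" for i j
  have bD: "b k \<in> D" if "k \<in> K" for k using that b by blast
  have sub: "K \<subseteq> J - D" using inK inKD by auto
  have J'_split: "J' = (J - D) \<union> D1" unfolding J'_def D1_def using b(2) DJ by blast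
  have D1D: "i \<in> D" if "i \<in> D1" for i using that by (simp add: D1_def)
  have K1J': "K1 \<subseteq> J'" unfolding J'_split K1_def using sub by blast
  have J'J: "i \<in> J" if "i \<in> J'" for i using that by (simp add: J'_def)
  have finJ': "finite J'" using fin by (simp add: J'_def)
  have gK: "g i = b i" if "i \<in> K" for i using that g by simp
  have gD1: "g i = i" if "i \<in> D1" for i using that g D1D inKD by auto
  have gbij: "bij_betw g K1 D"
  proof -
    have "inj_on g K1"
    proof (rule inj_onI)
      fix x y assume xy: "x \<in> K1" "y \<in> K1" "g x = g y"
      consider "x \<in> K" "y \<in> K" | "x \<in> D1" "y \<in> D1" | "x \<in> K" "y \<in> D1" | "x \<in> D1" "y \<in> K"
        using xy unfolding K1_def by blast
      then show "x = y"
      proof cases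
        case 1 then show ?thesis using xy(3) gK b(1) by (simp add: inj_on_def)
      next
        case 2 then show ?thesis using xy(3) gD1 by simp
      next
        case 3 then show ?thesis using xy(3) gK gD1 by (auto simp: D1_def)
      next
        case 4
        then have "x = b y" using xy(3) gK gD1 by simp
        then show ?thesis using 4 by (auto simp: D1_def)
      qed
    qed
    moreover have "g ` K1 = b ` K \<union> D1"
      unfolding K1_def image_Un using gK gD1 by simp
    moreover have "b ` K \<union> D1 = D" using b(2) by (auto simp: D1_def)
    ultimately show ?thesis by (simp add: bij_betw_def)
  qed
  have gD: "g s \<in> D" if "s \<in> K1" for s using gbij that bij_betwE by blast
  have Dg: "\<exists>s\<in>K1. d = g s" if "d \<in> D" for d using gbij that by (auto simp: bij_betw_def)
  have g_inj: "g s = g t \<longleftrightarrow> s = t" if "s \<in> K1" "t \<in> K1" for s t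
    using gbij that by (auto simp: bij_betw_def inj_on_def)
  have gbK: "g s \<in> b ` K \<longleftrightarrow> s \<in> K" if "s \<in> K1" for s
    using that gK gD1 by (auto simp: K1_def D1_def)
  have binv: "inv_into K b (b s) = s" if "s \<in> K" for s using that b(1) by simp
  note block = block_mcomm[OF sub b F1 F2]
  have Dre: "mcomm D F X (g s) (g t) = mcomm K1 Q (\<lambda>i j. X (g i) (g j)) s t" for X s t
    unfolding Q_def by (rule mcomm_reindex[OF gbij, symmetric])
  have small: "mcomm J' F' X i j =
      (if i \<notin> D then \<Sum>l\<in>J - D. F i l * X l j else 0) - (if j \<notin> D then \<Sum>l\<in>J - D. X i l * F l j else 0)
      + (if i \<in> K1 then \<Sum>l\<in>K1. Q i l * X l j else 0) - (if j \<in> K1 then \<Sum>l\<in>K1. X i l * Q l j else 0)"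
    for X i j
  proof -
    have JD: "(\<Sum>l\<in>J'. if l \<notin> D then f l else 0) = (\<Sum>l\<in>J - D. f l)" for f :: "'i \<Rightarrow> 'k"
    proof -
      have "J' \<inter> {l. l \<notin> D} = J - D" unfolding J'_split D1_def by blast
      then show ?thesis using finJ' by (simp add: sum.If_cases)
    qed
    have K1s: "(\<Sum>l\<in>J'. if l \<in> K1 then f l else 0) = (\<Sum>l\<in>K1. f l)" for f :: "'i \<Rightarrow> 'k"
      using finJ' K1J' by (simp add: sum.If_cases Int_absorb1)
    have 1: "(\<Sum>l\<in>J'. F' i l * X l j) = (\<Sum>l\<in>J'. if l \<notin> D then (if i \<notin> D then F i l * X l j else 0) else 0)
       + (\<Sum>l\<in>J'. if l \<in> K1 then (if i \<in> K1 then Q i l * X l j else 0) else 0)"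
      unfolding sum.distrib[symmetric]
      by (rule sum.cong) (auto simp: F' Q_def K1_def D1_def distrib_right)
    have 2: "(\<Sum>l\<in>J'. X i l * F' l j) = (\<Sum>l\<in>J'. if l \<notin> D then (if j \<notin> D then X i l * F l j else 0) else 0)
       + (\<Sum>l\<in>J'. if l \<in> K1 then (if j \<in> K1 then X i l * Q l j else 0) else 0)"
      unfolding sum.distrib[symmetric]
      by (rule sum.cong) (auto simp: F' Q_def K1_def D1_def distrib_left)
    show ?thesis unfolding mcomm_def 1 2 JD K1s by simp
  qed
  have X0: "X i l = 0" if X: "supported J' R X" and "i \<in> D1" "l \<in> J - D" for X :: "'i \<Rightarrow> 'i \<Rightarrow> 'k" and i l
    using supportedD[OF X, of i l] D_max[of i l] that D1D by (auto simp: J'_split)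
  have s1: "mcomm J' F' X i j = mcomm (J - D) F X i j" if "i \<in> J - D" "j \<in> J - D" "i \<notin> K" "j \<notin> K" for X i j
    unfolding small using that D1D by (auto simp: K1_def mcomm_def)
  have s2: "mcomm J' F' X i j = mcomm (J - D) F X i j"
    if X: "supported J' R X" and "i \<in> J - D" "i \<notin> K" "j \<in> K" for X i j
  proof -
    have "X i l = 0" if "l \<in> K1" for l
      using supportedD[OF X, of i l] P[of i l] K_min[of i l] \<open>i \<in> J - D\<close> \<open>i \<notin> K\<close> that K1J'
      unfolding K1_def D1_def J'_split by blast
    then show ?thesis unfolding small using that inKD D1D by (auto simp: K1_def mcomm_def)
  qed
  have s3: "mcomm J' F' X i j = mcomm (J - D) F X i j + mcomm K1 Q X i j" if "i \<in> K" "j \<in> K" for X i j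
    unfolding small using that inKD by (simp add: K1_def mcomm_def)
  have s4: "mcomm J' F' X i j = mcomm K1 Q X i j"
    if X: "supported J' R X" and "i \<in> D1" "j \<in> K1" for X i j
    unfolding small using that X0[OF X \<open>i \<in> D1\<close>] D1D by (simp add: mcomm_def K1_def)
  have kind: "i \<in> D1 \<and> j \<in> K1 \<or> i \<in> J - D \<and> j \<in> J - D" if "i \<in> J'" "j \<in> J'" "R j i" for i j
    using that D_max[of j i] P[of j i] unfolding J'_split K1_def D1_def by blast
  have "rigid J R F \<longleftrightarrow> rigid J' R F'"
  proof
    assume rig: "rigid J R F"
    show "rigid J' R F'"
      unfolding rigid_def
    proof (intro allI impI)
      fix X assume X: "stabilizes J' R F' X"
      then have Xs: "supported J' R X"
        and Xc: "\<And>i j. i \<in> J' \<Longrightarrow> j \<in> J' \<Longrightarrow> R j i \<Longrightarrow> mcomm J' F' X i j = 0"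
        by (auto simp: stabilizes_def)
      define gi where "gi = inv_into K1 g"
      have gi: "gi (g s) = s" if "s \<in> K1" for s
        unfolding gi_def using gbij that by (simp add: bij_betw_inv_into_left)
      define Z where "Z i j = X (gi i) (gi j)" for i j
      \<comment> \<open>\<open>Z\<close> is \<open>X\<close> transported to \<open>D\<close>, and the block \<open>K \<times> D\<close> is forced\<close>
      define Y where "Y i j =
        (if i \<in> D then if j \<in> D then Z i j else 0
         else if j \<in> D then if i \<in> K then - mcomm D F Z (b i) j else 0 else X i j)" for i j
      have YK1: "Y (g s) (g t) = X s t" if "s \<in> K1" "t \<in> K1" for s t
        using that gD gi by (simp add: Y_def Z_def)
      have Yin: "Y i j = X i j" if "i \<in> J - D" "j \<in> J - D" for i j using that by (simp add: Y_def)
      have Ymc: "mcomm (J - D) F Y i j = mcomm (J - D) F X i j" if "i \<in> J - D" "j \<in> J - D" for i j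
        using that by (intro mcomm_cong Yin) auto
      have YD: "mcomm D F Y (g s) (g t) = mcomm K1 Q X s t" if "s \<in> K1" "t \<in> K1" for s t
        unfolding Dre using that YK1 by (intro mcomm_cong) auto
      have YKD: "Y s (g t) = - mcomm K1 Q X s t" if "s \<in> K" "t \<in> K1" for s t
      proof -
        have s: "s \<in> K1" using that by (simp add: K1_def)
        have "Y s (g t) = - mcomm D F Z (g s) (g t)" using that inKD gD gK by (simp add: Y_def)
        also have "mcomm D F Z (g s) (g t) = mcomm D F Y (g s) (g t)"
          using that s gD by (intro mcomm_cong) (auto simp: Y_def)
        finally show ?thesis using YD[OF s that(2)] by simp
      qed
      have Ys: "supported J R Y"
        unfolding supported_def
      proof (intro ballI impI)
        fix i j assume ij: "i \<in> J" "j \<in> J" "\<not> R i j"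
        then show "Y i j = 0"
          using D_full[of i j] K_D[of i j] supportedD[OF Xs, of i j] by (auto simp: Y_def J'_split)
      qed
      have "stabilizes J R F Y"
        unfolding stabilizes_def
      proof (intro conjI Ys ballI impI)
        fix i j assume ij: "i \<in> J" "j \<in> J" "R j i"
        show "mcomm J F Y i j = 0"
        proof (cases "i \<in> D")
          case True
          then obtain s where s: "s \<in> K1" "i = g s" using Dg by blast
          show ?thesis
          proof (cases "j \<in> D")
            case True
            then obtain t where t: "t \<in> K1" "j = g t" using Dg by blast
            have eq: "mcomm J F Y i j = (if i \<in> b ` K then Y (inv_into K b i) j else 0) + mcomm K1 Q X s t"
              using block(3)[OF Ys \<open>i \<in> D\<close> \<open>j \<in> D\<close>] YD s t by simp
            show ?thesis
            proof (cases "s \<in> K")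
              case True
              then show ?thesis using eq YKD[OF True t(1)] s t gK binv by simp
            next
              case False
              then have s1: "s \<in> D1" using s by (simp add: K1_def)
              have "R t s" using K_D[of t s] D_full[of t s] s1 t D1D by (auto simp: K1_def)
              then have "mcomm K1 Q X s t = 0"
                using s4[OF Xs s1 t(1)] Xc[of s t] s(1) t(1) K1J' by auto
              then show ?thesis using eq False gbK s by simp
            qed
          next
            case False
            then have j: "j \<in> K" using P ij \<open>i \<in> D\<close> by blast
            have jj: "j \<in> J - D" "j \<in> K1" using j sub by (auto simp: K1_def)
            have eq: "mcomm J F Y i j = (if i \<in> b ` K then Y (inv_into K b i) j else 0) - Y i (b j)"
              using block(2)[OF Ys \<open>i \<in> D\<close> jj(1)] j by simp
            have 2: "Y i (b j) = X s j" using YK1[OF s(1) jj(2)] s gK[OF j] by simp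
            show ?thesis
            proof (cases "s \<in> K")
              case True
              then have "i \<in> b ` K" "inv_into K b i = s" using s gK binv by auto
              then show ?thesis using eq 2 Yin[of s j] True sub jj by auto
            next
              case False
              then have "s \<in> D1" using s by (simp add: K1_def)
              then show ?thesis using eq 2 False gbK s X0[OF Xs _ jj(1)] by simp
            qed
          qed
        next
          case False
          then have i: "i \<in> J - D" and j: "j \<in> J - D" using ij D_max[of j i] by blast+
          have iJ': "i \<in> J'" "j \<in> J'" using i j by (auto simp: J'_split)
          have X0: "mcomm J' F' X i j = 0" using Xc iJ' ij by blast
          have eq: "mcomm J F Y i j = mcomm (J - D) F X i j - (if j \<in> K then Y i (b j) else 0)"
            using block(1)[OF Ys i j] Ymc[OF i j] by simp
          show ?thesis
          proof (cases "j \<in> K")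
            case False
            then have "i \<notin> K" using K_min[of j i] ij by blast
            then show ?thesis using eq False s1[OF i j] X0 by simp
          next
            case jK: True
            show ?thesis
            proof (cases "i \<in> K")
              case True
              have "Y i (b j) = - mcomm K1 Q X i j"
                using YKD[OF True, of j] gK[OF jK] jK by (simp add: K1_def)
              then show ?thesis using eq jK s3[OF True jK, of X] X0 by simp
            next
              case False
              then show ?thesis using eq jK s2[OF Xs i False jK] X0 bD i by (simp add: Y_def)
            qed
          qed
        qed
      qed
      then obtain c where c: "\<And>i j. i \<in> J \<Longrightarrow> j \<in> J \<Longrightarrow> Y i j = (if i = j then c else 0)"
        using rig unfolding rigid_def scalar_on_def by metis
      show "scalar_on J' X" unfolding scalar_on_def
      proof (intro exI[of _ c] ballI)
        fix i j assume ij: "i \<in> J'" "j \<in> J'"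
        consider "i \<in> K1" "j \<in> K1" | "i \<in> J - D" "j \<in> J - D" | "i \<in> D1" "j \<in> J - D"
          | "i \<in> J - D" "i \<notin> K" "j \<in> D1"
          using ij unfolding J'_split K1_def by blast
        then show "X i j = (if i = j then c else 0)"
        proof cases
          case 1
          then show ?thesis using YK1[OF 1] c[of "g i" "g j"] gD inD g_inj[OF 1] by simp
        next
          case 2 then show ?thesis using Yin[OF 2] c[of i j] by simp
        next
          case 3 then show ?thesis using X0[OF Xs 3] D1D by auto
        next
          case 4
          then have "\<not> R i j" using P[of i j] D1D by blast
          then show ?thesis using 4 supportedD[OF Xs ij] D1D by auto
        qed
      qed
    qed
  next
    assume rig: "rigid J' R F'"
    show "rigid J R F"
      unfolding rigid_def
    proof (intro allI impI)
      fix X assume X: "stabilizes J R F X"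
      then have Xs: "supported J R X"
        and Xc: "\<And>i j. i \<in> J \<Longrightarrow> j \<in> J \<Longrightarrow> R j i \<Longrightarrow> mcomm J F X i j = 0"
        by (auto simp: stabilizes_def)
      \<comment> \<open>the rows \<open>D\<close> of \<open>[F, X]\<close>\<close>
      have E2: "(if s \<in> K then X s t else 0) = X (g s) (b t)" if "s \<in> K1" "t \<in> K" for s t
      proof -
        have t: "t \<in> J - D" using that sub by blast
        have "mcomm J F X (g s) t = 0"
          using Xc[OF inD[OF gD[OF that(1)]] inK[OF that(2)] K_D[OF that(2) gD[OF that(1)]]] .
        then show ?thesis using block(2)[OF Xs gD[OF that(1)] t] that gbK gK binv by auto
      qed
      have E3: "(if s \<in> K then X s (g t) else 0) = - mcomm D F X (g s) (g t)" if "s \<in> K1" "t \<in> K1" for s t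
      proof -
        have "mcomm J F X (g s) (g t) = 0"
          using Xc[OF inD[OF gD[OF that(1)]] inD[OF gD[OF that(2)]] D_full[OF gD[OF that(2)] gD[OF that(1)]]] .
        then show ?thesis using block(3)[OF Xs gD[OF that(1)] gD[OF that(2)]] that gbK gK binv
          by (auto simp: eq_neg_iff_add_eq_0)
      qed
      define Y where "Y i j = (if i \<in> K1 \<and> j \<in> K1 then X (g i) (g j) else X i j)" for i j
      have Yin: "Y i j = X i j" if "i \<in> J - D" "j \<in> J - D" for i j
      proof (cases "i \<in> K \<and> j \<in> K")
        case True
        then show ?thesis using E2[of i j] gK by (simp add: Y_def K1_def)
      next
        case False
        then have "\<not> (i \<in> K1 \<and> j \<in> K1)" using that D1D by (auto simp: K1_def)
        then show ?thesis by (auto simp: Y_def)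
      qed
      have Ymc: "mcomm (J - D) F Y i j = mcomm (J - D) F X i j" if "i \<in> J - D" "j \<in> J - D" for i j
        using that by (intro mcomm_cong Yin) auto
      have YD: "mcomm K1 Q Y s t = mcomm D F X (g s) (g t)" if "s \<in> K1" "t \<in> K1" for s t
        unfolding Dre using that by (intro mcomm_cong) (auto simp: Y_def)
      have Ys: "supported J' R Y"
        unfolding supported_def
      proof (intro ballI impI)
        fix i j assume ij: "i \<in> J'" "j \<in> J'" "\<not> R i j"
        show "Y i j = 0"
        proof (cases "i \<in> K1 \<and> j \<in> K1")
          case True
          then have "i \<in> D1" "j \<in> K" "i \<notin> K"
            using ij(3) K_full[of i j] K_D[of i j] D_full[of i j] D1D inKD unfolding K1_def by blast+
          then show ?thesis using E2[of i j] gK gD1 True by (simp add: Y_def)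
        next
          case False
          then show ?thesis using supportedD[OF Xs, of i j] ij J'J by (auto simp: Y_def)
        qed
      qed
      have "stabilizes J' R F' Y"
        unfolding stabilizes_def
      proof (intro conjI Ys ballI impI)
        fix i j assume ij: "i \<in> J'" "j \<in> J'" "R j i"
        from kind[OF this] show "mcomm J' F' Y i j = 0"
        proof
          assume "i \<in> D1 \<and> j \<in> K1"
          then have 1: "i \<in> D1" "j \<in> K1" "i \<in> K1" "i \<notin> K" using D1D inKD by (auto simp: K1_def)
          then show ?thesis using s4[OF Ys 1(1,2)] YD[OF 1(3,2)] E3[OF 1(3,2)] by simp
        next
          assume "i \<in> J - D \<and> j \<in> J - D"
          then have i: "i \<in> J - D" and j: "j \<in> J - D" by auto
          have 0: "mcomm J F X i j = 0" using Xc i j ij by blast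
          show ?thesis
          proof (cases "j \<in> K")
            case False
            then have "i \<notin> K" using K_min[of j i] ij i j by blast
            then show ?thesis using s1[OF i j] False block(1)[OF Xs i j] 0 Ymc[OF i j] by simp
          next
            case jK: True
            then have jK1: "j \<in> K1" by (simp add: K1_def)
            show ?thesis
            proof (cases "i \<in> K")
              case True
              then have iK1: "i \<in> K1" by (simp add: K1_def)
              have "mcomm J' F' Y i j = mcomm (J - D) F X i j + mcomm D F X (g i) (g j)"
                using s3[OF True jK] Ymc[OF i j] YD[OF iK1 jK1] by simp
              also have "mcomm (J - D) F X i j = X i (g j)"
                using block(1)[OF Xs i j] 0 jK gK by simp
              finally show ?thesis using E3[OF iK1 jK1] True by simp
            next
              case False
              have "\<not> R i (b j)" using P[of i "b j"] i False bD[OF jK] by blast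
              then have "X i (b j) = 0" using supportedD[OF Xs] i bD[OF jK] inD by blast
              then show ?thesis using s2[OF Ys i False jK] Ymc[OF i j] block(1)[OF Xs i j] 0 by simp
            qed
          qed
        qed
      qed
      then obtain c where c: "\<And>i j. i \<in> J' \<Longrightarrow> j \<in> J' \<Longrightarrow> Y i j = (if i = j then c else 0)"
        using rig unfolding rigid_def scalar_on_def by metis
      have K1': "s \<in> J'" if "s \<in> K1" for s using that K1J' by blast
      have finK1: "finite K1" using finJ' K1J' finite_subset by blast
      have mc0: "mcomm K1 Q Y s t = 0" if "s \<in> K1" "t \<in> K1" for s t
        using finK1 that K1' c by (intro mcomm_scalar) auto
      show "scalar_on J X" unfolding scalar_on_def
      proof (intro exI[of _ c] ballI)
        fix i j assume ij: "i \<in> J" "j \<in> J"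
        show "X i j = (if i = j then c else 0)"
        proof (cases "j \<in> D")
          case True
          then obtain t where t: "t \<in> K1" "j = g t" using Dg by blast
          show ?thesis
          proof (cases "i \<in> D")
            case True
            then obtain s where s: "s \<in> K1" "i = g s" using Dg by blast
            have "X i j = Y s t" using s t by (simp add: Y_def)
            then show ?thesis using c[of s t] K1' s t g_inj by simp
          next
            case False
            have "X i j = 0"
            proof (cases "i \<in> K")
              case True
              then have iK1: "i \<in> K1" by (simp add: K1_def)
              show ?thesis using E3[OF iK1 t(1)] YD[OF iK1 t(1)] mc0[OF iK1 t(1)] True t by simp
            next
              case iK: False
              then have "\<not> R i j" using P[of i j] ij True False by blast
              then show ?thesis using supportedD[OF Xs ij] by blast
            qed
            then show ?thesis using True False by auto
          qed
        next
          case jD: False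
          show ?thesis
          proof (cases "i \<in> D")
            case True
            then have "\<not> R i j" using D_max[of i j] ij jD by blast
            then show ?thesis using supportedD[OF Xs ij] True jD by auto
          next
            case False
            then have i: "i \<in> J - D" "j \<in> J - D" using ij jD by auto
            then have "i \<in> J'" "j \<in> J'" by (auto simp: J'_split)
            then show ?thesis using Yin[OF i] c[of i j] by simp
          qed
        qed
      qed
    qed
  qed
  then show ?thesis by (simp add: J'_def)
qed

end

section \<open>The two reductions\<close>

definition block_extend :: "'i set \<Rightarrow> ('i \<Rightarrow> 'i \<Rightarrow> 'k::field) \<Rightarrow> 'i \<Rightarrow> 'i \<Rightarrow> 'k" where
  "block_extend K g i j = (if i \<in> K \<and> j \<in> K then g i j else if i = j then 1 else 0)"

lemma mmul_block_extend_left: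
  assumes "finite J" "K \<subseteq> J" "i \<in> J"
  shows "mmul J (block_extend K g) A i j = (if i \<in> K then \<Sum>l\<in>K. g i l * A l j else A i j)"
proof (cases "i \<in> K")
  case True
  have "mmul J (block_extend K g) A i j = (\<Sum>l\<in>K. g i l * A l j)"
    unfolding mmul_def using assms True
    by (intro sum.mono_neutral_cong_right) (auto simp: block_extend_def)
  then show ?thesis using True by simp
next
  case False
  then show ?thesis using mmul_id_left[OF assms(1,3), of "block_extend K g"]
    by (simp add: block_extend_def)
qed

lemma mmul_block_extend_right:
  assumes "finite J" "K \<subseteq> J" "j \<in> J"
  shows "mmul J A (block_extend K g) i j = (if j \<in> K then \<Sum>l\<in>K. A i l * g l j else A i j)"
proof (cases "j \<in> K")
  case True
  have "mmul J A (block_extend K g) i j = (\<Sum>l\<in>K. A i l * g l j)"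
    unfolding mmul_def using assms True
    by (intro sum.mono_neutral_cong_right) (auto simp: block_extend_def)
  then show ?thesis using True by simp
next
  case False
  then show ?thesis using mmul_id_right[OF assms(1,3), of "block_extend K g"]
    by (simp add: block_extend_def)
qed

lemma inverse_on_block_extend:
  assumes fin: "finite J" "K \<subseteq> J" and gh: "inverse_on K g h"
  shows "inverse_on J (block_extend K g) (block_extend K h)"
proof -
  have "mmul J (block_extend K a) (block_extend K b) i j = (if i = j then 1 else 0)"
    if ab: "\<forall>i\<in>K. \<forall>j\<in>K. mmul K a b i j = (if i = j then 1 else 0)" and "i \<in> J" "j \<in> J" for a b i j
  proof (cases "i \<in> K \<and> j \<in> K")
    case True
    then have "mmul J (block_extend K a) (block_extend K b) i j = (\<Sum>l\<in>K. a i l * block_extend K b l j)"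
      using mmul_block_extend_left[OF fin \<open>i \<in> J\<close>, of a] by simp
    also have "\<dots> = mmul K a b i j"
      unfolding mmul_def using True by (intro sum.cong) (auto simp: block_extend_def)
    finally show ?thesis using ab True by simp
  next
    case False
    then show ?thesis using fin that
      by (auto simp: mmul_block_extend_left block_extend_def intro!: sum.neutral)
  qed
  then show ?thesis using gh unfolding inverse_on_def by blast
qed

text \<open>Conjugation by \<open>1 - Z\<close>, written out in entries.\<close>
lemma rigid_unipotent_conj:
  fixes F Z :: "'i \<Rightarrow> 'i \<Rightarrow> 'k::field"
  assumes fin: "finite J"
    and R_refl: "\<And>i. i \<in> J \<Longrightarrow> R i i"
    and tr: "\<And>i j k. i \<in> J \<Longrightarrow> j \<in> J \<Longrightarrow> k \<in> J \<Longrightarrow> R i j \<Longrightarrow> R j k \<Longrightarrow> R i k"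
    and Z: "supported J R Z" and ZZ: "\<And>i l j. i \<in> J \<Longrightarrow> l \<in> J \<Longrightarrow> j \<in> J \<Longrightarrow> Z i l * Z l j = 0"
    and F: "rigid J R F"
    and B: "\<And>i j. B i j = F i j + (\<Sum>l\<in>J. F i l * Z l j)"
    and G: "\<And>i j. G i j = B i j - (\<Sum>l\<in>J. Z i l * B l j)"
  shows "rigid J R G"
proof -
  let ?p = "\<lambda>i j. (if i = j then 1 else 0) + Z i j" and ?m = "\<lambda>i j. (if i = j then 1 else 0) - Z i j"
  have 1: "supported J R ?p" "supported J R ?m" using R_refl Z by (auto simp: supported_def)
  have 2: "inverse_on J ?m ?p" using inverse_on_unipotent[where Z = Z, OF fin ZZ] by (auto simp: inverse_on_def)
  have Bm: "mmul J F ?p i j = B i j" if "j \<in> J" for i j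
  proof -
    have "mmul J F ?p i j = (\<Sum>l\<in>J. (if l = j then F i l else 0) + F i l * Z l j)"
      unfolding mmul_def by (intro sum.cong) (auto simp: distrib_left)
    then show ?thesis using that fin B by (simp add: sum.distrib sum.delta)
  qed
  have Gm: "mmul J ?m (mmul J F ?p) i j = G i j" if "i \<in> J" "j \<in> J" for i j
  proof -
    have "mmul J ?m (mmul J F ?p) i j = (\<Sum>l\<in>J. (if i = l then B l j else 0) - Z i l * B l j)"
      unfolding mmul_def[of J ?m] using Bm that by (intro sum.cong) (auto simp: left_diff_distrib)
    then show ?thesis using that fin G by (simp add: sum_subtractf sum.delta')
  qed
  have "rigid J R (mmul J ?m (mmul J F ?p))" by (rule rigid_conj[OF fin tr 1(2,1) 2 F])
  then show ?thesis by (rule rigid_cong[OF tr Gm, rotated -1])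
qed

context extremal_pair
begin

text \<open>By \<open>rigid_full_rank\<close> the corner is injective or surjective; for \<open>|D| \<le> |K|\<close> the first implies the second.\<close>
lemma rigid_corner_surjective:
  fixes F :: "'i \<Rightarrow> 'i \<Rightarrow> 'k::field"
  assumes F: "rigid J R F" and card: "card D \<le> card K"
    and v: "\<And>k. k \<in> K \<Longrightarrow> (\<Sum>d\<in>D. v d * F d k) = 0"
  shows "\<forall>d\<in>D. v d = 0"
proof (rule ccontr)
  assume nz: "\<not> ?thesis"
  have inj: "\<forall>k\<in>K. u k = 0" if u: "\<And>d. d \<in> D \<Longrightarrow> (\<Sum>k\<in>K. F d k * u k) = 0" for u
  proof -
    have "(\<forall>k\<in>K. u k = 0) \<or> (\<forall>d\<in>D. v d = 0)" by (rule rigid_full_rank[OF F]) (fact u, fact v)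
    then show ?thesis using nz by simp
  qed
  have "\<forall>d\<in>D. v d = 0"
    by (rule injective_imp_surjective[where A = F, OF finD finK card]) (fact inj, fact v)
  then show False using nz by simp
qed

lemma rigid_corner_injective:
  fixes F :: "'i \<Rightarrow> 'i \<Rightarrow> 'k::field"
  assumes F: "rigid J R F" and card: "card K \<le> card D"
    and u: "\<And>d. d \<in> D \<Longrightarrow> (\<Sum>k\<in>K. F d k * u k) = 0"
  shows "\<forall>k\<in>K. u k = 0"
proof (rule ccontr)
  assume nz: "\<not> ?thesis"
  have inj: "\<forall>d\<in>D. v d = 0" if v: "\<And>k. k \<in> K \<Longrightarrow> (\<Sum>d\<in>D. F d k * v d) = 0" for v
  proof -
    have "(\<Sum>d\<in>D. v d * F d k) = 0" if "k \<in> K" for k using v[OF that] by (simp add: mult.commute)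
    then have "(\<forall>k\<in>K. u k = 0) \<or> (\<forall>d\<in>D. v d = 0)" by (intro rigid_full_rank[OF F] u)
    then show ?thesis using nz by simp
  qed
  have "\<forall>k\<in>K. u k = 0"
  proof (rule injective_imp_surjective[where A = "\<lambda>k d. F d k", OF finK finD card])
    show "(\<Sum>k\<in>K. u k * F d k) = 0" if "d \<in> D" for d using u[OF that] by (simp add: mult.commute)
  qed (fact inj)
  then show False using nz by simp
qed

lemma rigid_column_reduced:
  fixes F :: "'i \<Rightarrow> 'i \<Rightarrow> 'k::field"
  assumes F: "rigid J R F" and S: "S \<subseteq> K" and b: "bij_betw b S D"
  shows "\<exists>G. rigid J R G \<and> (\<forall>d\<in>D. \<forall>l\<in>K. G d l = (if l \<in> S \<and> d = b l then 1 else (0::'k)))"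
proof -
  define c where "c = inv_into S b"
  have c: "inj_on c D" "c ` D = S"
    using bij_betw_inv_into[OF b] by (auto simp: bij_betw_def c_def)
  have bc: "b (c d) = d" if "d \<in> D" for d unfolding c_def using b that by (simp add: bij_betw_inv_into_right)
  have cb: "c (b l) = l" if "l \<in> S" for l unfolding c_def using b that by (simp add: bij_betw_inv_into_left)
  have card: "card D \<le> card K"
    using bij_betw_same_card[OF b] card_mono[OF finK S] by simp
  have "\<exists>g h. inverse_on K g h \<and> (\<forall>d\<in>D. \<forall>k\<in>K. (\<Sum>l\<in>K. F d l * g l k) = (if k = c d then 1 else 0))"
    by (rule column_reduce[OF finD finK _ c(1)]) (rule rigid_corner_surjective[OF F card], assumption, use c(2) S in simp_all)
  then obtain g h where gh: "inverse_on K g h"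
    "\<And>d k. d \<in> D \<Longrightarrow> k \<in> K \<Longrightarrow> (\<Sum>l\<in>K. F d l * g l k) = (if k = c d then 1 else 0)"
    by blast
  let ?g = "block_extend K g" and ?h = "block_extend K h"
  have sup: "supported J R ?g" "supported J R ?h"
    using K_full R_refl by (auto simp: supported_def block_extend_def)
  have inv: "inverse_on J ?h ?g"
    using inverse_on_block_extend[OF fin KJ gh(1)] by (auto simp: inverse_on_def)
  have "rigid J R (mmul J ?h (mmul J F ?g))" by (rule rigid_conj[OF fin tr sup(2,1) inv F])
  moreover have "mmul J ?h (mmul J F ?g) d l = (if l \<in> S \<and> d = b l then 1 else 0)" if "d \<in> D" "l \<in> K" for d l
  proof -
    have "mmul J ?h (mmul J F ?g) d l = mmul J F ?g d l"
      using that inKD by (subst mmul_block_extend_left[OF fin KJ inD]) auto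
    also have "\<dots> = (if l = c d then 1 else 0)"
      using that by (simp add: mmul_block_extend_right[OF fin KJ inK] gh(2))
    also have "l = c d \<longleftrightarrow> l \<in> S \<and> d = b l" using that c bc cb by auto
    finally show ?thesis .
  qed
  ultimately show ?thesis by blast
qed

lemma rigid_row_reduced:
  fixes F :: "'i \<Rightarrow> 'i \<Rightarrow> 'k::field"
  assumes F: "rigid J R F" and b: "inj_on b K" "b ` K \<subseteq> D"
  shows "\<exists>G. rigid J R G \<and> (\<forall>d\<in>D. \<forall>l\<in>K. G d l = (if d = b l then 1 else (0::'k)))"
proof -
  have card: "card K \<le> card D" using card_inj_on_le[OF b finD] .
  have "\<exists>g h. inverse_on D g h \<and> (\<forall>d\<in>D. \<forall>k\<in>K. (\<Sum>l\<in>D. g d l * F l k) = (if d = b k then 1 else 0))"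
    by (rule row_reduce[OF finD finK _ b]) (rule rigid_corner_injective[OF F card])
  then obtain g h where gh: "inverse_on D g h"
    "\<And>d k. d \<in> D \<Longrightarrow> k \<in> K \<Longrightarrow> (\<Sum>l\<in>D. g d l * F l k) = (if d = b k then 1 else 0)"
    by blast
  let ?g = "block_extend D g" and ?h = "block_extend D h"
  have sup: "supported J R ?g" "supported J R ?h"
    using D_full R_refl by (auto simp: supported_def block_extend_def)
  have inv: "inverse_on J ?g ?h" using inverse_on_block_extend[OF fin DJ gh(1)] .
  have "rigid J R (mmul J ?g (mmul J F ?h))" by (rule rigid_conj[OF fin tr sup inv F])
  moreover have "mmul J ?g (mmul J F ?h) d l = (if d = b l then 1 else 0)" if "d \<in> D" "l \<in> K" for d l
  proof -
    have "mmul J F ?h m l = F m l" for m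
      using that inKD by (subst mmul_block_extend_right[OF fin DJ inK]) auto
    then show ?thesis using that gh(2) by (simp add: mmul_block_extend_left[OF fin DJ inD])
  qed
  ultimately show ?thesis by blast
qed

text \<open>A rigid \<open>F\<close> is brought to normal form by a change of basis in \<open>K\<close>, which reduces the corner, followed
by the unipotent \<open>1 + Z\<close>, which uses the columns \<open>S\<close> to clear the entries of \<open>F\<close> in the rows \<open>D\<close> and
the columns outside \<open>K\<close> that lie below \<open>D\<close>. Conversely any \<open>F'\<close> on \<open>J - D\<close> arises from a normal form,
up to entries that are never tested (\<open>rigid_cong\<close>): the block of \<open>F'\<close> at \<open>S \<times> S\<close> is
put at \<open>D \<times> D\<close>.\<close>
theorem surjective_reduction:
  assumes S: "S \<subseteq> K" and b: "bij_betw b S D"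
    and P_succ: "\<And>i d k. i \<in> J \<Longrightarrow> d \<in> D \<Longrightarrow> R i d \<Longrightarrow> k \<in> K \<Longrightarrow> R k i"
    and R': "\<And>i j. i \<in> J - D \<Longrightarrow> j \<in> J - D \<Longrightarrow>
      R' i j \<longleftrightarrow> R i j \<and> \<not> (i \<in> S \<and> j \<notin> S \<and> (\<exists>d\<in>D. R j d))"
  shows "has_rigid TYPE('k::field) J R \<longleftrightarrow> has_rigid TYPE('k) (J - D) R'"
proof
  have bD: "b s \<in> D" if "s \<in> S" for s using b that bij_betwE by blast
  have SJ: "s \<in> J - D" if "s \<in> S" for s using that S inK inKD by blast
  have PD: "R i e" if "R i d" "d \<in> D" "e \<in> D" "i \<in> J" for i d e
    using tr[of i d e] that inD D_full by blast
  {
    assume "has_rigid TYPE('k) J R"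
    then obtain F0 :: "'i \<Rightarrow> 'i \<Rightarrow> 'k" where "rigid J R F0" unfolding has_rigid_def by blast
    then obtain F where F: "rigid J R F"
      and FK: "\<forall>d\<in>D. \<forall>l\<in>K. F d l = (if l \<in> S \<and> d = b l then 1 else (0::'k))"
      using rigid_column_reduced[OF _ S b] by blast
    define Z where "Z i j = (if i \<in> S \<and> j \<in> J - K - D \<and> (\<exists>d\<in>D. R j d) then - F (b i) j else 0)" for i j
    define B where "B i j = F i j + (\<Sum>l\<in>J. F i l * Z l j)" for i j
    define G where "G i j = B i j - (\<Sum>l\<in>J. Z i l * B l j)" for i j
    have "rigid J R G"
    proof (rule rigid_unipotent_conj[OF fin R_refl tr _ _ F B_def G_def])
      show "supported J R Z" using P_succ S by (auto simp: supported_def Z_def)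
      show "Z i l * Z l j = 0" for i l j using S by (auto simp: Z_def)
    qed
    have Gd: "G d l = (if l \<in> S \<and> d = b l then 1 else 0)"
      if d: "d \<in> D" and l: "l \<in> J - D" "R l d" for d l
    proof -
      have "Z d m = 0" for m using d SJ by (auto simp: Z_def)
      then have "G d l = B d l" by (simp add: G_def)
      also have "(\<Sum>m\<in>J. F d m * Z m l) = (if l \<in> K then 0 else - F d l)"
      proof (cases "l \<in> K")
        case True then show ?thesis by (auto simp: Z_def intro!: sum.neutral)
      next
        case False
        obtain s where s: "s \<in> S" "d = b s" using b d by (auto simp: bij_betw_def)
        have "(\<Sum>m\<in>J. F d m * Z m l) = (\<Sum>m\<in>J. if m = s then - F d l else 0)"
        proof (rule sum.cong)
          fix m assume "m \<in> J"
          show "F d m * Z m l = (if m = s then - F d l else 0)"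
          proof (cases "m \<in> S")
            case True
            have "d = b m \<longleftrightarrow> m = s" using s True b by (auto simp: bij_betw_def inj_on_def)
            then show ?thesis using FK d True S False l by (auto simp: Z_def)
          qed (use s in \<open>auto simp: Z_def\<close>)
        qed simp
        then show ?thesis using False fin SJ s by (auto simp: sum.delta)
      qed
      then have "B d l = (if l \<in> K then F d l else 0)" by (simp add: B_def)
      finally show ?thesis using FK d S by auto
    qed
    define H where "H i j = (if R j i then G i j else 0)" for i j
    have "rigid J R H" by (rule rigid_cong[OF tr _ \<open>rigid J R G\<close>]) (auto simp: H_def)
    have H1: "\<forall>d\<in>D. \<forall>l\<in>J - D. H d l = (if l \<in> S \<and> d = b l then 1 else 0)"
      using Gd K_D S by (auto simp: H_def)
    have H2: "\<forall>i\<in>J - D. \<forall>e\<in>D. H i e = 0" using D_max by (auto simp: H_def)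
    have "rigid (J - D) R' (\<lambda>i j. H i j + (if i \<in> S \<and> j \<in> S then H (b i) (b j) else 0))"
      by (rule surjective_normal_form[THEN iffD1, OF S b P_succ R' H1 H2 _ \<open>rigid J R H\<close>]) simp_all
    then show "has_rigid TYPE('k) (J - D) R'" unfolding has_rigid_def by blast
  }
  {
    assume "has_rigid TYPE('k) (J - D) R'"
    then obtain F0 :: "'i \<Rightarrow> 'i \<Rightarrow> 'k" where F0: "rigid (J - D) R' F0" unfolding has_rigid_def by blast
    define c where "c = inv_into S b"
    have cb: "c (b l) = l" if "l \<in> S" for l unfolding c_def using b that by (simp add: bij_betw_inv_into_left)
    define F where "F i j = (if i \<in> D then if j \<in> D then F0 (c i) (c j) else if j \<in> S \<and> i = b j then 1 else 0
        else if j \<in> D then 0 else if i \<in> S \<and> j \<in> S then 0 else F0 i j)" for i j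
    have tr': "R' i k" if "i \<in> J - D" "j \<in> J - D" "k \<in> J - D" "R' i j" "R' j k" for i j k
    proof -
      have R: "R i j" "R j k" "R i k" using that R'[of i j] R'[of j k] tr[of i j k] by auto
      have "\<not> (i \<in> S \<and> k \<notin> S \<and> (\<exists>d\<in>D. R k d))"
      proof
        assume a: "i \<in> S \<and> k \<notin> S \<and> (\<exists>d\<in>D. R k d)"
        then obtain d where d: "d \<in> D" "R k d" by blast
        then have "R j d" using tr[of j k d] R that inD by blast
        then show False using that R'[of i j] R'[of j k] a d by blast
      qed
      then show ?thesis using R R'[of i k] that by blast
    qed
    have small: "rigid (J - D) R' (\<lambda>i j. F i j + (if i \<in> S \<and> j \<in> S then F (b i) (b j) else 0))"
      using bD cb by (intro rigid_cong[OF tr' _ F0]) (auto simp: F_def)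
    have F1: "\<forall>d\<in>D. \<forall>l\<in>J - D. F d l = (if l \<in> S \<and> d = b l then 1 else 0)"
      and F2: "\<forall>i\<in>J - D. \<forall>e\<in>D. F i e = 0" by (auto simp: F_def)
    have "rigid J R F"
      by (rule surjective_normal_form[THEN iffD2, OF S b P_succ R' F1 F2 _ small]) simp_all
    then show "has_rigid TYPE('k) J R" unfolding has_rigid_def by blast
  }
qed

text \<open>Here a change of basis in \<open>D\<close> alone produces the normal form. Conversely the block of \<open>F'\<close> at
\<open>K \<union> (D - b ` K)\<close> is put at \<open>D \<times> D\<close> along \<open>g\<close>.\<close>
theorem injective_reduction:
  assumes b: "inj_on b K" "b ` K \<subseteq> D"
    and P: "\<And>i d. i \<in> J \<Longrightarrow> d \<in> D \<Longrightarrow> R i d \<Longrightarrow> i \<in> K \<union> D"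
  shows "has_rigid TYPE('k::field) J R \<longleftrightarrow> has_rigid TYPE('k) (J - b ` K) R"
proof
  define g where "g i = (if i \<in> K then b i else i)" for i
  {
    assume "has_rigid TYPE('k) J R"
    then obtain F0 :: "'i \<Rightarrow> 'i \<Rightarrow> 'k" where "rigid J R F0" unfolding has_rigid_def by blast
    then obtain F where F: "rigid J R F"
      and FK: "\<forall>d\<in>D. \<forall>l\<in>K. F d l = (if d = b l then 1 else (0::'k))"
      using rigid_row_reduced[OF _ b] by blast
    define H where "H i j = (if R j i then F i j else 0)" for i j
    have "rigid J R H" by (rule rigid_cong[OF tr _ F]) (auto simp: H_def)
    have H1: "\<forall>d\<in>D. \<forall>l\<in>J - D. H d l = (if l \<in> K \<and> d = b l then 1 else 0)"
    proof (intro ballI)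
      fix d l assume "d \<in> D" "l \<in> J - D"
      then show "H d l = (if l \<in> K \<and> d = b l then 1 else 0)"
        using FK K_D[of l d] P[of l d] by (auto simp: H_def)
    qed
    have H2: "\<forall>i\<in>J - D. \<forall>e\<in>D. H i e = 0" using D_max by (auto simp: H_def)
    show "has_rigid TYPE('k) (J - b ` K) R"
      unfolding has_rigid_def
      by (intro exI, rule injective_normal_form[THEN iffD1, OF b P H1 H2 g_def HOL.refl \<open>rigid J R H\<close>])
  }
  {
    assume "has_rigid TYPE('k) (J - b ` K) R"
    then obtain F0 :: "'i \<Rightarrow> 'i \<Rightarrow> 'k" where F0: "rigid (J - b ` K) R F0" unfolding has_rigid_def by blast
    define D1 where "D1 = D - b ` K"
    define c where "c = inv_into (K \<union> D1) g"
    have bD: "b k \<in> D" if "k \<in> K" for k using that b by blast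
    have "inj_on g (K \<union> D1)"
      using b inKD unfolding inj_on_def g_def D1_def by (auto split: if_splits)
    then have cg: "c (g l) = l" if "l \<in> K \<union> D1" for l unfolding c_def using that by (simp add: inv_into_f_f)
    have gD: "g l \<in> D" if "l \<in> K \<union> D1" for l using that bD by (auto simp: g_def D1_def)
    define F where "F i j = (if i \<in> D then if j \<in> D then F0 (c i) (c j) else if j \<in> K \<and> i = b j then 1 else 0
        else if j \<in> D then 0 else if i \<in> K \<and> j \<in> K then 0 else F0 i j)" for i j
    have small: "rigid (J - b ` K) R (\<lambda>i j. (if i \<notin> D \<and> j \<notin> D then F i j else 0)
      + (if i \<in> K \<union> (D - b ` K) \<and> j \<in> K \<union> (D - b ` K) then F (g i) (g j) else 0))"
    proof (rule rigid_cong[OF _ _ F0])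
      show "R i k" if "i \<in> J - b ` K" "j \<in> J - b ` K" "k \<in> J - b ` K" "R i j" "R j k" for i j k
        using that tr[of i j k] by blast
      fix i j assume ij: "i \<in> J - b ` K" "j \<in> J - b ` K" "R j i"
      show "F0 i j = (if i \<notin> D \<and> j \<notin> D then F i j else 0)
        + (if i \<in> K \<union> (D - b ` K) \<and> j \<in> K \<union> (D - b ` K) then F (g i) (g j) else 0)"
      proof (cases "i \<in> K \<union> D1 \<and> j \<in> K \<union> D1")
        case True
        then have "F (g i) (g j) = F0 i j" using gD cg by (simp add: F_def)
        then show ?thesis using True by (auto simp: D1_def F_def)
      next
        case False
        have "i \<notin> D"
        proof
          assume "i \<in> D"
          then have "j \<in> K \<union> D" using P ij by blast
          then show False using False \<open>i \<in> D\<close> ij by (auto simp: D1_def)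
        qed
        moreover have "j \<notin> D" using D_max[of j i] ij calculation by blast
        ultimately show ?thesis using False by (auto simp: D1_def F_def)
      qed
    qed
    have F1: "\<forall>d\<in>D. \<forall>l\<in>J - D. F d l = (if l \<in> K \<and> d = b l then 1 else 0)"
      and F2: "\<forall>i\<in>J - D. \<forall>e\<in>D. F i e = 0" by (auto simp: F_def)
    have "rigid J R F"
      by (rule injective_normal_form[THEN iffD2, OF b P F1 F2 g_def HOL.refl small])
    then show "has_rigid TYPE('k) J R" unfolding has_rigid_def by blast
  }
qed

end

section \<open>Preorders given by levels\<close>

lemma has_rigid_cong:
  assumes "J = J'" "\<And>i j. i \<in> J' \<Longrightarrow> j \<in> J' \<Longrightarrow> R i j \<longleftrightarrow> R' i j"
  shows "has_rigid TYPE('k::field) J R \<longleftrightarrow> has_rigid TYPE('k) J' R'"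
  using assms by (intro has_rigid_relabel[where h = "\<lambda>x. x"]) (auto simp: bij_betw_def inj_on_def)

lemma has_rigid_reverse:
  "has_rigid TYPE('k::field) J (\<lambda>i j. R j i) \<longleftrightarrow> has_rigid TYPE('k) J R"
  using has_rigid_reverse_imp[where J = J and R = R] has_rigid_reverse_imp[where J = J and R = "\<lambda>i j. R j i"]
  by blast

text \<open>The projection to the coordinates in \<open>A\<close> stabilizes every \<open>F\<close>.\<close>
lemma not_has_rigid_disconnected:
  assumes fin: "finite J" and A: "A \<subseteq> J" "a \<in> A" "b \<in> J - A"
    and R_refl: "\<And>i. i \<in> J \<Longrightarrow> R i i"
    and R: "\<And>i j. i \<in> A \<Longrightarrow> j \<in> J - A \<Longrightarrow> \<not> R i j \<and> \<not> R j i"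
  shows "\<not> has_rigid TYPE('k::field) J R"
proof
  assume "has_rigid TYPE('k) J R"
  then obtain F :: "'a \<Rightarrow> 'a \<Rightarrow> 'k" where F: "rigid J R F" unfolding has_rigid_def by blast
  define X :: "'a \<Rightarrow> 'a \<Rightarrow> 'k" where "X i j = (if i = j \<and> i \<in> A then 1 else 0)" for i j
  have FX: "(\<Sum>l\<in>J. F i l * X l j) = (if j \<in> A then F i j else 0)" if "j \<in> J" for i j
  proof -
    have "(\<Sum>l\<in>J. F i l * X l j) = (\<Sum>l\<in>J. if l = j then (if j \<in> A then F i l else 0) else 0)"
      by (intro sum.cong) (auto simp: X_def)
    then show ?thesis using fin that by simp
  qed
  have XF: "(\<Sum>l\<in>J. X i l * F l j) = (if i \<in> A then F i j else 0)" if "i \<in> J" for i j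
  proof -
    have "(\<Sum>l\<in>J. X i l * F l j) = (\<Sum>l\<in>J. if i = l then (if i \<in> A then F l j else 0) else 0)"
      by (intro sum.cong) (auto simp: X_def)
    then show ?thesis using fin that by simp
  qed
  have "stabilizes J R F X"
    unfolding stabilizes_def
  proof (intro conjI ballI impI)
    show "supported J R X" using R_refl by (auto simp: supported_def X_def)
    fix i j assume ij: "i \<in> J" "j \<in> J" "R j i"
    then have "i \<in> A \<longleftrightarrow> j \<in> A" using R[of i j] R[of j i] by blast
    then show "mcomm J F X i j = 0" using ij by (simp add: mcomm_def FX XF)
  qed
  then obtain c where c: "\<And>i j. i \<in> J \<Longrightarrow> j \<in> J \<Longrightarrow> X i j = (if i = j then c else 0)"
    using F unfolding rigid_def scalar_on_def by metis
  from c[of a a] c[of b b] show False using A by (auto simp: X_def)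
qed

text \<open>If everything is allowed, \<open>F\<close> stabilizes itself. So a rigid \<open>F\<close> is scalar, and then every matrix is a
stabilizer.\<close>
lemma has_rigid_full:
  assumes fin: "finite J" and R: "\<And>i j. i \<in> J \<Longrightarrow> j \<in> J \<Longrightarrow> R i j" and "J \<noteq> {}"
  shows "has_rigid TYPE('k::field) J R \<longleftrightarrow> card J = 1"
proof
  assume "has_rigid TYPE('k) J R"
  then obtain F :: "'a \<Rightarrow> 'a \<Rightarrow> 'k" where F: "rigid J R F" unfolding has_rigid_def by blast
  have sup: "supported J R X" for X :: "'a \<Rightarrow> 'a \<Rightarrow> 'k" using R by (auto simp: supported_def)
  have "stabilizes J R F F" using sup by (simp add: stabilizes_def mcomm_def)
  then obtain c where c: "\<And>i j. i \<in> J \<Longrightarrow> j \<in> J \<Longrightarrow> F i j = (if i = j then c else 0)"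
    using F unfolding rigid_def scalar_on_def by metis
  have mc0: "mcomm J F X i j = 0" if "i \<in> J" "j \<in> J" for X i j
  proof -
    have "mcomm J F X i j = - mcomm J X F i j" by (simp add: mcomm_def)
    then show ?thesis using mcomm_scalar[OF fin that c, where F = X] by simp
  qed
  have sc: "scalar_on J X" for X :: "'a \<Rightarrow> 'a \<Rightarrow> 'k"
  proof -
    have "stabilizes J R F X" unfolding stabilizes_def using sup mc0 by blast
    then show ?thesis using F unfolding rigid_def by blast
  qed
  obtain a where a: "a \<in> J" using \<open>J \<noteq> {}\<close> by blast
  define X :: "'a \<Rightarrow> 'a \<Rightarrow> 'k" where "X i j = (if i = a \<and> j = a then 1 else 0)" for i j
  obtain e where e: "\<And>i j. i \<in> J \<Longrightarrow> j \<in> J \<Longrightarrow> X i j = (if i = j then e else 0)"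
    using sc[of X] unfolding scalar_on_def by blast
  have "b = a" if "b \<in> J" for b using e[of a a] e[of b b] a that by (auto simp: X_def split: if_splits)
  then have "J = {a}" using a by blast
  then show "card J = 1" by simp
next
  assume "card J = 1"
  then obtain a where a: "J = {a}" by (auto simp: card_1_singleton_iff)
  have "scalar_on J X" for X :: "'a \<Rightarrow> 'a \<Rightarrow> 'k" by (auto simp: scalar_on_def a)
  then show "has_rigid TYPE('k) J R" unfolding has_rigid_def rigid_def by blast
qed

text \<open>The index set has \<open>c ! k\<close> indices of level \<open>k\<close>. Levels may be empty, so that merging, splitting and
deleting levels need no case distinctions.\<close>
definition cells :: "nat list \<Rightarrow> (nat \<times> nat) set" where
  "cells c = (SIGMA k:{..<length c}. {..<c ! k})"

definition list_rigid :: "'k::field itself \<Rightarrow> nat list \<Rightarrow> (nat \<Rightarrow> nat \<Rightarrow> bool) \<Rightarrow> bool" where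
  "list_rigid K c Q \<longleftrightarrow> has_rigid K (cells c) (\<lambda>i j. Q (fst i) (fst j))"

lemma finite_cells [simp]: "finite (cells c)"
  by (simp add: cells_def)

lemma level_preserving_bijection:
  assumes fin: "finite J" "finite J'"
    and card: "\<And>k. card {j \<in> J. f j = k} = card {j \<in> J'. f' j = (k :: nat)}"
  shows "\<exists>h. bij_betw h J J' \<and> (\<forall>j\<in>J. f' (h j) = f j)"
proof -
  have "\<exists>h. bij_betw h {j \<in> J. f j = k} {j \<in> J'. f' j = k}" for k
    using card[of k] fin by (intro finite_same_card_bij) auto
  then obtain h where h: "\<And>k. bij_betw (h k) {j \<in> J. f j = k} {j \<in> J'. f' j = k}" by metis
  define g where "g j = h (f j) j" for j
  have g: "g j \<in> J' \<and> f' (g j) = f j" if "j \<in> J" for j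
  proof -
    have "j \<in> {i \<in> J. f i = f j}" using that by simp
    from bij_betwE[OF h[of "f j"], rule_format, OF this] show ?thesis by (simp add: g_def)
  qed
  have "inj_on g J"
  proof (rule inj_onI)
    fix x y assume xy: "x \<in> J" "y \<in> J" "g x = g y"
    then have "f x = f y" using g by metis
    then show "x = y" using xy h[of "f x"] unfolding g_def bij_betw_def inj_on_def by auto
  qed
  moreover have "g ` J = J'"
  proof
    show "g ` J \<subseteq> J'" using g by blast
    show "J' \<subseteq> g ` J"
    proof
      fix y assume "y \<in> J'"
      then have "y \<in> h (f' y) ` {j \<in> J. f j = f' y}" using h[of "f' y"] by (auto simp: bij_betw_def)
      then obtain x where x: "x \<in> J" "f x = f' y" "y = h (f' y) x" by blast
      then have "y = g x" by (simp add: g_def)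
      then show "y \<in> g ` J" using x(1) by blast
    qed
  qed
  ultimately show ?thesis using g unfolding bij_betw_def by blast
qed

lemma card_level_cells:
  "card {j \<in> cells c. fst j \<in> A \<and> f (fst j) = k} = (\<Sum>i | i < length c \<and> i \<in> A \<and> f i = k. c ! i)"
proof -
  have "{j \<in> cells c. fst j \<in> A \<and> f (fst j) = k} = (SIGMA i:{i. i < length c \<and> i \<in> A \<and> f i = k}. {..<c ! i})"
    by (auto simp: cells_def)
  then show ?thesis by simp
qed

lemma list_rigid_model:
  assumes fin: "finite J" and card: "\<And>k. card {j \<in> J. f j = k} = (if k < length c then c ! k else 0)"
  shows "has_rigid TYPE('k::field) J (\<lambda>i j. Q (f i) (f j)) \<longleftrightarrow> list_rigid TYPE('k) c Q"
proof -
  have "card {j \<in> cells c. fst j = k} = (if k < length c then c ! k else 0)" for k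
  proof -
    have "{i. i < length c \<and> i = k} = (if k < length c then {k} else {})" by auto
    then show ?thesis using card_level_cells[of c UNIV "\<lambda>i. i" k] by simp
  qed
  then obtain h where h: "bij_betw h J (cells c)" "\<forall>j\<in>J. fst (h j) = f j"
    using level_preserving_bijection[OF fin finite_cells, of f c fst] card by auto
  show ?thesis unfolding list_rigid_def using h(2) by (intro has_rigid_relabel[OF h(1)]) simp
qed

text \<open>Relabels levels along \<open>f\<close> after deleting the indices with level outside \<open>A\<close>; by \<open>list_rigid_model\<close> only the sizes
of the resulting levels matter. All passages between lists of levels below use it.\<close>
lemma list_rigid_cells:
  assumes "\<And>k. (\<Sum>i | i < length c \<and> i \<in> A \<and> f i = k. c ! i) = (if k < length c' then c' ! k else 0)"
  shows "has_rigid TYPE('k::field) {j \<in> cells c. fst j \<in> A} (\<lambda>i j. Q (f (fst i)) (f (fst j)))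
    \<longleftrightarrow> list_rigid TYPE('k) c' Q"
proof (rule list_rigid_model)
  fix k
  have "{j \<in> {j \<in> cells c. fst j \<in> A}. f (fst j) = k} = {j \<in> cells c. fst j \<in> A \<and> f (fst j) = k}" by auto
  then show "card {j \<in> {j \<in> cells c. fst j \<in> A}. f (fst j) = k} = (if k < length c' then c' ! k else 0)"
    using card_level_cells[of c A f k] assms[of k] by simp
qed simp

lemma list_rigid_merge_first:
  "has_rigid TYPE('k::field) (cells (x # y # zs)) (\<lambda>i j. Q (fst i - 1) (fst j - 1))
    \<longleftrightarrow> list_rigid TYPE('k) ((x + y) # zs) Q"
proof -
  let ?L = "x # y # zs"
  have "(\<Sum>i | i < length ?L \<and> i \<in> UNIV \<and> i - 1 = u. ?L ! i)
      = (if u < length ((x + y) # zs) then ((x + y) # zs) ! u else 0)" for u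
  proof (cases u)
    case 0
    have "{i. i < length ?L \<and> i \<in> UNIV \<and> i - 1 = u} = {0, 1}" using 0 by auto
    then show ?thesis using 0 by simp
  next
    case (Suc v)
    have "{i. i < length ?L \<and> i \<in> UNIV \<and> i - 1 = u} = (if Suc u < length ?L then {Suc u} else {})"
      using Suc by auto
    then show ?thesis using Suc by auto
  qed
  from list_rigid_cells[where f = "\<lambda>u. u - 1" and Q = Q, OF this] show ?thesis by simp
qed

text \<open>The shape of the seaweed algebra that arises when the last block of a composition has been removed:
the levels \<open>0, 2, 3, \<dots>\<close> form a composition, and level \<open>1\<close>, which records the size of the removed block,
lies above level \<open>0\<close> only.\<close>
definition seaweed_rel :: "nat \<Rightarrow> nat \<Rightarrow> bool" where
  "seaweed_rel u v \<longleftrightarrow> u = 0 \<or> u = v \<or> (2 \<le> u \<and> u \<le> v)"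

lemma seaweed_rel_refl: "seaweed_rel u u" and seaweed_rel_0: "seaweed_rel 0 v" "seaweed_rel u 0 \<longleftrightarrow> u = 0"
  and seaweed_rel_1: "seaweed_rel 1 v \<longleftrightarrow> v = 1" "seaweed_rel u 1 \<longleftrightarrow> u = 0 \<or> u = 1"
  by (auto simp: seaweed_rel_def)

lemma seaweed_rel_trans: "seaweed_rel u v \<Longrightarrow> seaweed_rel v w \<Longrightarrow> seaweed_rel u w"
  by (auto simp: seaweed_rel_def)

abbreviation levels_rigid :: "'k::field itself \<Rightarrow> nat list \<Rightarrow> bool" where
  "levels_rigid K c \<equiv> list_rigid K c (\<le>)"

lemma cells_iff: "(u, t) \<in> cells c \<longleftrightarrow> u < length c \<and> t < c ! u"
  by (auto simp: cells_def)

lemma cells_fst: "j \<in> cells c \<Longrightarrow> fst j < length c"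
  by (auto simp: cells_def)

lemma bij_betw_cells:
  assumes "u < length c" "v < length c" "c ! u = c ! v"
  shows "bij_betw (\<lambda>j. (v, snd j)) {j \<in> cells c. fst j = u} {j \<in> cells c. fst j = v}"
  using assms by (intro bij_betwI[where g = "\<lambda>j. (u, snd j)"]) (auto simp: cells_def)

section \<open>Euclid's algorithm on the outer blocks\<close>

text \<open>In \<open>L\<close> the first block of size \<open>k + d\<close> is split in advance into \<open>K'\<close> (level \<open>0\<close>, size \<open>k\<close>) and \<open>S\<close> (level
\<open>1\<close>, size \<open>d\<close>); subtracting \<open>1\<close> from the level merges the two again. All indices lie below the last
block, so the surjective reduction deletes every position with row in \<open>S\<close> and column outside \<open>S\<close>.\<close>
lemma remove_last_level:
  assumes d: "0 < d"
  shows "levels_rigid TYPE('k::field) ((k + d) # mid @ [d]) \<longleftrightarrow> list_rigid TYPE('k) (k # d # mid) seaweed_rel"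
proof -
  define L where "L = k # d # mid @ [d]"
  define w where "w = length mid + 2"
  have len: "length L = Suc w" by (simp add: L_def w_def)
  have Lw: "L ! w = d" "L ! 1 = d" by (auto simp: L_def w_def nth_append nth_Cons')
  let ?J = "cells L"
  define K where "K = {j \<in> ?J. fst j \<le> 1}"
  define S where "S = {j \<in> ?J. fst j = 1}"
  define D where "D = {j \<in> ?J. fst j = w}"
  let ?R = "\<lambda>i j. fst i - 1 \<le> fst j - 1"
  interpret extremal_pair ?J K D ?R
    by unfold_locales (auto simp: K_def D_def w_def dest: cells_fst simp: len)
  have D: "(w, 0) \<in> D" using d Lw len by (auto simp: D_def cells_iff)
  have "has_rigid TYPE('k) ?J ?R \<longleftrightarrow> has_rigid TYPE('k) (?J - D) (\<lambda>i j. seaweed_rel (fst i) (fst j))"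
  proof (rule surjective_reduction[where S = S and b = "\<lambda>j. (w, snd j)"])
    show "S \<subseteq> K" by (auto simp: S_def K_def)
    show "bij_betw (\<lambda>j. (w, snd j)) S D"
      unfolding S_def D_def using len Lw by (intro bij_betw_cells) (auto simp: w_def)
    show "fst k - 1 \<le> fst i - 1" if "k \<in> K" for i k :: "nat \<times> nat" using that by (auto simp: K_def)
    fix i j assume ij: "i \<in> ?J - D" "j \<in> ?J - D"
    then have "fst i < w" "fst j < w" by (auto simp: D_def len dest!: cells_fst)
    moreover from this have "\<exists>d\<in>D. fst j - 1 \<le> fst d - 1" using D by (auto intro!: bexI[of _ "(w, 0)"])
    ultimately show "seaweed_rel (fst i) (fst j) \<longleftrightarrow>
        fst i - 1 \<le> fst j - 1 \<and> \<not> (i \<in> S \<and> j \<notin> S \<and> (\<exists>d\<in>D. fst j - 1 \<le> fst d - 1))"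
      using ij by (auto simp: seaweed_rel_def S_def)
  qed
  moreover have "has_rigid TYPE('k) ?J ?R \<longleftrightarrow> levels_rigid TYPE('k) ((k + d) # mid @ [d])"
    unfolding L_def by (rule list_rigid_merge_first)
  moreover have "has_rigid TYPE('k) (?J - D) (\<lambda>i j. seaweed_rel (fst i) (fst j)) \<longleftrightarrow>
      list_rigid TYPE('k) (k # d # mid) seaweed_rel"
  proof -
    have "(\<Sum>i | i < length L \<and> i \<in> - {w} \<and> i = u. L ! i)
        = (if u < length (k # d # mid) then (k # d # mid) ! u else 0)" for u
    proof -
      have "{i. i < length L \<and> i \<in> - {w} \<and> i = u} = (if u < w then {u} else {})"
        by (auto simp: len)
      moreover have "L ! u = (k # d # mid) ! u" if "u < w"
      proof -
        have "L ! u = ((k # d # mid) @ [d]) ! u" by (simp add: L_def)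
        also have "\<dots> = (k # d # mid) ! u" unfolding nth_append using that by (simp add: w_def)
        finally show ?thesis .
      qed
      ultimately show ?thesis by (simp add: w_def)
    qed
    from list_rigid_cells[where f = "\<lambda>u. u" and Q = seaweed_rel, OF this]
    have "has_rigid TYPE('k) {j \<in> ?J. fst j \<in> - {w}} (\<lambda>i j. seaweed_rel (fst i) (fst j)) \<longleftrightarrow>
      list_rigid TYPE('k) (k # d # mid) seaweed_rel" .
    moreover have "{j \<in> ?J. fst j \<in> - {w}} = ?J - D" by (auto simp: D_def)
    ultimately show ?thesis by simp
  qed
  ultimately show ?thesis by simp
qed

text \<open>The seaweed corner is surjective. The first level is split in advance into its kernel (level \<open>0\<close>) and \<open>S\<close>
(level \<open>1\<close>). Now only the first level and \<open>D\<close> itself lie below \<open>D\<close> (level \<open>1\<close> of the seaweed),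
so only the positions with row in \<open>S\<close> and column in the kernel are deleted, and \<open>S\<close> becomes the second block of a composition.\<close>
lemma split_first_level:
  "list_rigid TYPE('k::field) ((k + e) # e # mid) seaweed_rel \<longleftrightarrow> levels_rigid TYPE('k) (k # e # mid)"
proof -
  define L where "L = k # e # e # mid"
  let ?J = "cells L"
  define K where "K = {j \<in> ?J. fst j \<le> 1}"
  define S where "S = {j \<in> ?J. fst j = 1}"
  define D where "D = {j \<in> ?J. fst j = 2}"
  let ?R = "\<lambda>i j. seaweed_rel (fst i - 1) (fst j - 1)"
  define f where "f u = (if u \<le> 2 then u else u - 1)" for u :: nat
  interpret extremal_pair ?J K D ?R
    by unfold_locales (auto simp: K_def D_def seaweed_rel_def)
  have b: "bij_betw (\<lambda>j. (2, snd j)) S D"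
    unfolding S_def D_def by (intro bij_betw_cells) (auto simp: L_def)
  have "has_rigid TYPE('k) ?J ?R \<longleftrightarrow> has_rigid TYPE('k) (?J - D) (\<lambda>i j. f (fst i) \<le> f (fst j))"
  proof (rule surjective_reduction[OF _ b])
    show "S \<subseteq> K" by (auto simp: S_def K_def)
    show "?R k i" if "k \<in> K" for i k :: "nat \<times> nat" using that by (auto simp: K_def seaweed_rel_def)
    fix i j assume ij: "i \<in> ?J - D" "j \<in> ?J - D"
    have n2: "fst i \<noteq> 2" "fst j \<noteq> 2" using ij by (auto simp: D_def)
    have num: "f u \<le> f v \<longleftrightarrow> seaweed_rel (u - 1) (v - 1) \<and> \<not> (u = 1 \<and> v \<noteq> 1 \<and> v \<le> 1)"
      if "u \<noteq> 2" "v \<noteq> 2" for u v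
      using that by (auto simp: seaweed_rel_def f_def)
    have "?R j d \<longleftrightarrow> fst j \<le> 1" if "d \<in> D" for d
      using that n2 by (auto simp: D_def seaweed_rel_def)
    moreover have "i \<in> S \<Longrightarrow> D \<noteq> {}" using b by (auto simp: bij_betw_def)
    moreover have "l \<in> S \<longleftrightarrow> fst l = 1" if "l \<in> ?J" for l using that by (simp add: S_def)
    ultimately show "f (fst i) \<le> f (fst j) \<longleftrightarrow> ?R i j \<and> \<not> (i \<in> S \<and> j \<notin> S \<and> (\<exists>d\<in>D. ?R j d))"
      using ij unfolding num[OF n2] by blast
  qed
  moreover have "has_rigid TYPE('k) ?J ?R \<longleftrightarrow> list_rigid TYPE('k) ((k + e) # e # mid) seaweed_rel"
    unfolding L_def by (rule list_rigid_merge_first)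
  moreover have "has_rigid TYPE('k) (?J - D) (\<lambda>i j. f (fst i) \<le> f (fst j)) \<longleftrightarrow>
      levels_rigid TYPE('k) (k # e # mid)"
  proof -
    have "(\<Sum>i | i < length L \<and> i \<in> - {2} \<and> f i = u. L ! i)
        = (if u < length (k # e # mid) then (k # e # mid) ! u else 0)" for u
    proof -
      have "{i. i < length L \<and> i \<in> - {2} \<and> f i = u} =
          (if u \<le> 1 then {u} else if Suc u < length L then {Suc u} else {})"
        by (auto simp: L_def f_def)
      then show ?thesis by (auto simp: L_def nth_Cons')
    qed
    from list_rigid_cells[where f = f and Q = "(\<le>)", OF this]
    have "has_rigid TYPE('k) {j \<in> ?J. fst j \<in> - {2}} (\<lambda>i j. f (fst i) \<le> f (fst j)) \<longleftrightarrow>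
      levels_rigid TYPE('k) (k # e # mid)" .
    moreover have "{j \<in> ?J. fst j \<in> - {2}} = ?J - D" by (auto simp: D_def)
    ultimately show ?thesis by simp
  qed
  ultimately show ?thesis by simp
qed

text \<open>The seaweed corner is injective. Its image, of size \<open>k\<close>, is made a level of its own (level \<open>1\<close> of \<open>L\<close>) and then
removed.\<close>
lemma subtract_first_level:
  "list_rigid TYPE('k::field) (k # (k + e) # mid) seaweed_rel \<longleftrightarrow> list_rigid TYPE('k) (k # e # mid) seaweed_rel"
proof -
  define L where "L = k # k # e # mid"
  let ?J = "cells L"
  define f where "f u = (if u \<le> 1 then u else u - 1)" for u :: nat
  define K where "K = {j \<in> ?J. fst j = 0}"
  define S where "S = {j \<in> ?J. fst j = 1}"
  define D where "D = {j \<in> ?J. fst j = 1 \<or> fst j = 2}"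
  let ?R = "\<lambda>i j. seaweed_rel (f (fst i)) (f (fst j))"
  interpret extremal_pair ?J K D ?R
  proof
    have f: "f u = 0 \<longleftrightarrow> u = 0" "f u = 1 \<longleftrightarrow> u = 1 \<or> u = 2" for u by (auto simp: f_def)
    then have K: "j \<in> K \<longleftrightarrow> j \<in> ?J \<and> f (fst j) = 0" and D: "j \<in> D \<longleftrightarrow> j \<in> ?J \<and> f (fst j) = 1" for j
      by (auto simp: K_def D_def)
    show "K \<subseteq> ?J" "D \<subseteq> ?J" "K \<inter> D = {}" by (auto simp: K D)
    show "?R i k" if "?R i j" "?R j k" for i j k :: "nat \<times> nat" using seaweed_rel_trans that by blast
    show "?R i i" for i :: "nat \<times> nat" by (rule seaweed_rel_refl)
    show "i \<in> K" if "i \<in> ?J" "j \<in> K" "?R i j" for i j using that unfolding K by (simp add: seaweed_rel_0)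
    show "?R i j" if "i \<in> K" "j \<in> K" for i j using that unfolding K by (simp add: seaweed_rel_0)
    show "?R i j" if "i \<in> K" "j \<in> D" for i j using that unfolding K by (simp add: seaweed_rel_0)
    show "j \<in> D" if "i \<in> D" "j \<in> ?J" "?R i j" for i j using that unfolding D by (simp add: seaweed_rel_1[simplified])
    show "?R i j" if "i \<in> D" "j \<in> D" for i j using that unfolding D by (simp add: seaweed_rel_refl)
  qed simp
  have b: "bij_betw (\<lambda>j. (1, snd j)) K S"
    unfolding K_def S_def by (intro bij_betw_cells) (auto simp: L_def)
  then have bS: "(\<lambda>j. (1, snd j)) ` K = S" and binj: "inj_on (\<lambda>j. (1 :: nat, snd j)) K"
    by (auto simp: bij_betw_def)
  have "has_rigid TYPE('k) ?J ?R \<longleftrightarrow> has_rigid TYPE('k) (?J - (\<lambda>j. (1, snd j)) ` K) ?R"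
  proof (rule injective_reduction[OF binj])
    show "(\<lambda>j. (1, snd j)) ` K \<subseteq> D" unfolding bS by (auto simp: S_def D_def)
    show "i \<in> K \<union> D" if "i \<in> ?J" "d \<in> D" "?R i d" for i d
      using that by (auto simp: K_def D_def seaweed_rel_def f_def split: if_splits)
  qed
  moreover have "has_rigid TYPE('k) ?J ?R \<longleftrightarrow> list_rigid TYPE('k) (k # (k + e) # mid) seaweed_rel"
  proof -
    have "(\<Sum>i | i < length L \<and> i \<in> UNIV \<and> f i = u. L ! i)
        = (if u < length (k # (k + e) # mid) then (k # (k + e) # mid) ! u else 0)" for u
    proof -
      have "{i. i < length L \<and> i \<in> UNIV \<and> f i = u} =
        (if u = 0 then {0} else if u = 1 then {1, 2} else if Suc u < length L then {Suc u} else {})"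
        by (auto simp: L_def f_def)
      then show ?thesis by (auto simp: L_def nth_Cons')
    qed
    from list_rigid_cells[where f = f and Q = seaweed_rel, OF this] show ?thesis by simp
  qed
  moreover have "has_rigid TYPE('k) (?J - S) ?R \<longleftrightarrow> list_rigid TYPE('k) (k # e # mid) seaweed_rel"
  proof -
    have "(\<Sum>i | i < length L \<and> i \<in> - {1} \<and> f i = u. L ! i)
        = (if u < length (k # e # mid) then (k # e # mid) ! u else 0)" for u
    proof -
      have "{i. i < length L \<and> i \<in> - {1} \<and> f i = u} =
          (if u = 0 then {0} else if Suc u < length L then {Suc u} else {})"
        by (auto simp: L_def f_def)
      then show ?thesis by (auto simp: L_def nth_Cons')
    qed
    from list_rigid_cells[where f = f and Q = seaweed_rel, OF this]
    have "has_rigid TYPE('k) {j \<in> ?J. fst j \<in> - {1}} ?R \<longleftrightarrow> list_rigid TYPE('k) (k # e # mid) seaweed_rel" .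
    moreover have "{j \<in> ?J. fst j \<in> - {1}} = ?J - S" by (auto simp: S_def)
    ultimately show ?thesis by simp
  qed
  ultimately show ?thesis using bS by simp
qed

lemma subtract_multiple_of_first_level:
  "list_rigid TYPE('k::field) (k # (m * k + e) # mid) seaweed_rel \<longleftrightarrow> list_rigid TYPE('k) (k # e # mid) seaweed_rel"
proof (induction m)
  case (Suc m)
  have "Suc m * k + e = k + (m * k + e)" by simp
  then show ?case
    using subtract_first_level[where 'k = 'k and k = k and e = "m * k + e" and mid = mid] Suc by (simp only:)
qed simp

lemma drop_empty_level:
  "levels_rigid TYPE('k::field) (k # 0 # mid) \<longleftrightarrow> levels_rigid TYPE('k) (k # mid)"
proof -
  define L where "L = k # 0 # mid"
  have "has_rigid TYPE('k) (cells L) (\<lambda>i j. fst i - 1 \<le> fst j - 1) \<longleftrightarrow> levels_rigid TYPE('k) (k # mid)"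
    unfolding L_def using list_rigid_merge_first[where x = k and y = 0 and Q = "(\<le>)"] by simp
  moreover have "has_rigid TYPE('k) (cells L) (\<lambda>i j. fst i - 1 \<le> fst j - 1) \<longleftrightarrow> levels_rigid TYPE('k) L"
    unfolding list_rigid_def
  proof (rule has_rigid_cong)
    fix i j assume "i \<in> cells L" "j \<in> cells L"
    then have "fst i \<noteq> 1" "fst j \<noteq> 1" by (auto simp: cells_def L_def)
    then show "fst i - 1 \<le> fst j - 1 \<longleftrightarrow> fst i \<le> fst j" by auto
  qed simp
  ultimately show ?thesis by (simp add: L_def)
qed

lemma levels_rigid_rev: "levels_rigid TYPE('k::field) (rev c) \<longleftrightarrow> levels_rigid TYPE('k) c"
proof -
  define f where "f u = length c - 1 - u" for u
  have "(\<Sum>i | i < length c \<and> i \<in> UNIV \<and> f i = u. c ! i)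
      = (if u < length (rev c) then rev c ! u else 0)" for u
  proof -
    have "{i. i < length c \<and> i \<in> UNIV \<and> f i = u} = (if u < length c then {length c - 1 - u} else {})"
      by (auto simp: f_def)
    then show ?thesis by (simp add: rev_nth)
  qed
  from list_rigid_cells[where f = f and Q = "(\<le>)", OF this]
  have "has_rigid TYPE('k) (cells c) (\<lambda>i j. f (fst i) \<le> f (fst j)) \<longleftrightarrow> levels_rigid TYPE('k) (rev c)"
    by simp
  moreover have "has_rigid TYPE('k) (cells c) (\<lambda>i j. f (fst i) \<le> f (fst j))
     \<longleftrightarrow> has_rigid TYPE('k) (cells c) (\<lambda>i j. fst j \<le> fst i)"
    by (rule has_rigid_cong) (auto simp: f_def dest!: cells_fst)
  moreover have "has_rigid TYPE('k) (cells c) (\<lambda>i j. fst j \<le> fst i) \<longleftrightarrow> levels_rigid TYPE('k) c"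
    unfolding list_rigid_def by (rule has_rigid_reverse)
  ultimately show ?thesis by simp
qed

lemma levels_rigid_single: "0 < n \<Longrightarrow> levels_rigid TYPE('k::field) [n] \<longleftrightarrow> n = 1"
proof -
  assume n: "0 < n"
  have cells: "cells [n] = {0} \<times> {..<n}" by (auto simp: cells_def)
  have "has_rigid TYPE('k) (cells [n]) (\<lambda>i j. fst i \<le> fst j) \<longleftrightarrow> card (cells [n]) = 1"
    by (rule has_rigid_full) (use n in \<open>auto simp: cells\<close>)
  then show ?thesis by (simp add: list_rigid_def cells)
qed

text \<open>With no kernel left, the level \<open>1\<close> of the seaweed is related to no other level. So either the middle is
nonempty and the problem is disconnected, or only a full matrix algebra is left.\<close>
lemma levels_rigid_equal_ends:
  assumes d: "0 < d" and mid: "\<forall>x\<in>set mid. 0 < x"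
  shows "levels_rigid TYPE('k::field) (d # mid @ [d]) \<longleftrightarrow> d = 1 \<and> mid = []"
proof -
  have "levels_rigid TYPE('k) (d # mid @ [d]) \<longleftrightarrow> list_rigid TYPE('k) (0 # d # mid) seaweed_rel"
    using remove_last_level[where 'k = 'k and k = 0, OF d] by simp
  also have "\<dots> \<longleftrightarrow> d = 1 \<and> mid = []"
  proof (cases mid)
    case Nil
    have 0: "fst j = 1" if "j \<in> cells [0, d]" for j using that by (auto simp: cells_def less_Suc_eq)
    have "cells [0, d] = {1} \<times> {..<d}" by (auto simp: cells_def less_Suc_eq)
    then have "card (cells [0, d]) = d" and "cells [0, d] \<noteq> {}" using d by auto
    moreover have "has_rigid TYPE('k) (cells [0, d]) (\<lambda>i j. seaweed_rel (fst i) (fst j)) \<longleftrightarrow> card (cells [0, d]) = 1"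
      using 0 calculation by (intro has_rigid_full) (auto simp: seaweed_rel_def)
    ultimately show ?thesis using Nil by (simp add: list_rigid_def)
  next
    case (Cons m ms)
    let ?L = "0 # d # mid"
    have "\<not> has_rigid TYPE('k) (cells ?L) (\<lambda>i j. seaweed_rel (fst i) (fst j))"
    proof (rule not_has_rigid_disconnected[where A = "{j \<in> cells ?L. fst j = 1}" and a = "(1, 0)" and b = "(2, 0)"])
      show "(1, 0) \<in> {j \<in> cells ?L. fst j = 1}" using d by (simp add: cells_iff)
      show "(2, 0) \<in> cells ?L - {j \<in> cells ?L. fst j = 1}" using mid Cons by (simp add: cells_iff)
      show "seaweed_rel (fst i) (fst i)" for i :: "nat \<times> nat" by (simp add: seaweed_rel_def)
      fix i j assume i: "i \<in> {j \<in> cells ?L. fst j = 1}" and j: "j \<in> cells ?L - {j \<in> cells ?L. fst j = 1}"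
      have "fst j \<noteq> 0" using j by (cases "fst j") (auto simp: cells_def)
      then show "\<not> seaweed_rel (fst i) (fst j) \<and> \<not> seaweed_rel (fst j) (fst i)" using i j by (auto simp: seaweed_rel_def)
    qed auto
    then show ?thesis using Cons by (simp add: list_rigid_def)
  qed
  finally show ?thesis .
qed

text \<open>Here \<open>k = a\<close> divides the last block, so the remainder is \<open>0\<close>.\<close>
lemma levels_rigid_sigma:
  assumes "0 < a"
  shows "levels_rigid TYPE('k::field) ((m + 2) * a # mid @ [(m + 1) * a]) \<longleftrightarrow> levels_rigid TYPE('k) (a # mid)"
proof -
  have "levels_rigid TYPE('k) ((a + (m + 1) * a) # mid @ [(m + 1) * a])
      \<longleftrightarrow> list_rigid TYPE('k) (a # (m + 1) * a # mid) seaweed_rel"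
    by (rule remove_last_level) (use assms in simp)
  also have "\<dots> \<longleftrightarrow> list_rigid TYPE('k) (a # 0 # mid) seaweed_rel"
    using subtract_multiple_of_first_level[where 'k = 'k and k = a and m = "m + 1" and e = 0 and mid = mid] by simp
  also have "\<dots> \<longleftrightarrow> levels_rigid TYPE('k) (a # mid)"
    using split_first_level[where 'k = 'k and k = a and e = 0 and mid = mid] drop_empty_level[where 'k = 'k and k = a and mid = mid] by simp
  finally show ?thesis by (simp add: algebra_simps)
qed

text \<open>Here \<open>k = a + b\<close> and the last block is \<open>m k + b\<close>, so the remainder is \<open>b\<close>.\<close>
lemma levels_rigid_tau:
  assumes "0 < a" "0 < b"
  shows "levels_rigid TYPE('k::field) (((m + 1) * a + (m + 2) * b) # mid @ [m * a + (m + 1) * b])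
     \<longleftrightarrow> levels_rigid TYPE('k) (a # b # mid)"
proof -
  have eq: "m * a + (m + 1) * b = m * (a + b) + b" "(m + 1) * a + (m + 2) * b = (a + b) + (m * (a + b) + b)"
    by (simp_all add: algebra_simps)
  have "levels_rigid TYPE('k) (((a + b) + (m * (a + b) + b)) # mid @ [m * (a + b) + b])
      \<longleftrightarrow> list_rigid TYPE('k) ((a + b) # (m * (a + b) + b) # mid) seaweed_rel"
    by (rule remove_last_level) (use assms in simp)
  also have "\<dots> \<longleftrightarrow> list_rigid TYPE('k) ((a + b) # b # mid) seaweed_rel" by (rule subtract_multiple_of_first_level)
  also have "\<dots> \<longleftrightarrow> levels_rigid TYPE('k) (a # b # mid)" by (rule split_first_level)
  finally show ?thesis unfolding eq .
qed

section \<open>Kernels of linear forms on a parabolic subalgebra\<close>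

text \<open>Dimension is defined by a least cardinality of generating sets, so a finite one must be shown to exist
before a vanishing dimension says anything. A maximal independent subset of the subspace generates it.\<close>
lemma (in vectorspace) subspace_fin_dim:
  assumes fd: "fin_dim" and W: "subspace K W V"
  shows "vectorspace.fin_dim K (vs W)"
proof -
  interpret W: vectorspace K "vs W" by (rule subspace_is_vs[OF W])
  have sub: "W \<subseteq> carrier V" using W by (simp add: subspace_def submodule_def)
  have small: "finite A \<and> card A \<le> dim" if "A \<subseteq> carrier (vs W) \<and> W.lin_indpt A" for A
  proof -
    have AW: "A \<subseteq> W" using that by simp
    have "W.lin_dep A = lin_dep A"
      using span_li_not_depend(2)[OF AW is_module[OF W]] .
    then have "lin_indpt A" using that by blast
    then show ?thesis using li_le_dim[OF fd] AW sub by blast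
  qed
  have "W.lin_indpt {}" unfolding W.lin_dep_def by auto
  then obtain A where "finite A" "maximal A (\<lambda>A. A \<subseteq> carrier (vs W) \<and> W.lin_indpt A)"
    using maximal_exists[where P = "\<lambda>A. A \<subseteq> carrier (vs W) \<and> W.lin_indpt A" and B = "{}", OF small] by auto
  then show ?thesis unfolding W.fin_dim_def using W.max_li_is_basis unfolding W.basis_def by blast
qed

lemma (in vectorspace) dim_eq_0_iff:
  assumes fd: "fin_dim"
  shows "dim = 0 \<longleftrightarrow> carrier V = {\<zero>\<^bsub>V\<^esub>}"
proof -
  have sp: "span {} = {\<zero>\<^bsub>V\<^esub>}" unfolding span_def lincomb_def by auto
  let ?P = "\<lambda>n. \<exists>A. finite A \<and> card A = n \<and> A \<subseteq> carrier V \<and> gen_set A"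
  have "\<exists>n. ?P n" using fd unfolding fin_dim_def by blast
  then have "?P dim" unfolding dim_def by (rule LeastI_ex)
  then have "dim = 0 \<Longrightarrow> carrier V = {\<zero>\<^bsub>V\<^esub>}" using sp by auto
  moreover have "dim = 0" if "carrier V = {\<zero>\<^bsub>V\<^esub>}"
    unfolding dim_def by (rule Least_eq_0) (use sp that in \<open>auto intro: exI[of _ "{}"]\<close>)
  ultimately show ?thesis by blast
qed

text \<open>The \<open>n \<times> n\<close> matrices are a linear image of the vectors of length \<open>n * n\<close>.\<close>
lemma mat_fin_dim: "vectorspace.fin_dim class_ring (module_mat TYPE('k::field) n n)"
proof -
  define T :: "'k vec \<Rightarrow> 'k mat" where "T v = mat n n (\<lambda>(i, j). v $ (i * n + j))" for v
  have idx: "i * n + j < n * n" if "i < n" "j < n" for i j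
  proof -
    have "i * n + j < (i + 1) * n" using that by simp
    also have "\<dots> \<le> n * n" using that by (intro mult_le_mono1) simp
    finally show ?thesis .
  qed
  interpret V: vec_space "TYPE('k)" "n * n" .
  interpret M: vectorspace class_ring "module_mat TYPE('k) n n" by (rule matrix_vs)
  have "linear_map class_ring (module_vec TYPE('k) (n * n)) (module_mat TYPE('k) n n) T"
    unfolding linear_map_def mod_hom_def mod_hom_axioms_def module_hom_def
    using V.vectorspace_axioms V.module_axioms M.vectorspace_axioms M.module_axioms idx
    by (auto simp: module_vec_simps module_mat_simps T_def)
  moreover have "T ` carrier (module_vec TYPE('k) (n * n)) = carrier (module_mat TYPE('k) n n)"
  proof
    show "T ` carrier (module_vec TYPE('k) (n * n)) \<subseteq> carrier (module_mat TYPE('k) n n)"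
      by (auto simp: module_mat_simps T_def)
    show "carrier (module_mat TYPE('k) n n) \<subseteq> T ` carrier (module_vec TYPE('k) (n * n))"
    proof
      fix A :: "'k mat" assume "A \<in> carrier (module_mat TYPE('k) n n)"
      then have A: "A \<in> carrier_mat n n" by (simp add: module_mat_simps)
      define v where "v = vec (n * n) (\<lambda>k. A $$ (k div n, k mod n))"
      have "T v = A" using A idx by (intro eq_matI) (auto simp: T_def v_def)
      then show "A \<in> T ` carrier (module_vec TYPE('k) (n * n))"
        by (intro image_eqI[of _ _ v]) (auto simp: module_vec_simps v_def)
    qed
  qed
  ultimately show ?thesis using linear_map.surj_fin_dim V.fin_dim by blast
qed

lemma mat_subspace_dim_eq_0_iff:
  fixes W :: "'k::field mat set"
  assumes W: "W \<subseteq> carrier_mat n n" "0\<^sub>m n n \<in> W"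
    and add: "\<And>X Y. X \<in> W \<Longrightarrow> Y \<in> W \<Longrightarrow> X + Y \<in> W"
    and smult: "\<And>c X. X \<in> W \<Longrightarrow> c \<cdot>\<^sub>m X \<in> W"
  shows "mat_subspace_dim n W = 0 \<longleftrightarrow> W = {0\<^sub>m n n}"
proof -
  interpret M: vectorspace class_ring "module_mat TYPE('k) n n" by (rule matrix_vs)
  have "subspace class_ring W (module_mat TYPE('k) n n)"
    unfolding subspace_def submodule_def
    using W add smult M.vectorspace_axioms M.module_axioms by (auto simp: module_mat_simps)
  from M.subspace_is_vs[OF this] M.subspace_fin_dim[OF mat_fin_dim this]
  show ?thesis unfolding mat_subspace_dim_def
    using vectorspace.dim_eq_0_iff by (fastforce simp: module_mat_simps)
qed

lemma block_of_level:
  assumes i: "i < csize a"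
  shows "block_of a i = k \<longleftrightarrow> k < length (parts a) \<and>
    sum_list (take k (parts a)) \<le> i \<and> i < sum_list (take (Suc k) (parts a))"
proof -
  let ?S = "\<lambda>k. sum_list (take k (parts a))"
  have mono: "?S k \<le> ?S l" if "k \<le> l" for k l
  proof -
    have "take l (parts a) = take k (parts a) @ take (l - k) (drop k (parts a))"
      using take_add[of k "l - k" "parts a"] that by simp
    then show ?thesis by simp
  qed
  have len: "i < ?S (length (parts a))" using i by (simp add: csize_def)
  then have ne: "0 < length (parts a)" by (cases "parts a") auto
  have ex: "i < ?S (Suc (length (parts a) - 1))" using len ne by simp
  have b: "i < ?S (Suc (block_of a i))" unfolding block_of_def by (rule LeastI[where P = "\<lambda>k. i < ?S (Suc k)", OF ex])
  have ble: "block_of a i \<le> l" if "i < ?S (Suc l)" for l unfolding block_of_def using that by (rule Least_le)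
  have blt: "block_of a i < length (parts a)" using ble[OF ex] ne by linarith
  have bge: "?S (block_of a i) \<le> i"
  proof (cases "block_of a i")
    case (Suc l)
    have "\<not> i < ?S (Suc l)" using ble[of l] Suc by fastforce
    then show ?thesis using Suc by simp
  qed simp
  show ?thesis
  proof
    assume "block_of a i = k"
    then show "k < length (parts a) \<and> ?S k \<le> i \<and> i < ?S (Suc k)" using b blt bge by blast
  next
    assume k: "k < length (parts a) \<and> ?S k \<le> i \<and> i < ?S (Suc k)"
    have "\<not> block_of a i < k" using mono[of "Suc (block_of a i)" k] b k by (meson Suc_leI leD le_trans)
    then show "block_of a i = k" using ble[of k] k by linarith
  qed
qed

lemma card_block_of:
  "card {i \<in> {..<csize a}. block_of a i = k} = (if k < length (parts a) then parts a ! k else 0)"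
proof (cases "k < length (parts a)")
  case True
  let ?S = "\<lambda>k. sum_list (take k (parts a))"
  have S: "?S (Suc k) = ?S k + parts a ! k" using True by (simp add: take_Suc_conv_app_nth)
  have total: "?S (Suc k) + sum_list (drop (Suc k) (parts a)) = csize a"
    unfolding csize_def by (metis append_take_drop_id sum_list_append)
  have "{i \<in> {..<csize a}. block_of a i = k} = {?S k..<?S (Suc k)}"
  proof (intro equalityI subsetI)
    fix i assume "i \<in> {i \<in> {..<csize a}. block_of a i = k}"
    then show "i \<in> {?S k..<?S (Suc k)}" using block_of_level[of i a k] by simp
  next
    fix i assume i: "i \<in> {?S k..<?S (Suc k)}"
    then have "i < csize a" using total by simp
    then show "i \<in> {i \<in> {..<csize a}. block_of a i = k}" using block_of_level[of i a k] i True by simp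
  qed
  then show ?thesis using True S by simp
next
  case False
  then have "{i \<in> {..<csize a}. block_of a i = k} = {}" using block_of_level[of _ a k] by auto
  then show ?thesis using False by (simp only: card.empty if_False)
qed

definition mtrace :: "'i set \<Rightarrow> ('i \<Rightarrow> 'i \<Rightarrow> 'k::field) \<Rightarrow> 'k" where
  "mtrace J A = (\<Sum>i\<in>J. A i i)"

lemma mtrace_commute: "mtrace J (mmul J A B) = mtrace J (mmul J B A)"
  unfolding mtrace_def mmul_def by (subst sum.swap) (simp add: mult.commute)

lemma mcomm_eq_mmul: "mcomm J F X i j = mmul J F X i j - mmul J X F i j"
  by (simp add: mcomm_def mmul_def)

lemma mtrace_mcomm: "mtrace J (mcomm J F X) = 0"
proof -
  have "mtrace J (mcomm J F X) = mtrace J (mmul J F X) - mtrace J (mmul J X F)"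
    by (simp add: mtrace_def mcomm_eq_mmul sum_subtractf)
  then show ?thesis using mtrace_commute[of J F X] by simp
qed

text \<open>The invariance of the trace form, \<open>tr (F [X, Y]) = tr ([F, X] Y)\<close>.\<close>
lemma mtrace_invariance:
  "mtrace J (mmul J F (mcomm J X Y)) = mtrace J (mmul J (mcomm J F X) Y)"
proof -
  have "mtrace J (mmul J F (mcomm J X Y)) = mtrace J (mmul J F (mmul J X Y)) - mtrace J (mmul J F (mmul J Y X))"
    unfolding mtrace_def mmul_def[of J F] mcomm_eq_mmul by (simp add: right_diff_distrib sum_subtractf)
  also have "mtrace J (mmul J F (mmul J Y X)) = mtrace J (mmul J X (mmul J F Y))"
    using mtrace_commute[of J "mmul J F Y" X] by (simp add: mmul_assoc)
  also have "mtrace J (mmul J F (mmul J X Y)) - mtrace J (mmul J X (mmul J F Y))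
     = mtrace J (mmul J (mmul J F X) Y) - mtrace J (mmul J (mmul J X F) Y)" by (simp add: mmul_assoc)
  also have "\<dots> = mtrace J (mmul J (mcomm J F X) Y)"
    unfolding mtrace_def mmul_def[of J _ Y] mcomm_eq_mmul by (simp add: left_diff_distrib sum_subtractf)
  finally show ?thesis .
qed

lemma mat_mult_entry:
  assumes "X \<in> carrier_mat n n" "Y \<in> carrier_mat n n" "i < n" "j < n"
  shows "(X * Y) $$ (i, j) = mmul {..<n} (\<lambda>i j. X $$ (i, j)) (\<lambda>i j. Y $$ (i, j)) i j"
  using assms by (simp add: mmul_def scalar_prod_def lessThan_atLeast0)

lemma lie_bracket_entry:
  assumes "X \<in> carrier_mat n n" "Y \<in> carrier_mat n n" "i < n" "j < n"
  shows "lie_bracket X Y $$ (i, j) = mcomm {..<n} (\<lambda>i j. X $$ (i, j)) (\<lambda>i j. Y $$ (i, j)) i j"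
  using assms mat_mult_entry[OF assms] mat_mult_entry[OF assms(2,1,3,4)]
  by (simp add: lie_bracket_def mcomm_eq_mmul)

lemma lie_bracket_carrier:
  "X \<in> carrier_mat n n \<Longrightarrow> Y \<in> carrier_mat n n \<Longrightarrow> lie_bracket X Y \<in> carrier_mat n n"
  unfolding lie_bracket_def by (metis minus_carrier_mat mult_carrier_mat)

lemma parabolic_iff:
  "X \<in> parabolic a \<longleftrightarrow> X \<in> carrier_mat (csize a) (csize a)
     \<and> mtrace {..<csize a} (\<lambda>i j. X $$ (i, j)) = 0
     \<and> supported {..<csize a} (\<lambda>i j. block_of a i \<le> block_of a j) (\<lambda>i j. X $$ (i, j))"
  by (auto simp: parabolic_def mtrace_def supported_def not_le)

lemma parabolic_closed:
  fixes X Y :: "'k::field mat"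
  assumes X: "X \<in> parabolic a" and Y: "Y \<in> parabolic a"
  shows "X + Y \<in> parabolic a" and "c \<cdot>\<^sub>m X \<in> parabolic a"
    and "lie_bracket X Y \<in> parabolic a"
proof -
  let ?J = "{..<csize a}" and ?R = "\<lambda>i j. block_of a i \<le> block_of a j"
  let ?X = "\<lambda>i j. X $$ (i, j)" and ?Y = "\<lambda>i j. Y $$ (i, j)"
  have X': "X \<in> carrier_mat (csize a) (csize a)" "mtrace ?J ?X = 0" "supported ?J ?R ?X"
    and Y': "Y \<in> carrier_mat (csize a) (csize a)" "mtrace ?J ?Y = 0" "supported ?J ?R ?Y"
    using X Y by (auto simp: parabolic_iff)
  show "X + Y \<in> parabolic a"
    using X' Y' by (auto simp: parabolic_iff mtrace_def supported_def sum.distrib)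
  show "c \<cdot>\<^sub>m X \<in> parabolic a"
    using X' by (auto simp: parabolic_iff mtrace_def supported_def sum_distrib_left[symmetric])
  have sup: "supported ?J ?R (mmul ?J A B)" if "supported ?J ?R A" "supported ?J ?R B" for A B :: "nat \<Rightarrow> nat \<Rightarrow> 'k"
    by (rule mmul_supported[OF _ that]) simp
  have entry: "lie_bracket X Y $$ (i, j) = mcomm ?J ?X ?Y i j" if "i < csize a" "j < csize a" for i j
    using lie_bracket_entry[OF X'(1) Y'(1) that] .
  have "supported ?J ?R (mcomm ?J ?X ?Y)"
    using sup[OF X'(3) Y'(3)] sup[OF Y'(3) X'(3)] by (simp add: supported_def mcomm_eq_mmul)
  moreover have "mtrace ?J (\<lambda>i j. lie_bracket X Y $$ (i, j)) = mtrace ?J (mcomm ?J ?X ?Y)"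
    unfolding mtrace_def using entry by (intro sum.cong) auto
  ultimately show "lie_bracket X Y \<in> parabolic a"
    using entry lie_bracket_carrier[OF X'(1) Y'(1)] mtrace_mcomm[of ?J ?X ?Y]
    by (simp add: parabolic_iff supported_def)
qed

lemma zero_parabolic: "0\<^sub>m (csize a) (csize a) \<in> (parabolic a :: 'k::field mat set)"
  by (auto simp: parabolic_iff mtrace_def supported_def)

lemma lie_bracket_linear:
  fixes X Y Z :: "'k::field mat"
  assumes "X \<in> carrier_mat n n" "Y \<in> carrier_mat n n" "Z \<in> carrier_mat n n"
  shows "lie_bracket (X + Y) Z = lie_bracket X Z + lie_bracket Y Z"
    and "lie_bracket (c \<cdot>\<^sub>m X) Z = c \<cdot>\<^sub>m lie_bracket X Z"
proof -
  have bc: "lie_bracket X Z \<in> carrier_mat n n" "lie_bracket Y Z \<in> carrier_mat n n"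
    using assms by (auto intro: lie_bracket_carrier)
  show "lie_bracket (X + Y) Z = lie_bracket X Z + lie_bracket Y Z"
  proof (rule eq_matI)
    fix i j assume "i < dim_row (lie_bracket X Z + lie_bracket Y Z)"
      "j < dim_col (lie_bracket X Z + lie_bracket Y Z)"
    then have ij: "i < n" "j < n" using bc by auto
    show "lie_bracket (X + Y) Z $$ (i, j) = (lie_bracket X Z + lie_bracket Y Z) $$ (i, j)"
      using assms bc ij lie_bracket_entry[of "X + Y" n Z i j] lie_bracket_entry[of X n Z i j]
        lie_bracket_entry[of Y n Z i j]
      by (simp add: mcomm_def distrib_left distrib_right sum.distrib)
  qed (use assms bc in \<open>auto simp: lie_bracket_def\<close>)
  show "lie_bracket (c \<cdot>\<^sub>m X) Z = c \<cdot>\<^sub>m lie_bracket X Z"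
  proof (rule eq_matI)
    fix i j assume "i < dim_row (c \<cdot>\<^sub>m lie_bracket X Z)" "j < dim_col (c \<cdot>\<^sub>m lie_bracket X Z)"
    then have ij: "i < n" "j < n" using bc by auto
    show "lie_bracket (c \<cdot>\<^sub>m X) Z $$ (i, j) = (c \<cdot>\<^sub>m lie_bracket X Z) $$ (i, j)"
      using assms bc ij lie_bracket_entry[of "c \<cdot>\<^sub>m X" n Z i j] lie_bracket_entry[of X n Z i j]
      by (simp add: mcomm_def right_diff_distrib sum_distrib_left mult.assoc mult.left_commute)
  qed (use assms bc in \<open>auto simp: lie_bracket_def\<close>)
qed

lemma zero_in_form_kernel:
  fixes f :: "'k::field mat \<Rightarrow> 'k"
  assumes f: "linear_form_on (parabolic a) f"
  shows "0\<^sub>m (csize a) (csize a) \<in> form_kernel (parabolic a) f"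
proof -
  have "f (0 \<cdot>\<^sub>m 0\<^sub>m (csize a) (csize a)) = 0 * f (0\<^sub>m (csize a) (csize a))"
    using f zero_parabolic unfolding linear_form_on_def by blast
  moreover have "(0 :: 'k) \<cdot>\<^sub>m 0\<^sub>m (csize a) (csize a) = 0\<^sub>m (csize a) (csize a)" by (intro eq_matI) auto
  ultimately have z: "f (0\<^sub>m (csize a) (csize a)) = 0" by simp
  have "lie_bracket (0\<^sub>m (csize a) (csize a)) Y = 0\<^sub>m (csize a) (csize a)" if "Y \<in> parabolic a" for Y :: "'k mat"
    using that by (auto simp: lie_bracket_def parabolic_iff)
  then show ?thesis using z zero_parabolic by (auto simp: form_kernel_def)
qed

lemma form_kernel_dim_eq_0_iff:
  fixes f :: "'k::field mat \<Rightarrow> 'k"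
  assumes f: "linear_form_on (parabolic a) f"
  shows "mat_subspace_dim (csize a) (form_kernel (parabolic a) f) = 0 \<longleftrightarrow>
    form_kernel (parabolic a) f = {0\<^sub>m (csize a) (csize a)}"
proof (rule mat_subspace_dim_eq_0_iff)
  have car: "X \<in> carrier_mat (csize a) (csize a)" if "X \<in> parabolic a" for X :: "'k mat"
    using that by (simp add: parabolic_iff)
  show "form_kernel (parabolic a) f \<subseteq> carrier_mat (csize a) (csize a)"
    using car by (auto simp: form_kernel_def)
  show "c \<cdot>\<^sub>m X \<in> form_kernel (parabolic a) f" if X: "X \<in> form_kernel (parabolic a) f" for c X
  proof -
    have Xp: "X \<in> parabolic a" using X by (simp add: form_kernel_def)
    have "f (lie_bracket (c \<cdot>\<^sub>m X) Y) = 0" if Y: "Y \<in> parabolic a" for Y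
    proof -
      have "f (lie_bracket (c \<cdot>\<^sub>m X) Y) = f (c \<cdot>\<^sub>m lie_bracket X Y)"
        using lie_bracket_linear(2)[OF car[OF Xp] car[OF Xp] car[OF Y]] by simp
      also have "\<dots> = c * f (lie_bracket X Y)"
        using f parabolic_closed(3)[OF Xp Y] unfolding linear_form_on_def by blast
      finally show ?thesis using X Y by (simp add: form_kernel_def)
    qed
    then show ?thesis using parabolic_closed(2)[OF Xp Xp] by (simp add: form_kernel_def)
  qed
  show "X + Z \<in> form_kernel (parabolic a) f"
    if X: "X \<in> form_kernel (parabolic a) f" and Z: "Z \<in> form_kernel (parabolic a) f" for X Z
  proof -
    have Xp: "X \<in> parabolic a" "Z \<in> parabolic a" using X Z by (auto simp: form_kernel_def)
    have "f (lie_bracket (X + Z) Y) = 0" if Y: "Y \<in> parabolic a" for Y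
    proof -
      have "f (lie_bracket (X + Z) Y) = f (lie_bracket X Y + lie_bracket Z Y)"
        using lie_bracket_linear(1)[OF car[OF Xp(1)] car[OF Xp(2)] car[OF Y]] by simp
      also have "\<dots> = f (lie_bracket X Y) + f (lie_bracket Z Y)"
        using f parabolic_closed(3)[OF Xp(1) Y] parabolic_closed(3)[OF Xp(2) Y]
        unfolding linear_form_on_def by blast
      finally show ?thesis using X Z Y by (simp add: form_kernel_def)
    qed
    then show ?thesis using parabolic_closed(1)[OF Xp] by (simp add: form_kernel_def)
  qed
  show "0\<^sub>m (csize a) (csize a) \<in> form_kernel (parabolic a) f" by (rule zero_in_form_kernel[OF f])
qed

lemma lie_index_eq_0_iff:
  "lie_index (csize a) (parabolic a :: 'k::field mat set) = 0 \<longleftrightarrow>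
    (\<exists>f. linear_form_on (parabolic a :: 'k mat set) f \<and>
      form_kernel (parabolic a) f = {0\<^sub>m (csize a) (csize a)})"
proof -
  let ?g = "parabolic a :: 'k mat set"
  let ?P = "\<lambda>d. \<exists>f. linear_form_on ?g f \<and> d = mat_subspace_dim (csize a) (form_kernel ?g f)"
  have "linear_form_on ?g (\<lambda>_. 0)" by (simp add: linear_form_on_def)
  then have "\<exists>d. ?P d" by blast
  then have "?P (lie_index (csize a) ?g)" unfolding lie_index_def by (rule LeastI_ex)
  moreover have "?P 0 \<Longrightarrow> lie_index (csize a) ?g = 0" unfolding lie_index_def by (rule Least_eq_0)
  ultimately have "lie_index (csize a) ?g = 0 \<longleftrightarrow> ?P 0" by metis
  then show ?thesis using form_kernel_dim_eq_0_iff by metis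
qed

lemma linear_form_on_sum:
  fixes f :: "'k::field mat \<Rightarrow> 'k" and B :: "'s \<Rightarrow> nat \<Rightarrow> nat \<Rightarrow> 'k"
  assumes f: "linear_form_on (parabolic a) f" and "finite S"
    and B: "\<And>s. s \<in> S \<Longrightarrow> mat (csize a) (csize a) (\<lambda>(i, j). B s i j) \<in> parabolic a"
  shows "mat (csize a) (csize a) (\<lambda>(i, j). \<Sum>s\<in>S. y s * B s i j) \<in> parabolic a \<and>
    f (mat (csize a) (csize a) (\<lambda>(i, j). \<Sum>s\<in>S. y s * B s i j))
      = (\<Sum>s\<in>S. y s * f (mat (csize a) (csize a) (\<lambda>(i, j). B s i j)))"
  using assms(2) B
proof (induction S)
  case empty
  have "mat (csize a) (csize a) (\<lambda>_. 0) = (0 :: 'k) \<cdot>\<^sub>m 0\<^sub>m (csize a) (csize a)" by (intro eq_matI) auto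
  moreover have "f (0 \<cdot>\<^sub>m 0\<^sub>m (csize a) (csize a)) = 0 * f (0\<^sub>m (csize a) (csize a))"
    using f zero_parabolic unfolding linear_form_on_def by blast
  ultimately show ?case using parabolic_closed(2)[OF zero_parabolic zero_parabolic, where a = a and c = 0] by simp
next
  case (insert s S)
  let ?M = "\<lambda>F. mat (csize a) (csize a) (\<lambda>(i, j). F i j :: 'k)"
  have eq: "?M (\<lambda>i j. \<Sum>s\<in>insert s S. y s * B s i j) = y s \<cdot>\<^sub>m ?M (B s) + ?M (\<lambda>i j. \<Sum>s\<in>S. y s * B s i j)"
    using insert.hyps by (intro eq_matI) auto
  have IH: "?M (\<lambda>i j. \<Sum>s\<in>S. y s * B s i j) \<in> parabolic a"
    "f (?M (\<lambda>i j. \<Sum>s\<in>S. y s * B s i j)) = (\<Sum>s\<in>S. y s * f (?M (B s)))"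
    using insert by auto
  have B: "?M (B s) \<in> parabolic a" using insert.prems by simp
  then have yB: "y s \<cdot>\<^sub>m ?M (B s) \<in> parabolic a" using parabolic_closed(2) by blast
  have "f (y s \<cdot>\<^sub>m ?M (B s) + ?M (\<lambda>i j. \<Sum>s\<in>S. y s * B s i j))
      = f (y s \<cdot>\<^sub>m ?M (B s)) + f (?M (\<lambda>i j. \<Sum>s\<in>S. y s * B s i j))"
    using f yB IH(1) unfolding linear_form_on_def by blast
  also have "f (y s \<cdot>\<^sub>m ?M (B s)) = y s * f (?M (B s))"
    using f B unfolding linear_form_on_def by blast
  finally show ?case unfolding eq using parabolic_closed(1)[OF yB IH(1)] IH(2) insert.hyps by simp
qed

text \<open>A matrix \<open>Y\<close> of trace zero is the sum of \<open>Y i j\<close> times the matrix unit at \<open>(i, j)\<close> for \<open>i \<noteq> j\<close>, and of \<open>Y i i\<close>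
times the difference of the diagonal units at \<open>i\<close> and \<open>0\<close>. The values of \<open>f\<close> on these matrices are the
entries of \<open>F\<close>.\<close>
lemma linear_form_on_trace:
  fixes f :: "'k::field mat \<Rightarrow> 'k"
  assumes f: "linear_form_on (parabolic a) f"
  shows "\<exists>F. \<forall>Y\<in>parabolic a. f Y = mtrace {..<csize a} (mmul {..<csize a} F (\<lambda>i j. Y $$ (i, j)))"
proof -
  let ?n = "csize a"
  let ?R = "\<lambda>i j. block_of a i \<le> block_of a j"
  let ?M = "\<lambda>F. mat ?n ?n (\<lambda>(i, j). F i j :: 'k)"
  define B :: "nat \<times> nat \<Rightarrow> nat \<Rightarrow> nat \<Rightarrow> 'k" where "B s i j =
    (if fst s = snd s then (if i = j then (if i = fst s then 1 else 0) - (if i = 0 then 1 else 0) else 0)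
     else if ?R (fst s) (snd s) \<and> i = fst s \<and> j = snd s then 1 else 0)" for s i j
  have tr: "(\<Sum>i<?n. B s i i) = 0" if s: "s \<in> {..<?n} \<times> {..<?n}" for s
  proof (cases "fst s = snd s")
    case True
    have "0 < ?n" "fst s < ?n" using s by auto
    then show ?thesis using True by (simp add: B_def sum_subtractf)
  next
    case False
    then show ?thesis by (auto simp: B_def intro!: sum.neutral)
  qed
  have Bp: "?M (B s) \<in> parabolic a" if "s \<in> {..<?n} \<times> {..<?n}" for s
    using tr[OF that] by (auto simp: parabolic_iff mtrace_def supported_def B_def)
  define F where "F i j = f (?M (B (j, i)))" for i j
  have "f Y = mtrace {..<?n} (mmul {..<?n} F (\<lambda>i j. Y $$ (i, j)))" if Y: "Y \<in> parabolic a" for Y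
  proof -
    let ?S = "{..<?n} \<times> {..<?n}"
    have YY: "Y \<in> carrier_mat ?n ?n" "(\<Sum>i<?n. Y $$ (i, i)) = 0"
      and Y0: "\<And>i j. i < ?n \<Longrightarrow> j < ?n \<Longrightarrow> \<not> ?R i j \<Longrightarrow> Y $$ (i, j) = 0"
      using Y by (auto simp: parabolic_iff mtrace_def supported_def)
    have "Y = ?M (\<lambda>i j. \<Sum>s\<in>?S. Y $$ s * B s i j)"
    proof (rule eq_matI)
      fix i j assume "i < dim_row (?M (\<lambda>i j. \<Sum>s\<in>?S. Y $$ s * B s i j))"
        "j < dim_col (?M (\<lambda>i j. \<Sum>s\<in>?S. Y $$ s * B s i j))"
      then have ij: "i < ?n" "j < ?n" by auto
      have "(\<Sum>s\<in>?S. Y $$ s * B s i j) = Y $$ (i, j)"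
      proof (cases "i = j")
        case False
        have "(\<Sum>s\<in>?S. Y $$ s * B s i j) = (\<Sum>s\<in>?S. if s = (i, j) then Y $$ (i, j) else 0)"
          using False Y0[OF ij] by (intro sum.cong) (auto simp: B_def)
        then show ?thesis using ij by simp
      next
        case True
        have "(\<Sum>s\<in>?S. Y $$ s * B s i j) = (\<Sum>p<?n. \<Sum>q<?n. Y $$ (p, q) * B (p, q) i i)"
          using True by (simp add: sum.cartesian_product)
        also have "\<dots> = (\<Sum>p<?n. \<Sum>q<?n. if q = p then Y $$ (p, p) * ((if i = p then 1 else 0) - (if i = 0 then 1 else 0)) else 0)"
          by (intro sum.cong) (auto simp: B_def)
        also have "\<dots> = (\<Sum>p<?n. (if i = p then Y $$ (p, p) else 0) - (if i = 0 then 1 else 0) * Y $$ (p, p))"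
          by (intro sum.cong) (auto simp: algebra_simps)
        also have "\<dots> = Y $$ (i, i)"
          using ij YY(2) by (simp add: sum_subtractf sum_distrib_left[symmetric])
        finally show ?thesis using True by simp
      qed
      then show "Y $$ (i, j) = ?M (\<lambda>i j. \<Sum>s\<in>?S. Y $$ s * B s i j) $$ (i, j)" using ij by simp
    qed (use YY in auto)
    then have "f Y = (\<Sum>s\<in>?S. Y $$ s * f (?M (B s)))"
      using linear_form_on_sum[OF f, of ?S B "\<lambda>s. Y $$ s"] Bp by simp
    also have "\<dots> = (\<Sum>p<?n. \<Sum>q<?n. Y $$ (p, q) * F q p)"
      by (simp add: F_def sum.cartesian_product split_def)
    also have "\<dots> = (\<Sum>q<?n. \<Sum>p<?n. F q p * Y $$ (p, q))" by (subst sum.swap) (simp add: mult.commute)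
    finally show ?thesis by (simp add: mtrace_def mmul_def)
  qed
  then show ?thesis by blast
qed

lemma csize_pos: "0 < csize a"
proof -
  obtain x xs where "parts a = x # xs" "0 < x"
    using parts[of a] by (auto simp: neq_Nil_conv)
  then show ?thesis by (simp add: csize_def)
qed

lemma mtrace_mcomm_supported:
  fixes F X :: "'i \<Rightarrow> 'i \<Rightarrow> 'k::field"
  assumes "\<And>i j. i \<in> J \<Longrightarrow> j \<in> J \<Longrightarrow> R j i \<Longrightarrow> mcomm J F X i j = 0" and "supported J R Y"
  shows "mtrace J (mmul J (mcomm J F X) Y) = 0"
  unfolding mtrace_def mmul_def
proof (intro sum.neutral ballI)
  fix i j assume "i \<in> J" "j \<in> J"
  then show "mcomm J F X i j * Y j i = 0" using assms(1)[of i j] supportedD[OF assms(2), of j i] by (cases "R j i") auto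
qed

text \<open>A stabilizer \<open>X\<close> becomes an element of the kernel of \<open>f\<close> after subtracting the scalar matrix with the same trace,
which exists in characteristic \<open>0\<close>.\<close>
lemma index_0_imp_has_rigid:
  fixes f :: "'k::field_char_0 mat \<Rightarrow> 'k"
  assumes f: "linear_form_on (parabolic a) f"
    and ker: "form_kernel (parabolic a) f = {0\<^sub>m (csize a) (csize a)}"
  shows "has_rigid TYPE('k) {..<csize a} (\<lambda>i j. block_of a i \<le> block_of a j)"
proof -
  let ?n = "csize a" and ?R = "\<lambda>i j. block_of a i \<le> block_of a j"
  let ?J = "{..<?n}"
  obtain F where F: "\<And>Y. Y \<in> parabolic a \<Longrightarrow> f Y = mtrace ?J (mmul ?J F (\<lambda>i j. Y $$ (i, j)))"
    using linear_form_on_trace[OF f] by blast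
  have "rigid ?J ?R F"
    unfolding rigid_def
  proof (intro allI impI)
    fix X assume X: "stabilizes ?J ?R F X"
    define c where "c = mtrace ?J X / of_nat ?n"
    define E :: "nat \<Rightarrow> nat \<Rightarrow> 'k" where "E i j = (if i = j then c else 0)" for i j
    define X0 where "X0 i j = X i j - E i j" for i j
    define M where "M = mat ?n ?n (\<lambda>(i, j). X0 i j)"
    have Mij: "M $$ (i, j) = X0 i j" if "i < ?n" "j < ?n" for i j using that by (simp add: M_def)
    have "mtrace ?J E = of_nat ?n * c" by (simp add: mtrace_def E_def)
    then have tr: "mtrace ?J X0 = 0"
      using csize_pos[of a] by (simp add: X0_def mtrace_def sum_subtractf c_def)
    have sup: "supported ?J ?R X0" using X by (auto simp: stabilizes_def supported_def X0_def E_def)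
    have M: "M \<in> parabolic a"
      using tr sup Mij by (auto simp: parabolic_iff mtrace_def supported_def) (auto simp: M_def)
    have comm: "mcomm ?J F X0 i j = 0" if "i \<in> ?J" "j \<in> ?J" "?R j i" for i j
    proof -
      have "mcomm ?J F X0 i j = mcomm ?J F X i j - mcomm ?J F E i j"
        by (simp add: mcomm_def X0_def right_diff_distrib left_diff_distrib sum_subtractf)
      also have "mcomm ?J F E i j = 0" using that by (intro mcomm_scalar) (auto simp: E_def)
      finally show ?thesis using X that by (simp add: stabilizes_def)
    qed
    have "f (lie_bracket M Y) = 0" if Y: "Y \<in> parabolic a" for Y
    proof -
      let ?Y = "\<lambda>i j. Y $$ (i, j)"
      have car: "M \<in> carrier_mat ?n ?n" "Y \<in> carrier_mat ?n ?n" using M Y by (auto simp: parabolic_iff)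
      have "f (lie_bracket M Y) = mtrace ?J (mmul ?J F (\<lambda>i j. lie_bracket M Y $$ (i, j)))"
        using F parabolic_closed(3)[OF M Y] by blast
      also have "\<dots> = mtrace ?J (mmul ?J F (mcomm ?J X0 ?Y))"
        unfolding mtrace_def
      proof (intro sum.cong refl mmul_cong)
        fix i l assume "i \<in> ?J" "l \<in> ?J"
        then show "lie_bracket M Y $$ (l, i) = mcomm ?J X0 ?Y l i"
          using lie_bracket_entry[OF car, of l i] Mij
          by (simp, intro mcomm_cong) auto
      qed
      also have "\<dots> = mtrace ?J (mmul ?J (mcomm ?J F X0) ?Y)" by (rule mtrace_invariance)
      also have "\<dots> = 0"
        using mtrace_mcomm_supported[where J = ?J and F = F and X = X0 and R = ?R and Y = ?Y] comm Y
        by (simp add: parabolic_iff)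
      finally show ?thesis .
    qed
    then have "M = 0\<^sub>m ?n ?n" using ker M by (auto simp: form_kernel_def)
    then have "X0 i j = 0" if "i < ?n" "j < ?n" for i j using Mij[OF that] that by simp
    then show "scalar_on ?J X" unfolding scalar_on_def X0_def E_def by auto
  qed
  then show ?thesis unfolding has_rigid_def by blast
qed

text \<open>Testing \<open>[F, X]\<close> against the matrix units shows that it vanishes off the diagonal where required, and
testing against differences of diagonal units shows that its diagonal is constant. As a commutator has trace
zero, that constant is \<open>0\<close> in characteristic \<open>0\<close>. So \<open>X\<close> is a stabilizer, hence scalar, and then zero since it has
trace zero.\<close>
lemma has_rigid_imp_index_0:
  assumes "has_rigid TYPE('k::field_char_0) {..<csize a} (\<lambda>i j. block_of a i \<le> block_of a j)"
  shows "\<exists>f. linear_form_on (parabolic a :: 'k mat set) f \<and>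
    form_kernel (parabolic a) f = {0\<^sub>m (csize a) (csize a)}"
proof -
  let ?n = "csize a" and ?R = "\<lambda>i j. block_of a i \<le> block_of a j"
  let ?J = "{..<?n}"
  obtain F :: "nat \<Rightarrow> nat \<Rightarrow> 'k" where F: "rigid ?J ?R F" using assms unfolding has_rigid_def by blast
  define f :: "'k mat \<Rightarrow> 'k" where "f Y = mtrace ?J (mmul ?J F (\<lambda>i j. Y $$ (i, j)))" for Y
  have car: "X \<in> carrier_mat ?n ?n" if "X \<in> parabolic a" for X :: "'k mat"
    using that by (simp add: parabolic_iff)
  have lin: "linear_form_on (parabolic a) f"
    unfolding linear_form_on_def
  proof (intro conjI ballI allI)
    fix X Y :: "'k mat" and c assume "X \<in> parabolic a" "Y \<in> parabolic a"
    then have c: "X \<in> carrier_mat ?n ?n" "Y \<in> carrier_mat ?n ?n" using car by auto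
    show "f (X + Y) = f X + f Y"
      unfolding f_def mtrace_def mmul_def sum.distrib[symmetric] using c
      by (intro sum.cong) (auto simp: algebra_simps)
  next
    fix X :: "'k mat" and c assume "X \<in> parabolic a"
    then have "X \<in> carrier_mat ?n ?n" using car by auto
    then show "f (c \<cdot>\<^sub>m X) = c * f X"
      unfolding f_def mtrace_def mmul_def sum_distrib_left
      by (intro sum.cong) auto
  qed
  have "X = 0\<^sub>m ?n ?n" if X: "X \<in> form_kernel (parabolic a) f" for X
  proof -
    let ?X = "\<lambda>i j. X $$ (i, j)"
    have Xp: "X \<in> parabolic a" using X by (simp add: form_kernel_def)
    define C where "C = mcomm ?J F ?X"
    have key: "(\<Sum>i<?n. \<Sum>j<?n. C i j * G j i) = 0"
      if G: "mat ?n ?n (\<lambda>(i, j). G i j) \<in> parabolic a" for G :: "nat \<Rightarrow> nat \<Rightarrow> 'k"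
    proof -
      let ?G = "mat ?n ?n (\<lambda>(i, j). G i j)"
      have "0 = f (lie_bracket X ?G)" using X G by (simp add: form_kernel_def)
      also have "\<dots> = mtrace ?J (mmul ?J F (mcomm ?J ?X G))"
        unfolding f_def mtrace_def
      proof (intro sum.cong refl mmul_cong)
        fix i l assume "i \<in> ?J" "l \<in> ?J"
        then show "lie_bracket X ?G $$ (l, i) = mcomm ?J ?X G l i"
          using lie_bracket_entry[OF car[OF Xp] car[OF G], of l i]
          by (simp, intro mcomm_cong) auto
      qed
      also have "\<dots> = mtrace ?J (mmul ?J C G)" unfolding C_def by (rule mtrace_invariance)
      finally show ?thesis by (simp add: mtrace_def mmul_def)
    qed
    have off: "C i j = 0" if ij: "i < ?n" "j < ?n" "?R j i" "i \<noteq> j" for i j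
    proof -
      define G :: "nat \<Rightarrow> nat \<Rightarrow> 'k" where "G p q = (if p = j \<and> q = i then 1 else 0)" for p q
      have "(\<Sum>p<?n. G p p) = 0" using ij by (auto simp: G_def intro!: sum.neutral)
      then have "mat ?n ?n (\<lambda>(i, j). G i j) \<in> parabolic a"
        using ij by (auto simp: parabolic_iff mtrace_def supported_def) (auto simp: G_def)
      from key[OF this] have "(\<Sum>p<?n. \<Sum>q<?n. C p q * G q p) = 0" .
      also have "(\<Sum>p<?n. \<Sum>q<?n. C p q * G q p) = (\<Sum>p<?n. \<Sum>q<?n. if q = j then (if p = i then C p q else 0) else 0)"
        by (intro sum.cong) (auto simp: G_def)
      also have "\<dots> = C i j" using ij by simp
      finally show ?thesis .
    qed
    have diag: "C i i = C 0 0" if i: "i < ?n" for i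
    proof (cases "i = 0")
      case False
      define G :: "nat \<Rightarrow> nat \<Rightarrow> 'k" where "G p q = (if p = q then (if p = i then 1 else 0) - (if p = 0 then 1 else 0) else 0)" for p q
      have "(\<Sum>p<?n. G p p) = 0" using i by (simp add: G_def sum_subtractf)
      then have "mat ?n ?n (\<lambda>(i, j). G i j) \<in> parabolic a"
        by (auto simp: parabolic_iff mtrace_def supported_def) (auto simp: G_def intro!: gr0I)
      from key[OF this] have "(\<Sum>p<?n. \<Sum>q<?n. C p q * G q p) = 0" .
      also have "(\<Sum>p<?n. \<Sum>q<?n. C p q * G q p) =
        (\<Sum>p<?n. \<Sum>q<?n. if q = p then C p p * ((if p = i then 1 else 0) - (if p = 0 then 1 else 0)) else 0)"
        by (intro sum.cong) (auto simp: G_def)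
      also have "\<dots> = (\<Sum>p<?n. (if p = i then C p p else 0) - (if p = 0 then C p p else 0))"
        by (intro sum.cong) (auto simp: algebra_simps)
      also have "\<dots> = C i i - C 0 0" using i csize_pos[of a] by (simp add: sum_subtractf)
      finally show ?thesis by simp
    qed simp
    have "(\<Sum>i<?n. C i i) = (\<Sum>i<?n. C 0 0)" by (rule sum.cong) (rule HOL.refl, rule diag, simp)
    then have "of_nat ?n * C 0 0 = (\<Sum>i<?n. C i i)" by simp
    also have "\<dots> = 0" using mtrace_mcomm[of ?J F ?X] by (simp add: mtrace_def C_def)
    finally have C0: "C 0 0 = 0" using csize_pos[of a] by simp
    have "C i j = 0" if "i < ?n" "j < ?n" "?R j i" for i j
      using off[OF that] diag[OF that(1)] C0 by (cases "i = j") simp_all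
    then have "stabilizes ?J ?R F ?X" using Xp by (simp add: stabilizes_def parabolic_iff C_def)
    then obtain c where c: "\<And>i j. i < ?n \<Longrightarrow> j < ?n \<Longrightarrow> X $$ (i, j) = (if i = j then c else 0)"
      using F unfolding rigid_def scalar_on_def by blast
    have "(\<Sum>i<?n. X $$ (i, i)) = of_nat ?n * c" using c by simp
    then have "c = 0" using Xp csize_pos[of a] by (simp add: parabolic_iff mtrace_def)
    then show ?thesis using c car[OF Xp] by (intro eq_matI) auto
  qed
  moreover have "0\<^sub>m ?n ?n \<in> form_kernel (parabolic a) f"
    by (rule zero_in_form_kernel[OF lin])
  ultimately show ?thesis using lin by blast
qed

theorem lie_index_0_iff_levels_rigid:
  "lie_index (csize a) (parabolic a :: 'k::field_char_0 mat set) = 0 \<longleftrightarrow> levels_rigid TYPE('k) (parts a)"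
proof -
  have "has_rigid TYPE('k) {..<csize a} (\<lambda>i j. block_of a i \<le> block_of a j) \<longleftrightarrow> levels_rigid TYPE('k) (parts a)"
    by (rule list_rigid_model[where Q = "(\<le>)"]) (use card_block_of[of a] in auto)
  then show ?thesis
    unfolding lie_index_eq_0_iff using index_0_imp_has_rigid has_rigid_imp_index_0 by blast
qed

section \<open>The operators\<close>

lemma parts_Composition: "l \<noteq> [] \<Longrightarrow> \<forall>x\<in>set l. 0 < x \<Longrightarrow> parts (Composition l) = l"
  by (rule Composition_inverse) simp

lemma parts_ne: "parts a \<noteq> []" and parts_pos: "x \<in> set (parts a) \<Longrightarrow> 0 < x"
  using parts[of a] by auto

lemma parts_sigma: "parts a = x # xs \<Longrightarrow> parts (\<sigma> m a) = (m + 2) * x # xs @ [(m + 1) * x]"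
  by (simp add: \<sigma>.rep_eq)

lemma parts_tau: "parts a = x # y # xs \<Longrightarrow>
    parts (\<tau> m a) = ((m + 1) * x + (m + 2) * y) # xs @ [m * x + (m + 1) * y]"
  by (simp add: \<tau>.rep_eq)

lemma tau_single: "parts a = [x] \<Longrightarrow> \<tau> m a = a"
  by (metis (mono_tags, lifting) \<tau>.rep_eq list.simps(5) parts_inject list.case_eq_if list.sel(3) list.distinct(1))

lemma theta_theta: "\<theta> (\<theta> a) = a"
  by (simp add: parts_inject[symmetric] \<theta>.rep_eq)

abbreviation frob :: "'k::field itself \<Rightarrow> composition \<Rightarrow> bool" where
  "frob K a \<equiv> levels_rigid K (parts a)"

lemma frob_theta: "frob TYPE('k::field) (\<theta> a) \<longleftrightarrow> frob TYPE('k) a"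
  by (simp add: \<theta>.rep_eq levels_rigid_rev)

lemma frob_sigma: "frob TYPE('k::field) (\<sigma> m a) \<longleftrightarrow> frob TYPE('k) a"
proof -
  obtain x xs where x: "parts a = x # xs" using parts_ne by (meson neq_Nil_conv)
  then have "0 < x" using parts_pos[of x a] by simp
  from levels_rigid_sigma[where 'k = 'k and m = m and mid = xs, OF this] show ?thesis using parts_sigma[OF x] x by simp
qed

lemma frob_tau: "frob TYPE('k::field) (\<tau> m a) \<longleftrightarrow> frob TYPE('k) a"
proof (cases "\<exists>x. parts a = [x]")
  case True then show ?thesis using tau_single by metis
next
  case False
  then obtain x y xs where x: "parts a = x # y # xs" using parts_ne by (metis neq_Nil_conv)
  then have "0 < x" "0 < y" using parts_pos[of x a] parts_pos[of y a] by simp_all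
  from levels_rigid_tau[where 'k = 'k and m = m and mid = xs, OF this] show ?thesis using parts_tau[OF x] x by simp
qed

lemma frob_op: "\<eta> \<in> A_ops \<Longrightarrow> frob TYPE('k::field) (\<eta> a) \<longleftrightarrow> frob TYPE('k) a"
  unfolding A_ops_def S_ops_def T_ops_def
  using frob_theta[where 'k = 'k] frob_sigma[where 'k = 'k] frob_tau[where 'k = 'k] by auto

text \<open>Excludes exactly the letters of \<open>T\<close> applied to a composition with one part, where nothing happens. All other
applications of a letter strictly increase the size.\<close>
definition admissible :: "(composition \<Rightarrow> composition) \<Rightarrow> composition \<Rightarrow> bool" where
  "admissible \<eta> a \<longleftrightarrow> \<eta> \<in> A_ops \<and> (\<eta> \<in> S_ops \<or> 2 \<le> length (parts a))"

lemma csize_theta: "csize (\<theta> a) = csize a"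
  by (simp add: csize_def \<theta>.rep_eq)

lemma length_theta: "length (parts (\<theta> a)) = length (parts a)"
  by (simp add: \<theta>.rep_eq)

lemma sigma_size:
  "csize (\<sigma> m a) = csize a + 2 * ((m + 1) * hd (parts a))" "length (parts (\<sigma> m a)) = Suc (length (parts a))"
proof -
  obtain x xs where x: "parts a = x # xs" using parts_ne by (meson neq_Nil_conv)
  show "csize (\<sigma> m a) = csize a + 2 * ((m + 1) * hd (parts a))" "length (parts (\<sigma> m a)) = Suc (length (parts a))"
    using parts_sigma[OF x, of m] x by (simp_all add: csize_def algebra_simps)
qed

lemma tau_size:
  assumes "2 \<le> length (parts a)"
  shows "\<exists>k>0. csize (\<tau> m a) = csize a + 2 * k" "length (parts (\<tau> m a)) = length (parts a)"
proof -
  obtain x y xs where x: "parts a = x # y # xs" using assms by (metis One_nat_def Suc_1 Suc_le_length_iff)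
  have "0 < y" using x parts_pos[of y a] by simp
  then show "\<exists>k>0. csize (\<tau> m a) = csize a + 2 * k" "length (parts (\<tau> m a)) = length (parts a)"
    using parts_tau[OF x, of m] x
    by (auto simp: csize_def algebra_simps intro!: exI[of _ "m * x + (m + 1) * y"])
qed

lemma hd_parts_pos: "0 < hd (parts a)"
  using parts_ne[of a] parts_pos[of "hd (parts a)" a] by simp

lemma admissible_size:
  assumes "admissible \<eta> a"
  shows "\<exists>k>0. csize (\<eta> a) = csize a + 2 * k" and "2 \<le> length (parts (\<eta> a))"
proof -
  have \<eta>: "\<eta> \<in> A_ops" using assms by (simp add: admissible_def)
  have pos: "1 \<le> length (parts a)" using parts_ne[of a] by (cases "parts a") auto
  have S: "\<exists>k>0. csize (\<sigma> m a) = csize a + 2 * k" for m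
    using sigma_size(1)[of m a] hd_parts_pos[of a] by (intro exI[of _ "(m + 1) * hd (parts a)"]) simp
  have "(\<exists>k>0. csize (\<eta> a) = csize a + 2 * k) \<and> 2 \<le> length (parts (\<eta> a))"
  proof (cases "\<eta> \<in> S_ops")
    case True
    then show ?thesis using S pos by (auto simp: S_ops_def csize_theta length_theta sigma_size(2))
  next
    case False
    then have "\<eta> \<in> T_ops" "2 \<le> length (parts a)" using assms by (auto simp: admissible_def A_ops_def)
    then show ?thesis using tau_size[of a] by (auto simp: T_ops_def csize_theta length_theta)
  qed
  then show "\<exists>k>0. csize (\<eta> a) = csize a + 2 * k" "2 \<le> length (parts (\<eta> a))" by blast+
qed

text \<open>Division of \<open>d\<close> by \<open>k = c - d\<close>: remainder \<open>0\<close> gives the first case with \<open>x = k\<close>, a remainder \<open>y > 0\<close> gives the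
second one with \<open>x = k - y\<close>.\<close>
lemma division_step:
  fixes c d :: nat
  assumes "0 < d" "d < c"
  shows "(\<exists>m x. 0 < x \<and> c = (m + 2) * x \<and> d = (m + 1) * x) \<or>
    (\<exists>m x y. 0 < x \<and> 0 < y \<and> c = (m + 1) * x + (m + 2) * y \<and> d = m * x + (m + 1) * y)"
proof -
  define k where "k = c - d"
  have k: "0 < k" "c = d + k" using assms by (auto simp: k_def)
  define q r where "q = d div k" and "r = d mod k"
  have d: "d = q * k + r" by (simp add: q_def r_def)
  have r: "r < k" using k by (simp add: r_def)
  show ?thesis
  proof (cases "r = 0")
    case True
    then have "q \<noteq> 0" using d assms by auto
    then obtain m where "q = m + 1" by (metis Suc_eq_plus1 not0_implies_Suc)
    then show ?thesis using d k True by (intro disjI1 exI[of _ m] exI[of _ k]) (auto simp: algebra_simps)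
  next
    case False
    define x where "x = k - r"
    have "k = x + r" "0 < x" using r by (auto simp: x_def)
    then show ?thesis using d k False
      by (intro disjI2 exI[of _ q] exI[of _ x] exI[of _ r]) (auto simp: algebra_simps)
  qed
qed

text \<open>The differences of the two equations give \<open>x + y = x' + y'\<close>, and \<open>m\<close>, \<open>y\<close> are quotient and remainder of the
last entry by this number. The value \<open>y = 0\<close> covers \<open>\<sigma>\<close>.\<close>
lemma division_unique:
  fixes m m' x y x' y' :: nat
  assumes "0 < x" "0 < x'" and "(m + 1) * x + (m + 2) * y = (m' + 1) * x' + (m' + 2) * y'"
    and "m * x + (m + 1) * y = m' * x' + (m' + 1) * y'"
  shows "m = m' \<and> x = x' \<and> y = y'"
proof -
  have k: "x + y = x' + y'" using assms(3,4) by (simp add: algebra_simps)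
  have d: "m * (x + y) + y = m' * (x' + y') + y'" using assms(4) by (simp add: algebra_simps)
  have "y < x + y" "y' < x' + y'" using assms by auto
  have "(m * (x + y) + y) div (x + y) = m" "(m * (x + y) + y) mod (x + y) = y"
    using \<open>y < x + y\<close> by simp_all
  moreover have "(m' * (x' + y') + y') div (x' + y') = m'" "(m' * (x' + y') + y') mod (x' + y') = y'"
    using \<open>y' < x' + y'\<close> by simp_all
  ultimately have "m = m'" "y = y'" using k d by metis+
  then show ?thesis using k by simp
qed

text \<open>The letters without \<open>\<theta>\<close>: an admissible application makes the first part larger than the last one, whereas a
letter with \<open>\<theta>\<close> makes it smaller.\<close>
definition core_ops :: "(composition \<Rightarrow> composition) set" where
  "core_ops = range \<sigma> \<union> range \<tau>"

text \<open>One normal form for both kinds of letters: \<open>\<sigma>\<^sub>m\<close> is \<open>\<tau>\<^sub>m\<^sub>+\<^sub>1\<close> with the second part \<open>0\<close> inserted.\<close>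
lemma core_form:
  assumes "admissible \<kappa> a" "\<kappa> \<in> core_ops"
  shows "\<exists>m x y mid. 0 < x \<and> parts (\<kappa> a) = ((m + 1) * x + (m + 2) * y) # mid @ [m * x + (m + 1) * y]
    \<and> (if y = 0 then \<kappa> = \<sigma> (m - 1) \<and> parts a = x # mid else \<kappa> = \<tau> m \<and> parts a = x # y # mid)"
proof -
  have sig: ?thesis if k: "\<kappa> = \<sigma> m" for m
  proof -
    obtain x xs where x: "parts a = x # xs" using parts_ne by (meson neq_Nil_conv)
    show ?thesis using parts_sigma[OF x, of m] x k parts_pos[of x a]
      by (intro exI[of _ "m + 1"] exI[of _ x] exI[of _ 0] exI[of _ xs]) simp
  qed
  show ?thesis
  proof (cases "\<exists>m. \<kappa> = \<sigma> m")
    case True then show ?thesis using sig by blast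
  next
    case False
    then obtain m where m: "\<kappa> = \<tau> m" using assms(2) by (auto simp: core_ops_def)
    show ?thesis
    proof (cases "2 \<le> length (parts a)")
      case True
      then obtain x y xs where x: "parts a = x # y # xs" by (metis One_nat_def Suc_1 Suc_le_length_iff)
      show ?thesis using parts_tau[OF x, of m] x m parts_pos[of x a] parts_pos[of y a]
        by (intro exI[of _ m] exI[of _ x] exI[of _ y] exI[of _ xs]) simp
    next
      case short: False
      then have "\<kappa> \<in> S_ops" using assms(1) by (simp add: admissible_def)
      then obtain l where "\<kappa> = \<theta> \<circ> \<sigma> l" using False by (auto simp: S_ops_def)
      then have "length (parts (\<kappa> a)) = Suc (length (parts a))" by (simp add: length_theta sigma_size(2))
      moreover obtain x where "parts a = [x]"
        using parts_ne[of a] short by (cases "parts a" rule: remdups_adj.cases) auto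
      ultimately show ?thesis using m tau_single by force
    qed
  qed
qed

lemma core_unique:
  assumes "admissible \<kappa> a" "\<kappa> \<in> core_ops" "admissible \<kappa>' a'" "\<kappa>' \<in> core_ops" and eq: "\<kappa> a = \<kappa>' a'"
  shows "\<kappa> = \<kappa>' \<and> a = a'"
proof -
  obtain m x y mid where 1: "0 < x" "parts (\<kappa> a) = ((m + 1) * x + (m + 2) * y) # mid @ [m * x + (m + 1) * y]"
    "if y = 0 then \<kappa> = \<sigma> (m - 1) \<and> parts a = x # mid else \<kappa> = \<tau> m \<and> parts a = x # y # mid"
    using core_form[OF assms(1,2)] by blast
  obtain m' x' y' mid' where 2: "0 < x'" "parts (\<kappa>' a') = ((m' + 1) * x' + (m' + 2) * y') # mid' @ [m' * x' + (m' + 1) * y']"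
    "if y' = 0 then \<kappa>' = \<sigma> (m' - 1) \<and> parts a' = x' # mid' else \<kappa>' = \<tau> m' \<and> parts a' = x' # y' # mid'"
    using core_form[OF assms(3,4)] by blast
  have "mid = mid'" "(m + 1) * x + (m + 2) * y = (m' + 1) * x' + (m' + 2) * y'"
    "m * x + (m + 1) * y = m' * x' + (m' + 1) * y'"
    using 1(2) 2(2) eq by (simp_all only: list.inject append1_eq_conv)
  then have "mid = mid'" "m = m'" "x = x'" "y = y'" using division_unique[OF 1(1) 2(1)] by blast+
  then have "\<kappa> = \<kappa>'" "parts a = parts a'" using 1(3) 2(3) by (auto split: if_splits)
  then show ?thesis by (simp add: parts_inject)
qed

lemma core_hd_last:
  assumes "admissible \<kappa> a" "\<kappa> \<in> core_ops"
  shows "last (parts (\<kappa> a)) < hd (parts (\<kappa> a))"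
proof -
  obtain m x y mid where "0 < x" "parts (\<kappa> a) = ((m + 1) * x + (m + 2) * y) # mid @ [m * x + (m + 1) * y]"
    using core_form[OF assms] by blast
  then show ?thesis by simp
qed

lemma admissible_cases:
  assumes "admissible \<eta> a"
  obtains \<kappa> where "admissible \<kappa> a" "\<kappa> \<in> core_ops" "\<eta> = \<kappa>"
    | \<kappa> where "admissible \<kappa> a" "\<kappa> \<in> core_ops" "\<eta> = \<theta> \<circ> \<kappa>"
proof (cases "\<eta> \<in> S_ops")
  case True
  then obtain m where "\<eta> = \<sigma> m \<or> \<eta> = \<theta> \<circ> \<sigma> m" by (auto simp: S_ops_def)
  moreover have "admissible (\<sigma> m) a" "\<sigma> m \<in> core_ops"
    by (auto simp: admissible_def A_ops_def S_ops_def core_ops_def)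
  ultimately show ?thesis using that by blast
next
  case False
  then have "\<eta> \<in> T_ops" "2 \<le> length (parts a)" using assms by (auto simp: admissible_def A_ops_def)
  then obtain m where "\<eta> = \<tau> m \<or> \<eta> = \<theta> \<circ> \<tau> m" by (auto simp: T_ops_def)
  moreover have "admissible (\<tau> m) a" "\<tau> m \<in> core_ops"
    using \<open>2 \<le> length (parts a)\<close> by (auto simp: admissible_def A_ops_def T_ops_def core_ops_def)
  ultimately show ?thesis using that by blast
qed

lemma theta_core_hd_last:
  assumes "admissible \<kappa> a" "\<kappa> \<in> core_ops"
  shows "hd (parts (\<theta> (\<kappa> a))) < last (parts (\<theta> (\<kappa> a)))"
  using core_hd_last[OF assms] parts_ne[of "\<kappa> a"] by (simp add: \<theta>.rep_eq hd_rev last_rev)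

lemma unique_parsing:
  assumes "admissible \<eta> a" "admissible \<eta>' a'" and eq: "\<eta> a = \<eta>' a'"
  shows "\<eta> = \<eta>' \<and> a = a'"
proof (cases rule: admissible_cases[OF assms(1)])
  case (1 \<kappa>)
  show ?thesis
  proof (cases rule: admissible_cases[OF assms(2)])
    case (1 \<kappa>')
    then show ?thesis using core_unique \<open>admissible \<kappa> a\<close> \<open>\<kappa> \<in> core_ops\<close> \<open>\<eta> = \<kappa>\<close> eq by blast
  next
    case (2 \<kappa>')
    then show ?thesis
      using core_hd_last[OF 1(1,2)] theta_core_hd_last[OF 2(1,2)] eq 1(3) by simp
  qed
next
  case (2 \<kappa>)
  show ?thesis
  proof (cases rule: admissible_cases[OF assms(2)])
    case (1 \<kappa>')
    then show ?thesis
      using core_hd_last[OF 1(1,2)] theta_core_hd_last[OF 2(1,2)] eq 2(3) by simp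
  next
    case (2 \<kappa>')
    have "\<kappa> a = \<kappa>' a'" using eq 2(3) \<open>\<eta> = \<theta> \<circ> \<kappa>\<close> theta_theta by (metis comp_apply)
    then show ?thesis using core_unique[OF \<open>admissible \<kappa> a\<close> \<open>\<kappa> \<in> core_ops\<close> 2(1,2)] 2(3) \<open>\<eta> = \<theta> \<circ> \<kappa>\<close> by simp
  qed
qed

lemma exists_core_preimage:
  assumes c: "parts c = x # mid @ [z]" and zx: "z < x"
  shows "\<exists>\<kappa> a. (\<kappa> \<in> range \<sigma> \<or> \<kappa> \<in> range \<tau> \<and> 2 \<le> length (parts a)) \<and> c = \<kappa> a"
proof -
  have z: "0 < z" and mid: "\<forall>u\<in>set mid. 0 < u" using parts_pos[of _ c] c by auto
  from division_step[OF z zx] show ?thesis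
  proof (elim disjE exE conjE)
    fix m x' assume h: "0 < x'" "x = (m + 2) * x'" "z = (m + 1) * x'"
    have p: "parts (Composition (x' # mid)) = x' # mid" using h mid by (intro parts_Composition) auto
    have "c = \<sigma> m (Composition (x' # mid))"
      using parts_sigma[OF p, of m] c h by (simp add: parts_inject[symmetric])
    then show ?thesis by blast
  next
    fix m x' y assume h: "0 < x'" "0 < y" "x = (m + 1) * x' + (m + 2) * y" "z = m * x' + (m + 1) * y"
    have p: "parts (Composition (x' # y # mid)) = x' # y # mid" using h mid by (intro parts_Composition) auto
    have "c = \<tau> m (Composition (x' # y # mid))"
      using parts_tau[OF p, of m] c h by (simp add: parts_inject[symmetric])
    moreover have "2 \<le> length (parts (Composition (x' # y # mid)))" using p by simp
    ultimately show ?thesis by blast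
  qed
qed

lemma exists_preimage:
  assumes c: "parts c = x # mid @ [z]" and zx: "z \<noteq> x"
  shows "\<exists>\<eta> a. admissible \<eta> a \<and> c = \<eta> a"
proof (cases "z < x")
  case True
  then obtain \<kappa> a where k: "\<kappa> \<in> range \<sigma> \<or> \<kappa> \<in> range \<tau> \<and> 2 \<le> length (parts a)" "c = \<kappa> a"
    using exists_core_preimage[OF c] by blast
  then have "admissible \<kappa> a" by (auto simp: admissible_def A_ops_def S_ops_def T_ops_def)
  then show ?thesis using k(2) by blast
next
  case False
  have "parts (\<theta> c) = z # rev mid @ [x]" using c by (simp add: \<theta>.rep_eq)
  then obtain \<kappa> a where k: "\<kappa> \<in> range \<sigma> \<or> \<kappa> \<in> range \<tau> \<and> 2 \<le> length (parts a)" "\<theta> c = \<kappa> a"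
    using exists_core_preimage[of "\<theta> c" z "rev mid" x] False zx by auto
  have "admissible (\<theta> \<circ> \<kappa>) a"
    using k(1) by (auto simp: admissible_def A_ops_def S_ops_def T_ops_def)
  moreover have "c = (\<theta> \<circ> \<kappa>) a" using k(2) theta_theta[of c] by simp
  ultimately show ?thesis by blast
qed

section \<open>Words\<close>

definition act :: "(composition \<Rightarrow> composition) list \<Rightarrow> composition \<Rightarrow> composition" where
  "act \<eta>s = foldr (\<circ>) \<eta>s id"

lemma act_Nil: "act [] = id" and act_Cons: "act (\<eta> # \<eta>s) = \<eta> \<circ> act \<eta>s"
  by (simp_all only: act_def foldr.simps id_apply comp_apply)

lemma act_apply [simp]: "act [] b = b" "act (\<eta> # \<eta>s) b = \<eta> (act \<eta>s b)"
  by (simp_all add: act_Nil act_Cons)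

lemma act_append: "act (\<eta>s @ \<rho>s) = act \<eta>s \<circ> act \<rho>s"
  by (rule ext, induction \<eta>s) simp_all

fun admissible_word :: "(composition \<Rightarrow> composition) list \<Rightarrow> composition \<Rightarrow> bool" where
  "admissible_word [] b \<longleftrightarrow> True"
| "admissible_word (\<eta> # \<eta>s) b \<longleftrightarrow> admissible_word \<eta>s b \<and> admissible \<eta> (act \<eta>s b)"

lemma admissible_word_letters: "admissible_word \<eta>s b \<Longrightarrow> set \<eta>s \<subseteq> A_ops"
  by (induction \<eta>s) (auto simp: admissible_def)

lemma admissible_word_last: "admissible_word \<eta>s b \<Longrightarrow> \<eta>s \<noteq> [] \<Longrightarrow> admissible (last \<eta>s) b"
  by (induction \<eta>s) auto

lemma admissible_word_size:
  "admissible_word \<eta>s b \<Longrightarrow> \<exists>k. csize (act \<eta>s b) = csize b + 2 * k \<and> (\<eta>s \<noteq> [] \<longrightarrow> 0 < k)"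
proof (induction \<eta>s)
  case (Cons \<eta> \<eta>s)
  have "admissible_word \<eta>s b" using Cons.prems by simp
  from Cons.IH[OF this] obtain k where k: "csize (act \<eta>s b) = csize b + 2 * k" by blast
  obtain l where l: "0 < l" "csize (\<eta> (act \<eta>s b)) = csize (act \<eta>s b) + 2 * l"
    using admissible_size(1)[of \<eta> "act \<eta>s b"] Cons.prems by auto
  show ?case using k l by (intro exI[of _ "k + l"]) simp
qed simp

lemma admissible_word_length: "admissible_word \<eta>s b \<Longrightarrow> \<eta>s \<noteq> [] \<Longrightarrow> 2 \<le> length (parts (act \<eta>s b))"
  using admissible_size(2) by (cases \<eta>s) auto

lemma admissible_wordI:
  assumes "set \<eta>s \<subseteq> A_ops" "2 \<le> length (parts b) \<or> (\<eta>s \<noteq> [] \<longrightarrow> last \<eta>s \<in> S_ops)"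
  shows "admissible_word \<eta>s b"
  using assms
proof (induction \<eta>s)
  case (Cons \<eta> \<eta>s)
  show ?case
  proof (cases "\<eta>s = []")
    case True then show ?thesis using Cons.prems by (auto simp: admissible_def)
  next
    case False
    then have "admissible_word \<eta>s b" using Cons by auto
    then show ?thesis using admissible_word_length[OF _ False] Cons.prems by (auto simp: admissible_def)
  qed
qed simp

text \<open>Reads off the letters one by one from the left by \<open>unique_parsing\<close>; the size decides when the word ends.\<close>
lemma admissible_word_inj:
  "admissible_word \<eta>s b \<Longrightarrow> admissible_word \<eta>s' b \<Longrightarrow> act \<eta>s b = act \<eta>s' b \<Longrightarrow> \<eta>s = \<eta>s'"
proof (induction \<eta>s arbitrary: \<eta>s')
  case Nil
  show ?case
  proof (rule ccontr)
    assume "[] \<noteq> \<eta>s'"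
    then obtain k where "csize (act \<eta>s' b) = csize b + 2 * k" "0 < k"
      using admissible_word_size[OF Nil.prems(2)] by blast
    moreover have "act \<eta>s' b = b" using Nil.prems(3) by simp
    ultimately show False by simp
  qed
next
  case (Cons \<eta> \<eta>s)
  show ?case
  proof (cases \<eta>s')
    case Nil
    then have "act (\<eta> # \<eta>s) b = b" using Cons.prems by simp
    then show ?thesis using admissible_word_size[OF Cons.prems(1)] by auto
  next
    case (Cons \<eta>' \<rho>s)
    then have "\<eta> = \<eta>'" "act \<eta>s b = act \<rho>s b"
      using unique_parsing[of \<eta> "act \<eta>s b" \<eta>' "act \<rho>s b"] Cons.prems by auto
    then show ?thesis using Cons.IH[of \<rho>s] Cons.prems \<open>\<eta>s' = \<eta>' # \<rho>s\<close> by auto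
  qed
qed

lemma base_parts: "parts (base_comp 0) = [1, 1]" "parts (base_comp (Suc 0)) = [1]"
  by (simp_all add: base_comp_def comp_1_1.rep_eq comp_1.rep_eq)

lemma frob_base: "\<epsilon> \<in> {0, 1} \<Longrightarrow> frob TYPE('k::field) (base_comp \<epsilon>)"
  using levels_rigid_single[of 1, where 'k = 'k] levels_rigid_equal_ends[of 1 "[]", where 'k = 'k]
  by (auto simp: base_parts)

text \<open>The descent: a composition with different ends has a smaller Frobenius preimage of the same parity, and the
others are \<open>(1)\<close> or \<open>(1, 1)\<close>.\<close>
lemma frob_imp_word:
  assumes "frob TYPE('k::field) c"
  shows "\<exists>\<eta>s. admissible_word \<eta>s (base_comp (csize c mod 2)) \<and> c = act \<eta>s (base_comp (csize c mod 2))"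
  using assms
proof (induction "csize c" arbitrary: c rule: less_induct)
  case less
  show ?case
  proof (cases "\<exists>x. parts c = [x]")
    case True
    then obtain x where x: "parts c = [x]" by blast
    then have "x = 1" using less.prems levels_rigid_single[of x, where 'k = 'k] parts_pos[of x c] by simp
    then have "c = base_comp (csize c mod 2)"
      using x by (simp add: parts_inject[symmetric] csize_def base_parts)
    then show ?thesis by (intro exI[of _ "[]"]) simp
  next
    case False
    then obtain x ys where "parts c = x # ys" "ys \<noteq> []" using parts_ne[of c] by (cases "parts c") auto
    then obtain mid z where c: "parts c = x # mid @ [z]" by (metis append_butlast_last_id)
    show ?thesis
    proof (cases "z = x")
      case True
      have "x = 1 \<and> mid = []"
        using less.prems c True levels_rigid_equal_ends[of x mid, where 'k = 'k] parts_pos[of _ c] by simp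
      then have "c = base_comp (csize c mod 2)"
        using c True by (simp add: parts_inject[symmetric] csize_def base_parts)
      then show ?thesis by (intro exI[of _ "[]"]) simp
    next
      case False
      then obtain \<eta> a where a: "admissible \<eta> a" "c = \<eta> a" using exists_preimage[OF c] by blast
      obtain k where k: "0 < k" "csize c = csize a + 2 * k" using admissible_size(1)[OF a(1)] a(2) by blast
      have "\<eta> \<in> A_ops" using a(1) by (simp add: admissible_def)
      then have "frob TYPE('k) a" using less.prems frob_op[where 'k = 'k] a(2) by simp
      moreover have "csize a < csize c" using k by simp
      ultimately obtain \<eta>s where "admissible_word \<eta>s (base_comp (csize a mod 2))"
        "a = act \<eta>s (base_comp (csize a mod 2))" using less.hyps by blast
      then show ?thesis using a k by (intro exI[of _ "\<eta> # \<eta>s"]) simp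
    qed
  qed
qed

lemma op_monoid_words: "w \<in> op_monoid \<longleftrightarrow> (\<exists>\<eta>s. set \<eta>s \<subseteq> A_ops \<and> w = act \<eta>s)"
proof
  show "w \<in> op_monoid \<Longrightarrow> \<exists>\<eta>s. set \<eta>s \<subseteq> A_ops \<and> w = act \<eta>s"
  proof (induction rule: op_monoid.induct)
    case one show ?case by (intro exI[of _ "[]"]) (simp add: act_Nil del: id_apply)
  next
    case (gen \<eta>) then show ?case by (intro exI[of _ "[\<eta>]"]) (auto simp: fun_eq_iff)
  next
    case (mult v w)
    then obtain \<eta>s \<rho>s where w: "set \<eta>s \<subseteq> A_ops" "v = act \<eta>s" "set \<rho>s \<subseteq> A_ops" "w = act \<rho>s" by blast
    have "v \<circ> w = act (\<eta>s @ \<rho>s)" unfolding w(2,4) by (rule act_append[symmetric])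
    moreover have "set (\<eta>s @ \<rho>s) \<subseteq> A_ops" using w by simp
    ultimately show ?case by blast
  qed
next
  have "set \<eta>s \<subseteq> A_ops \<Longrightarrow> act \<eta>s \<in> op_monoid" for \<eta>s
  proof (induction \<eta>s)
    case Nil show ?case unfolding act_Nil by (rule op_monoid.one)
  next
    case (Cons \<eta> \<eta>s)
    then show ?case unfolding act_Cons by (intro op_monoid.mult[OF op_monoid.gen]) simp_all
  qed
  then show "\<exists>\<eta>s. set \<eta>s \<subseteq> A_ops \<and> w = act \<eta>s \<Longrightarrow> w \<in> op_monoid" by blast
qed

text \<open>Over \<open>(1, 1)\<close> every word is admissible. Over \<open>(1)\<close> a nonempty word is admissible iff it ends in \<open>S\<close>, since
all later compositions have at least two parts.\<close>
lemma op_monoid_parity_words: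
  assumes "\<epsilon> \<in> {0, 1}"
  shows "w \<in> op_monoid_parity \<epsilon> \<longleftrightarrow>
    (\<exists>\<eta>s. admissible_word \<eta>s (base_comp \<epsilon>) \<and> (\<epsilon> = 1 \<longrightarrow> \<eta>s \<noteq> []) \<and> w = act \<eta>s)"
proof (cases "\<epsilon> = 0")
  case True
  then have "admissible_word \<eta>s (base_comp \<epsilon>) \<longleftrightarrow> set \<eta>s \<subseteq> A_ops" for \<eta>s
    using admissible_wordI[of \<eta>s "base_comp \<epsilon>"] admissible_word_letters by (auto simp: base_parts)
  then show ?thesis using True by (simp add: op_monoid_parity_def op_monoid_words)
next
  case False
  then have e: "\<epsilon> = 1" using assms by simp
  have "admissible_word \<eta>s (base_comp \<epsilon>) \<longleftrightarrow> set \<eta>s \<subseteq> A_ops \<and> last \<eta>s \<in> S_ops" if "\<eta>s \<noteq> []" for \<eta>s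
    using admissible_wordI[of \<eta>s "base_comp \<epsilon>"] admissible_word_letters[of \<eta>s "base_comp \<epsilon>"]
      admissible_word_last[of \<eta>s "base_comp \<epsilon>"] that e by (auto simp: base_parts admissible_def)
  then show ?thesis using e by (auto simp: op_monoid_parity_def op_monoid_words ends_with_letter_in_def act_def[symmetric])
qed

theorem theorem5p4:
  fixes \<epsilon> :: nat
  assumes "\<epsilon> \<in> {0, 1}"
  shows "bij_betw (\<lambda>w. w (base_comp \<epsilon>)) (op_monoid_parity \<epsilon>)
    (frobenius_parity TYPE('k::{alg_closed_field, field_char_0}) \<epsilon>)"
proof -
  let ?b = "base_comp \<epsilon>"
  have size_b: "csize ?b = 2 - \<epsilon>" using assms by (auto simp: csize_def base_parts)
  have target: "c \<in> frobenius_parity TYPE('k) \<epsilon> \<longleftrightarrow> (\<exists>n\<ge>1. csize c = 2 * n + \<epsilon>) \<and> frob TYPE('k) c" for c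
    unfolding frobenius_parity_def frobenius_def using lie_index_0_iff_levels_rigid[of c, where 'k = 'k] by auto
  have frob_act: "frob TYPE('k) (act \<eta>s ?b)" if "set \<eta>s \<subseteq> A_ops" for \<eta>s
    using that frob_base[OF assms, where 'k = 'k] frob_op[where 'k = 'k] by (induction \<eta>s) auto
  have "inj_on (\<lambda>w. w ?b) (op_monoid_parity \<epsilon>)"
  proof (rule inj_onI)
    fix v w assume "v \<in> op_monoid_parity \<epsilon>" "w \<in> op_monoid_parity \<epsilon>" and eq: "v ?b = w ?b"
    then obtain \<eta>s \<rho>s where "admissible_word \<eta>s ?b" "v = act \<eta>s" "admissible_word \<rho>s ?b" "w = act \<rho>s"
      using op_monoid_parity_words[OF assms] by blast
    then show "v = w" using admissible_word_inj[of \<eta>s ?b \<rho>s] eq by blast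
  qed
  moreover have "(\<lambda>w. w ?b) ` op_monoid_parity \<epsilon> \<subseteq> frobenius_parity TYPE('k) \<epsilon>"
  proof
    fix c assume "c \<in> (\<lambda>w. w ?b) ` op_monoid_parity \<epsilon>"
    then obtain v where v: "v \<in> op_monoid_parity \<epsilon>" "c = v ?b" by blast
    then obtain \<eta>s where w: "admissible_word \<eta>s ?b" "\<epsilon> = 1 \<longrightarrow> \<eta>s \<noteq> []" "c = act \<eta>s ?b"
      using op_monoid_parity_words[OF assms, of v] by blast
    obtain k where k: "csize c = csize ?b + 2 * k" "\<eta>s \<noteq> [] \<longrightarrow> 0 < k"
      using admissible_word_size[OF w(1)] w(3) by blast
    have "\<exists>n\<ge>1. csize c = 2 * n + \<epsilon>"
    proof (cases "\<epsilon> = 0")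
      case True
      then show ?thesis using k(1) size_b by (intro exI[of _ "k + 1"]) simp
    next
      case False
      then have "\<epsilon> = 1" using assms by simp
      then show ?thesis using k w(2) size_b by (intro exI[of _ k]) simp
    qed
    then show "c \<in> frobenius_parity TYPE('k) \<epsilon>"
      using target frob_act[OF admissible_word_letters[OF w(1)]] w(3) by blast
  qed
  moreover have "frobenius_parity TYPE('k) \<epsilon> \<subseteq> (\<lambda>w. w ?b) ` op_monoid_parity \<epsilon>"
  proof
    fix c assume "c \<in> frobenius_parity TYPE('k) \<epsilon>"
    then obtain n where n: "1 \<le> n" "csize c = 2 * n + \<epsilon>" and "frob TYPE('k) c" using target by blast
    moreover have "csize c mod 2 = \<epsilon>" using n assms by auto
    ultimately obtain \<eta>s where w: "admissible_word \<eta>s ?b" "c = act \<eta>s ?b"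
      using frob_imp_word[where 'k = 'k] by metis
    have "\<epsilon> = 1 \<longrightarrow> \<eta>s \<noteq> []" using w(2) n size_b by auto
    then have "act \<eta>s \<in> op_monoid_parity \<epsilon>" using op_monoid_parity_words[OF assms] w(1) by blast
    then show "c \<in> (\<lambda>w. w ?b) ` op_monoid_parity \<epsilon>" using w(2) by blast
  qed
  ultimately show ?thesis unfolding bij_betw_def by blast
qed

end
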